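(* Let $(A,C,\psi_R,\psi_L)$ be an invertible weak entwining structure over $k$ and let $\mathfrak{C}=\mathrm{Im}\,p_R$ be the $A$-coring corresponding to the weak entwining structure $(A,C,\psi_R)$. Suppose that: (a) $A$ is a right weak entwined module (i.e. a weak entwined module over $(A,C,\psi_R)$, with action given by the product) with coaction $\varrho^A$; (b) $C$ is $k$-flat and projective as a left $C$-comodule; (c) $(A\otimes A)^{\mathrm{co}C}=A\otimes B$, where $B=A^{\mathrm{co}C}$; (d) the map $\widetilde{\mathrm{can}}_A:A\otimes A\to\mathfrak{C}$, $a\otimes b\mapsto\sum ab_{[0]}\otimes b_{[1]}$, is surjective. Then $B\subseteq A$ is a weak coalgebra-Galois $C$-extension and $A$ is $k$-relatively projective as a left $B$-module.
   Context: $k$ is a commutative ring with unit, algebras are associative unital $k$-algebras, coalgebras are coassociative counital $k$-coalgebras, $\otimes=\otimes_k$, $\Delta_C(c)=\sum c_{(1)}\otimes c_{(2)}$. A right-right weak entwining structure is $(A,C,\psi_R)$ with $A$ an algebra, $C$ a coalgebra and $\psi_R:C\otimes A\to A\otimes C$ $k$-linear such that, writing $\psi_R(c\otimes a)=\sum_\alpha a_\alpha\otimes c^\alpha$, for all $a,b\in A$, $c\in C$: $\sum_\alpha(ab)_\alpha\otimes c^\alpha=\sum_{\alpha,\beta}a_\alpha b_\beta\otimes c^{\alpha\beta}$; $\sum_\alpha a_\alpha\varepsilon_C(c^\alpha)=\sum_\alpha\varepsilon_C(c^\alpha)1_\alpha a$; $\sum_\alpha a_\alpha\otimes\Delta_C(c^\alpha)=\sum_{\alpha,\beta}a_{\alpha\beta}\otimes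 c_{(1)}{}^\beta\otimes c_{(2)}{}^\alpha$; $\sum_\alpha 1_\alpha\otimes c^\alpha=\sum_\alpha\varepsilon_C(c_{(1)}{}^\alpha)1_\alpha\otimes c_{(2)}$. A left-left weak entwining structure is $(A,C,\psi_L)$ with $\psi_L:A\otimes C\to C\otimes A$ $k$-linear such that, writing $\psi_L(a\otimes c)=\sum_E c_E\otimes a^E$: $\sum_E c_E\otimes(ab)^E=\sum_{E,F}c_{EF}\otimes a^Fb^E$; $\sum_E\varepsilon_C(c_E)a^E=\sum_E a\,\varepsilon_C(c_E)1^E$; $\sum_E\Delta_C(c_E)\otimes a^E=\sum_{E,F}c_{(1)E}\otimes c_{(2)F}\otimes a^{EF}$; $\sum_E c_E\otimes1^E=\sum_E c_{(1)}\otimes\varepsilon_C(c_{(2)E})1^E$. Associated projections: $p_R:A\otimes C\to A\otimes C$, $p_R(a\otimes c)=\sum_\alpha a1_\alpha\otimes c^\alpha$ and $p_L:C\otimes A\to C\otimes A$, $p_L(c\otimes a)=\sum_E c_E\otimes1^Ea$. An invertible weak entwining structure is a quadruple $(A,C,\psi_R,\psi_L)$ such that (a) $(A,C,\psi_R)$ is a right-right and $(A,C,\psi_L)$ a left-left weak entwining structure; (b) $\psi_R\circ\psi_L=p_R$ and $\psi_L\circ\psi_R=p_L$; (c) $\sum_E\varepsilon_C(c_E)1^E=\sum_\alpha1_\alpha\varepsilon_C(c^\alpha)$ for all $c\in C$. $\mathfrak{C}=\mathrm{Im}\,p_R$ is an $A$-coring with left action $a'(\sum_\alpha a1_\alpha\otimes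 c^\alpha)=\sum_\alpha a'a1_\alpha\otimes c^\alpha$, right action $(\sum_\alpha a'1_\alpha\otimes c^\alpha)a=\sum_{\alpha,\beta}a'1_\alpha a_\beta\otimes c^{\alpha\beta}$, coproduct $\sum_\alpha a1_\alpha\otimes c^\alpha\mapsto\sum_{\alpha,\beta}(a1_\alpha\otimes c_{(1)}{}^\alpha)\otimes_A(1_\beta\otimes c_{(2)}{}^\beta)$ and counit $(A\otimes\varepsilon_C)|_{\mathfrak{C}}$. A weak entwined module over $(A,C,\psi_R)$ is a right $A$-module and right $C$-comodule $M$ with $\varrho^M(ma)=\sum_\alpha m_{[0]}a_\alpha\otimes m_{[1]}{}^\alpha$ for all $m\in M$, $a\in A$, where $\varrho^M(m)=\sum m_{[0]}\otimes m_{[1]}$. $A^{\mathrm{co}C}=\{b\in A\mid\forall a\in A,\ \varrho^A(ba)=b\varrho^A(a)\}$, a subalgebra of $A$. With $g=\varrho^A(1)=\sum1_{[0]}\otimes1_{[1]}\in\mathfrak{C}$ (so that $ga=\varrho^A(a)$), $(A\otimes A)^{\mathrm{co}C}=\{\sum_ia_i\otimes b_i\in A\otimes A\mid\sum_ia_i\otimes gb_i=\sum_ia_i\otimes b_ig\}$, the equality being in $A\otimes\mathfrak{C}$; the condition $(A\otimes A)^{\mathrm{co}C}=A\otimes B$ means that the natural map $A\otimes B\to(A\otimes A)^{\mathrm{co}C}$, $a\otimes b\mapsto a\otimes b$, is an isomorphism. "$C$ is projective as a left $C$-comodule" means that $C$, with coaction $\Delta_C$, is a projective object in the category of left $C$-comodules.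 With $B=A^{\mathrm{co}C}$, the extension $B\subseteq A$ is a (right) weak coalgebra-Galois $C$-extension if the map $\overline{\mathrm{can}}:A\otimes_BA\to A\otimes C$, $a\otimes_Ba'\mapsto a\varrho^A(a')$, is a split monomorphism in the category of left $A$-modules and right $C$-comodules, where $A\otimes_BA$ is a left $A$-module via $\mu\otimes_BA$ ($\mu$ the product of $A$) and a right $C$-comodule via $A\otimes_B\varrho^A$, and $A\otimes C$ is a left $A$-module via $\mu\otimes C$ and a right $C$-comodule via $A\otimes\Delta_C$. A left $B$-module $M$ is $k$-relatively projective if any $B$-module epimorphism $N\to M$ that splits as a $k$-module map splits as a $B$-module map. *)

theory Defs
  imports "HOL-Algebra.Module" "HOL-Algebra.Free_Abelian_Groups"
begin

section \<open>Modules and linear maps\<close>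

text \<open>The library locale \<open>module\<close> requires commutative scalars; this is its analogue over
  an arbitrary ring.\<close>

locale left_module = R?: ring R + M?: abelian_group M for R (structure) and M (structure) +
  assumes act_closed: "\<lbrakk>a \<in> carrier R; x \<in> carrier M\<rbrakk> \<Longrightarrow> a \<odot>\<^bsub>M\<^esub> x \<in> carrier M"
    and act_add_left: "\<lbrakk>a \<in> carrier R; b \<in> carrier R; x \<in> carrier M\<rbrakk>
          \<Longrightarrow> (a \<oplus>\<^bsub>R\<^esub> b) \<odot>\<^bsub>M\<^esub> x = a \<odot>\<^bsub>M\<^esub> x \<oplus>\<^bsub>M\<^esub> b \<odot>\<^bsub>M\<^esub> x"
    and act_add_right: "\<lbrakk>a \<in> carrier R; x \<in> carrier M; y \<in> carrier M\<rbrakk>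
          \<Longrightarrow> a \<odot>\<^bsub>M\<^esub> (x \<oplus>\<^bsub>M\<^esub> y) = a \<odot>\<^bsub>M\<^esub> x \<oplus>\<^bsub>M\<^esub> a \<odot>\<^bsub>M\<^esub> y"
    and act_mult: "\<lbrakk>a \<in> carrier R; b \<in> carrier R; x \<in> carrier M\<rbrakk>
          \<Longrightarrow> (a \<otimes>\<^bsub>R\<^esub> b) \<odot>\<^bsub>M\<^esub> x = a \<odot>\<^bsub>M\<^esub> (b \<odot>\<^bsub>M\<^esub> x)"
    and act_one: "x \<in> carrier M \<Longrightarrow> \<one>\<^bsub>R\<^esub> \<odot>\<^bsub>M\<^esub> x = x"

definition linear_maps ::
  "('r, 'x) ring_scheme \<Rightarrow> ('r, 'm, 'y) module_scheme \<Rightarrow> ('r, 'n, 'z) module_scheme \<Rightarrow> ('m \<Rightarrow> 'n) set"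
  where "linear_maps R M N =
    {f \<in> carrier M \<rightarrow> carrier N.
       (\<forall>x\<in>carrier M. \<forall>y\<in>carrier M. f (x \<oplus>\<^bsub>M\<^esub> y) = f x \<oplus>\<^bsub>N\<^esub> f y) \<and>
       (\<forall>r\<in>carrier R. \<forall>x\<in>carrier M. f (r \<odot>\<^bsub>M\<^esub> x) = r \<odot>\<^bsub>N\<^esub> f x)}"

definition left_regular :: "('a, 'x) ring_scheme \<Rightarrow> ('a, 'a) module"
  where "left_regular A = \<lparr>carrier = carrier A, monoid.mult = (\<otimes>\<^bsub>A\<^esub>), one = \<one>\<^bsub>A\<^esub>,
           ring.zero = \<zero>\<^bsub>A\<^esub>, add = (\<oplus>\<^bsub>A\<^esub>), smult = (\<otimes>\<^bsub>A\<^esub>)\<rparr>"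


section \<open>Tensor products\<close>

text \<open>The tensor product of a right module \<open>M\<close> (action \<open>ra\<close>) and a left module \<open>N\<close> (action \<open>la\<close>)
  over a ring with carrier \<open>R\<close> is the free abelian group on \<open>M \<times> N\<close> modulo the subgroup
  generated by the biadditivity and balancing relations; its elements are cosets of that
  subgroup. Scalars from the ground ring act through the left factor. The fields \<open>mult\<close> and \<open>one\<close>
  of a record that only serves as a module are irrelevant.\<close>

type_synonym ('m, 'n) tens = "('m \<times> 'n \<Rightarrow>\<^sub>0 int) set"

definition tensor_rels ::
  "'r set \<Rightarrow> ('m \<Rightarrow> 'r \<Rightarrow> 'm) \<Rightarrow> ('r \<Rightarrow> 'n \<Rightarrow> 'n) \<Rightarrow> ('m, 'x) ring_scheme \<Rightarrow> ('n, 'y) ring_scheme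
    \<Rightarrow> ('m, 'n) tens"
  where "tensor_rels R ra la M N =
     {frag_of (m \<oplus>\<^bsub>M\<^esub> m', n) - frag_of (m, n) - frag_of (m', n) | m m' n.
        m \<in> carrier M \<and> m' \<in> carrier M \<and> n \<in> carrier N}
   \<union> {frag_of (m, n \<oplus>\<^bsub>N\<^esub> n') - frag_of (m, n) - frag_of (m, n') | m n n'.
        m \<in> carrier M \<and> n \<in> carrier N \<and> n' \<in> carrier N}
   \<union> {frag_of (ra m r, n) - frag_of (m, la r n) | m r n.
        m \<in> carrier M \<and> r \<in> R \<and> n \<in> carrier N}"

definition tensor_over ::
  "'r set \<Rightarrow> ('m \<Rightarrow> 'r \<Rightarrow> 'm) \<Rightarrow> ('r \<Rightarrow> 'n \<Rightarrow> 'n) \<Rightarrow> ('k, 'm, 'x) module_scheme \<Rightarrow> ('n, 'y) ring_scheme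
    \<Rightarrow> ('k, ('m, 'n) tens) module"
  where "tensor_over R ra la M N =
    (let F = free_Abelian_group (carrier M \<times> carrier N);
         H = generate F (tensor_rels R ra la M N)
     in \<lparr>carrier = carrier (F Mod H), monoid.mult = undefined, one = undefined,
         ring.zero = \<one>\<^bsub>F Mod H\<^esub>, add = (\<otimes>\<^bsub>F Mod H\<^esub>),
         smult = (\<lambda>r X. \<Union>x\<in>X. H #>\<^bsub>F\<^esub> frag_extend (\<lambda>(m, n). frag_of (r \<odot>\<^bsub>M\<^esub> m, n)) x)\<rparr>)"

abbreviation tensor ::
  "('k, 'w) ring_scheme \<Rightarrow> ('k, 'm, 'x) module_scheme \<Rightarrow> ('k, 'n, 'y) module_scheme
    \<Rightarrow> ('k, ('m, 'n) tens) module"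
  where "tensor k M N \<equiv>
    tensor_over (carrier k) (\<lambda>m r. r \<odot>\<^bsub>M\<^esub> m) (\<lambda>r n. r \<odot>\<^bsub>N\<^esub> n) M N"

text \<open>The zero of a tensor product \<open>T\<close> is the subgroup of relations itself, so that \<open>T\<close> alone
  determines the class of a pair.\<close>

definition pure_tensor :: "(('m, 'n) tens, 'x) ring_scheme \<Rightarrow> 'm \<Rightarrow> 'n \<Rightarrow> ('m, 'n) tens"
    (infixl \<open>\<boxtimes>\<index>\<close> 75)
  where "m \<boxtimes>\<^bsub>T\<^esub> n = (\<lambda>h. h + frag_of (m, n)) ` \<zero>\<^bsub>T\<^esub>"

definition lin_ext :: "('g, 'x) ring_scheme \<Rightarrow> ('m \<Rightarrow> 'n \<Rightarrow> 'g) \<Rightarrow> ('m \<times> 'n \<Rightarrow>\<^sub>0 int) \<Rightarrow> 'g"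
  where "lin_ext G f x =
    finsum G (\<lambda>(m, n). [Poly_Mapping.lookup x (m, n)] \<cdot>\<^bsub>G\<^esub> f m n) (Poly_Mapping.keys x)"

text \<open>If \<open>X\<close> is the class of \<open>\<Sum>i. m\<^sub>i \<otimes> n\<^sub>i\<close> and \<open>f\<close> is a balanced map into the abelian group
  \<open>G\<close>, then \<open>tsum G X f = (\<Sum>i. f m\<^sub>i n\<^sub>i)\<close>, whatever the representative; see
  \<open>tsum_rep\<close>, \<open>tsum_pure\<close> and \<open>tsum_add\<close>. Every Sweedler-type sum is written in this way.\<close>

definition tsum :: "('g, 'x) ring_scheme \<Rightarrow> ('m, 'n) tens \<Rightarrow> ('m \<Rightarrow> 'n \<Rightarrow> 'g) \<Rightarrow> 'g"
  where "tsum G X f = lin_ext G f (SOME x. x \<in> X)"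

lemma lin_ext_hom:
  assumes G: "abelian_group G" and f: "\<And>m n. (m,n) \<in> S \<Longrightarrow> f m n \<in> carrier G"
  shows "lin_ext G f \<in> hom (free_Abelian_group S) (add_monoid G)"
    and "\<And>m n. (m,n) \<in> S \<Longrightarrow> lin_ext G f (frag_of (m,n)) = f m n"
proof -
  interpret G: abelian_group G by fact
  have im: "(\<lambda>(m, n). f m n) ` S \<subseteq> carrier (add_monoid G)"
    using f by auto
  obtain h where h: "h \<in> hom (free_Abelian_group S) (add_monoid G)"
    and hf: "\<And>p. p \<in> S \<Longrightarrow> h (frag_of p) = (case p of (m, n) \<Rightarrow> f m n)"
    by (rule comm_group.free_Abelian_group_universal[OF G.a_comm_group im]) blast
  interpret H: group_hom "free_Abelian_group S" "add_monoid G" h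
    by (simp add: group_hom_def group_hom_axioms_def h)
  have *: "h (\<Sum>i\<in>T. frag_cmul (c i) (frag_of i)) = finsum G (\<lambda>i. [c i] \<cdot>\<^bsub>G\<^esub> (case i of (m,n) \<Rightarrow> f m n)) T"
    if "finite T" "T \<subseteq> S" for T and c :: "_ \<Rightarrow> int"
    using that
  proof (induction T)
    case empty
    then show ?case using H.hom_one by simp
  next
    case (insert i T)
    have i: "i \<in> S" using insert by simp
    have cl: "(\<Sum>i\<in>T. frag_cmul (c i) (frag_of i)) \<in> carrier (free_Abelian_group S)"
      by (rule sum_closed_free_Abelian_group) (use insert in \<open>auto dest: subsetD[OF keys_cmul]\<close>)
    have cl2: "frag_cmul (c i) (frag_of i) \<in> carrier (free_Abelian_group S)"
      using i by (auto dest: subsetD[OF keys_cmul])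
    have e: "h (frag_cmul (c i) (frag_of i)) = [c i] \<cdot>\<^bsub>G\<^esub> (case i of (m,n) \<Rightarrow> f m n)"
      using H.hom_int_pow[of "frag_of i" "c i"] i hf[OF i]
      by (simp add: add_pow_def)
    have ff: "(\<lambda>i. [c i] \<cdot>\<^bsub>G\<^esub> (case i of (m,n) \<Rightarrow> f m n)) \<in> insert i T \<rightarrow> carrier G"
      using insert.prems f by (fastforce intro!: G.add.int_pow_closed split: prod.splits)
    show ?case
      using insert.hyps insert.IH insert.prems H.hom_mult[OF cl2 cl] e ff
      by (auto simp: G.finsum_insert)
  qed
  have eq: "h x = lin_ext G f x" if "Poly_Mapping.keys x \<subseteq> S" for x
  proof -
    have "x = (\<Sum>i\<in>Poly_Mapping.keys x. frag_cmul (Poly_Mapping.lookup x i) (frag_of i))"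
      using frag_expansion[of x] by (simp add: frag_extend_def)
    then have "h x = h (\<Sum>i\<in>Poly_Mapping.keys x. frag_cmul (Poly_Mapping.lookup x i) (frag_of i))" by simp
    also have "\<dots> = lin_ext G f x" unfolding lin_ext_def
      using *[OF finite_keys that, of "Poly_Mapping.lookup x"] by (simp add: split_def)
    finally show ?thesis .
  qed
  have eq': "lin_ext G f x = h x" if "x \<in> carrier (free_Abelian_group S)" for x
    using eq[of x] that by simp
  show "lin_ext G f \<in> hom (free_Abelian_group S) (add_monoid G)"
  proof (rule homI)
    fix x y assume x: "x \<in> carrier (free_Abelian_group S)" and y: "y \<in> carrier (free_Abelian_group S)"
    show "lin_ext G f x \<in> carrier (add_monoid G)"
      unfolding eq'[OF x] by (rule H.hom_closed[OF x])
    have "x \<otimes>\<^bsub>free_Abelian_group S\<^esub> y \<in> carrier (free_Abelian_group S)"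
      by (rule H.G.m_closed[OF x y])
    from eq'[OF this] H.hom_mult[OF x y] eq'[OF x] eq'[OF y]
    show "lin_ext G f (x \<otimes>\<^bsub>free_Abelian_group S\<^esub> y)
        = lin_ext G f x \<otimes>\<^bsub>add_monoid G\<^esub> lin_ext G f y"
      by (simp only:)
  qed
  show "lin_ext G f (frag_of (m,n)) = f m n" if "(m,n) \<in> S" for m n
    using eq[of "frag_of (m,n)"] hf[OF that] that by simp
qed

lemma tensor_rels_subset:
  assumes "abelian_group M" "abelian_group N"
    and ra: "\<And>m r. \<lbrakk>m \<in> carrier M; r \<in> R\<rbrakk> \<Longrightarrow> ra m r \<in> carrier M"
    and la: "\<And>r n. \<lbrakk>r \<in> R; n \<in> carrier N\<rbrakk> \<Longrightarrow> la r n \<in> carrier N"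
  shows "tensor_rels R ra la M N \<subseteq> carrier (free_Abelian_group (carrier M \<times> carrier N))"
proof -
  interpret M: abelian_group M by fact
  interpret N: abelian_group N by fact
  let ?F = "free_Abelian_group (carrier M \<times> carrier N)"
  have d: "x - y \<in> carrier ?F" if "x \<in> carrier ?F" "y \<in> carrier ?F" for x y
    using keys_diff[of x y] that by auto
  have p: "frag_of (m, n) \<in> carrier ?F" if "m \<in> carrier M" "n \<in> carrier N" for m n
    using that by simp
  show ?thesis
    unfolding tensor_rels_def
    by (auto simp: ra la simp del: carrier_free_Abelian_group_iff intro!: d p)
qed

context
  fixes R :: "'r set" and ra :: "'m \<Rightarrow> 'r \<Rightarrow> 'm" and la :: "'r \<Rightarrow> 'n \<Rightarrow> 'n"
    and M :: "('k, 'm, 'x) module_scheme" and N :: "('n, 'y) ring_scheme"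
    and G :: "('g, 'z) ring_scheme" and f :: "'m \<Rightarrow> 'n \<Rightarrow> 'g"
  assumes M: "abelian_group M" and N: "abelian_group N" and G: "abelian_group G"
    and ra: "\<And>m r. \<lbrakk>m \<in> carrier M; r \<in> R\<rbrakk> \<Longrightarrow> ra m r \<in> carrier M"
    and la: "\<And>r n. \<lbrakk>r \<in> R; n \<in> carrier N\<rbrakk> \<Longrightarrow> la r n \<in> carrier N"
    and f: "\<And>m n. \<lbrakk>m \<in> carrier M; n \<in> carrier N\<rbrakk> \<Longrightarrow> f m n \<in> carrier G"
    and f_left: "\<And>m m' n. \<lbrakk>m \<in> carrier M; m' \<in> carrier M; n \<in> carrier N\<rbrakk>
      \<Longrightarrow> f (m \<oplus>\<^bsub>M\<^esub> m') n = f m n \<oplus>\<^bsub>G\<^esub> f m' n"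
    and f_right: "\<And>m n n'. \<lbrakk>m \<in> carrier M; n \<in> carrier N; n' \<in> carrier N\<rbrakk>
      \<Longrightarrow> f m (n \<oplus>\<^bsub>N\<^esub> n') = f m n \<oplus>\<^bsub>G\<^esub> f m n'"
    and f_balanced: "\<And>m r n. \<lbrakk>m \<in> carrier M; r \<in> R; n \<in> carrier N\<rbrakk> \<Longrightarrow> f (ra m r) n = f m (la r n)"
begin

lemma lin_ext_rels:
  assumes "x \<in> generate (free_Abelian_group (carrier M \<times> carrier N)) (tensor_rels R ra la M N)"
  shows "x \<in> carrier (free_Abelian_group (carrier M \<times> carrier N)) \<and> lin_ext G f x = \<zero>\<^bsub>G\<^esub>"
proof -
  let ?F = "free_Abelian_group (carrier M \<times> carrier N)"
  interpret G: abelian_group G by (rule G)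
  interpret M: abelian_group M by (rule M)
  interpret N: abelian_group N by (rule N)
  have S: "f m n \<in> carrier G" if "(m, n) \<in> carrier M \<times> carrier N" for m n
    using that f by auto
  interpret H: group_hom ?F "add_monoid G" "lin_ext G f"
    using lin_ext_hom(1)[of G "carrier M \<times> carrier N" f, OF G S] G.add.is_group by (simp add: group_hom_def group_hom_axioms_def)
  have fo: "lin_ext G f (frag_of (m, n)) = f m n" if "m \<in> carrier M" "n \<in> carrier N" for m n
    by (rule lin_ext_hom(2)[OF G, of "carrier M \<times> carrier N"]) (use f that in auto)
  have diff: "lin_ext G f (u - v) = lin_ext G f u \<ominus>\<^bsub>G\<^esub> lin_ext G f v"
    if "u \<in> carrier ?F" "v \<in> carrier ?F" for u v
    using H.hom_mult[of u "-v"] H.hom_inv[of v] that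
    by (simp add: a_minus_def a_inv_def)
  have rel: "lin_ext G f x = \<zero>\<^bsub>G\<^esub>" if "x \<in> tensor_rels R ra la M N" for x
  proof -
    have ss: "Poly_Mapping.keys (u - v) \<subseteq> S" if "Poly_Mapping.keys u \<subseteq> S" "Poly_Mapping.keys v \<subseteq> S"
      for u v :: "'m \<times> 'n \<Rightarrow>\<^sub>0 int" and S using that keys_diff[of u v] by blast
    have z: "a \<oplus>\<^bsub>G\<^esub> (b \<oplus>\<^bsub>G\<^esub> (\<ominus>\<^bsub>G\<^esub> a \<oplus>\<^bsub>G\<^esub> \<ominus>\<^bsub>G\<^esub> b)) = \<zero>\<^bsub>G\<^esub>"
      if "a \<in> carrier G" "b \<in> carrier G" for a b
      using that by (metis G.a_assoc G.add.inv_closed G.add.m_closed G.minus_add G.r_neg)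
    show ?thesis
      using that unfolding tensor_rels_def
      by (auto simp: diff ss fo f f_left f_right f_balanced ra la G.minus_eq G.a_ac G.r_neg
          G.r_neg1 G.r_neg2 G.minus_add z)
  qed
  have sub: "tensor_rels R ra la M N \<subseteq> carrier ?F"
    by (rule tensor_rels_subset[OF M N ra la])
  from assms show ?thesis
  proof induction
    case (eng u v)
    then have "u + v \<in> carrier ?F"
      using group.subgroup_self[OF group_free_Abelian_group] subgroup.m_closed
      by (metis mult_free_Abelian_group)
    then show ?case using H.hom_mult[of u v] eng by simp
  next
    case (inv u)
    moreover have "u \<in> carrier ?F"
      by (rule subsetD[OF sub inv])
    ultimately show ?case
      using H.hom_inv[of u] rel[OF inv] group.inv_closed[OF group_free_Abelian_group, of u]
      by (simp add: a_inv_def[symmetric] del: inv_free_Abelian_group carrier_free_Abelian_group_iff)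
  next
    case one
    then show ?case using H.hom_one by simp
  next
    case (incl u)
    then show ?case using rel subsetD[OF sub] by blast
  qed
qed

lemma tsum_rep:
  assumes X: "X \<in> carrier (tensor_over R ra la M N)" and x: "x \<in> X"
  shows "tsum G X f = lin_ext G f x"
proof -
  let ?F = "free_Abelian_group (carrier M \<times> carrier N)"
  let ?H = "generate ?F (tensor_rels R ra la M N)"
  interpret G: abelian_group G by (rule G)
  have S: "f m n \<in> carrier G" if "(m, n) \<in> carrier M \<times> carrier N" for m n
    using that f by auto
  interpret L: group_hom ?F "add_monoid G" "lin_ext G f"
    using lin_ext_hom(1)[of G "carrier M \<times> carrier N" f, OF G S] G.add.is_group by (simp add: group_hom_def group_hom_axioms_def)
  obtain w where w: "w \<in> carrier ?F" and Xw: "X = ?H #>\<^bsub>?F\<^esub> w"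
    using X by (auto simp: tensor_over_def Let_def FactGroup_def RCOSETS_def)
  have "lin_ext G f y = lin_ext G f w" if y: "y \<in> X" for y
  proof -
    obtain h where h: "h \<in> ?H" "y = h + w"
      using y Xw by (auto simp: r_coset_def)
    with lin_ext_rels[OF h(1)] L.hom_mult[of h w] w L.hom_closed[OF w] show ?thesis by simp
  qed
  moreover have "(SOME x. x \<in> X) \<in> X"
    using x by (rule someI)
  ultimately show ?thesis
    unfolding tsum_def using x by metis
qed

lemma tsum_pure:
  assumes "m \<in> carrier M" "n \<in> carrier N"
  defines "T \<equiv> tensor_over R ra la M N"
  shows "m \<boxtimes>\<^bsub>T\<^esub> n \<in> carrier T" and "tsum G (m \<boxtimes>\<^bsub>T\<^esub> n) f = f m n"
proof -
  let ?F = "free_Abelian_group (carrier M \<times> carrier N)"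
  let ?H = "generate ?F (tensor_rels R ra la M N)"
  have mem: "frag_of (m, n) \<in> m \<boxtimes>\<^bsub>T\<^esub> n"
    by (auto simp: pure_tensor_def T_def tensor_over_def Let_def image_iff
        intro!: bexI[of _ 0] generate.one[of ?F, simplified])
  have "m \<boxtimes>\<^bsub>T\<^esub> n = ?H #>\<^bsub>?F\<^esub> frag_of (m, n)"
    by (auto simp: pure_tensor_def T_def tensor_over_def Let_def r_coset_def)
  then show *: "m \<boxtimes>\<^bsub>T\<^esub> n \<in> carrier T"
    using assms(1,2) by (auto simp: T_def tensor_over_def Let_def FactGroup_def RCOSETS_def)
  have S: "f m n \<in> carrier G" if "(m, n) \<in> carrier M \<times> carrier N" for m n
    using that f by auto
  show "tsum G (m \<boxtimes>\<^bsub>T\<^esub> n) f = f m n"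
    using tsum_rep[OF *[unfolded T_def] mem[unfolded T_def]] lin_ext_hom(2)[of G "carrier M \<times> carrier N" f, OF G S] assms by simp
qed

lemma tsum_add:
  defines "T \<equiv> tensor_over R ra la M N"
  assumes X: "X \<in> carrier T" and Y: "Y \<in> carrier T"
  shows "tsum G (X \<oplus>\<^bsub>T\<^esub> Y) f = tsum G X f \<oplus>\<^bsub>G\<^esub> tsum G Y f"
proof -
  let ?F = "free_Abelian_group (carrier M \<times> carrier N)"
  let ?H = "generate ?F (tensor_rels R ra la M N)"
  interpret F: comm_group ?F by (rule abelian_free_Abelian_group)
  interpret G: abelian_group G by (rule G)
  have S: "f m n \<in> carrier G" if "(m, n) \<in> carrier M \<times> carrier N" for m n
    using that f by auto
  interpret L: group_hom ?F "add_monoid G" "lin_ext G f"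
    using lin_ext_hom(1)[of G "carrier M \<times> carrier N" f, OF G S] G.add.is_group by (simp add: group_hom_def group_hom_axioms_def)
  have sub: "subgroup ?H ?F"
    by (rule F.generate_is_subgroup[OF tensor_rels_subset[OF M N ra la]])
  interpret N: normal ?H ?F
    using F.subgroup_imp_normal[OF sub] .
  obtain x where x: "x \<in> carrier ?F" "X = ?H #>\<^bsub>?F\<^esub> x"
    using X by (auto simp: T_def tensor_over_def Let_def FactGroup_def RCOSETS_def)
  obtain y where y: "y \<in> carrier ?F" "Y = ?H #>\<^bsub>?F\<^esub> y"
    using Y by (auto simp: T_def tensor_over_def Let_def FactGroup_def RCOSETS_def)
  have XY: "X \<oplus>\<^bsub>T\<^esub> Y = ?H #>\<^bsub>?F\<^esub> (x + y)"
    using N.rcos_sum[OF x(1) y(1)] x y by (simp add: T_def tensor_over_def Let_def)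
  have xy: "x + y \<in> carrier ?F" using F.m_closed[OF x(1) y(1)] by simp
  have XYc: "X \<oplus>\<^bsub>T\<^esub> Y \<in> carrier T"
    unfolding XY unfolding T_def tensor_over_def Let_def FactGroup_def RCOSETS_def using xy by (simp del: carrier_free_Abelian_group_iff) blast
  have m: "x \<in> X" "y \<in> Y" "x + y \<in> X \<oplus>\<^bsub>T\<^esub> Y"
    using F.rcos_self[OF x(1) sub] F.rcos_self[OF y(1) sub] F.rcos_self[OF xy sub] x y XY by auto
  show ?thesis
    using tsum_rep[OF X[unfolded T_def] m(1)] tsum_rep[OF Y[unfolded T_def] m(2)]
      tsum_rep[OF XYc[unfolded T_def] m(3)[unfolded T_def]] L.hom_mult[OF x(1) y(1)]
    by (simp add: T_def)
qed

end


section \<open>Algebras, coalgebras, modules and comodules over \<open>k\<close>\<close>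

text \<open>The library locale \<open>algebra\<close> requires a commutative multiplication.\<close>

locale assoc_algebra = module k A + ring A
  for k :: "('k, 'w) ring_scheme" and A :: "('k, 'a, 'x) module_scheme" +
  assumes smult_mult_left: "\<lbrakk>r \<in> carrier k; x \<in> carrier A; y \<in> carrier A\<rbrakk>
      \<Longrightarrow> r \<odot>\<^bsub>A\<^esub> (x \<otimes>\<^bsub>A\<^esub> y) = (r \<odot>\<^bsub>A\<^esub> x) \<otimes>\<^bsub>A\<^esub> y"
    and smult_mult_right: "\<lbrakk>r \<in> carrier k; x \<in> carrier A; y \<in> carrier A\<rbrakk>
      \<Longrightarrow> r \<odot>\<^bsub>A\<^esub> (x \<otimes>\<^bsub>A\<^esub> y) = x \<otimes>\<^bsub>A\<^esub> (r \<odot>\<^bsub>A\<^esub> y)"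

record ('k, 'c) coalgebra = "('k, 'c) module" +
  comult :: "'c \<Rightarrow> ('c, 'c) tens"
  counit :: "'c \<Rightarrow> 'k"

locale coalgebra = module k C
  for k :: "('k, 'w) ring_scheme" and C :: "('k, 'c, 'y) coalgebra_scheme" (structure) +
  assumes comult_linear: "comult C \<in> linear_maps k C (tensor k C C)"
    and counit_linear: "counit C \<in> linear_maps k C (left_regular k)"
    and coassoc: "c \<in> carrier C \<Longrightarrow>
      (let T = tensor k C (tensor k C C) in
        tsum T (comult C c) (\<lambda>c1 c2. tsum T (comult C c1) (\<lambda>d e. d \<boxtimes>\<^bsub>T\<^esub> (e \<boxtimes>\<^bsub>tensor k C C\<^esub> c2)))
      = tsum T (comult C c) (\<lambda>c1 c2. c1 \<boxtimes>\<^bsub>T\<^esub> comult C c2))"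
    and counit_left: "c \<in> carrier C \<Longrightarrow> tsum C (comult C c) (\<lambda>c1 c2. counit C c1 \<odot>\<^bsub>C\<^esub> c2) = c"
    and counit_right: "c \<in> carrier C \<Longrightarrow> tsum C (comult C c) (\<lambda>c1 c2. counit C c2 \<odot>\<^bsub>C\<^esub> c1) = c"

locale right_algebra_module = assoc_algebra k A + M: module k M
  for k :: "('k, 'w) ring_scheme" and A :: "('k, 'a, 'x) module_scheme" and M :: "('k, 'm, 'z) module_scheme" +
  fixes ra :: "'m \<Rightarrow> 'a \<Rightarrow> 'm"
  assumes ra_closed: "\<lbrakk>m \<in> carrier M; a \<in> carrier A\<rbrakk> \<Longrightarrow> ra m a \<in> carrier M"
    and ra_add_left: "\<lbrakk>m \<in> carrier M; m' \<in> carrier M; a \<in> carrier A\<rbrakk>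
      \<Longrightarrow> ra (m \<oplus>\<^bsub>M\<^esub> m') a = ra m a \<oplus>\<^bsub>M\<^esub> ra m' a"
    and ra_add_right: "\<lbrakk>m \<in> carrier M; a \<in> carrier A; b \<in> carrier A\<rbrakk>
      \<Longrightarrow> ra m (a \<oplus>\<^bsub>A\<^esub> b) = ra m a \<oplus>\<^bsub>M\<^esub> ra m b"
    and ra_smult_left: "\<lbrakk>r \<in> carrier k; m \<in> carrier M; a \<in> carrier A\<rbrakk>
      \<Longrightarrow> ra (r \<odot>\<^bsub>M\<^esub> m) a = r \<odot>\<^bsub>M\<^esub> ra m a"
    and ra_smult_right: "\<lbrakk>r \<in> carrier k; m \<in> carrier M; a \<in> carrier A\<rbrakk>
      \<Longrightarrow> ra m (r \<odot>\<^bsub>A\<^esub> a) = r \<odot>\<^bsub>M\<^esub> ra m a"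
    and ra_mult: "\<lbrakk>m \<in> carrier M; a \<in> carrier A; b \<in> carrier A\<rbrakk>
      \<Longrightarrow> ra m (a \<otimes>\<^bsub>A\<^esub> b) = ra (ra m a) b"
    and ra_one: "m \<in> carrier M \<Longrightarrow> ra m \<one>\<^bsub>A\<^esub> = m"

locale right_comodule = coalgebra k C + M: module k M
  for k :: "('k, 'w) ring_scheme" and C :: "('k, 'c, 'y) coalgebra_scheme" (structure)
    and M :: "('k, 'm, 'z) module_scheme" +
  fixes \<rho> :: "'m \<Rightarrow> ('m, 'c) tens"
  assumes rcoact_linear: "\<rho> \<in> linear_maps k M (tensor k M C)"
    and rcoact_coassoc: "m \<in> carrier M \<Longrightarrow>
      (let T = tensor k M (tensor k C C) in
        tsum T (\<rho> m) (\<lambda>m0 m1. tsum T (\<rho> m0) (\<lambda>n d. n \<boxtimes>\<^bsub>T\<^esub> (d \<boxtimes>\<^bsub>tensor k C C\<^esub> m1)))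
      = tsum T (\<rho> m) (\<lambda>m0 m1. m0 \<boxtimes>\<^bsub>T\<^esub> comult C m1))"
    and rcoact_counit: "m \<in> carrier M \<Longrightarrow> tsum M (\<rho> m) (\<lambda>m0 m1. counit C m1 \<odot>\<^bsub>M\<^esub> m0) = m"

locale left_comodule = coalgebra k C + M: module k M
  for k :: "('k, 'w) ring_scheme" and C :: "('k, 'c, 'y) coalgebra_scheme" (structure)
    and M :: "('k, 'm, 'z) module_scheme" +
  fixes \<gamma>M :: "'m \<Rightarrow> ('c, 'm) tens"
  assumes lcoact_linear: "\<gamma>M \<in> linear_maps k M (tensor k C M)"
    and lcoact_coassoc: "m \<in> carrier M \<Longrightarrow>
      (let T = tensor k (tensor k C C) M in
        tsum T (\<gamma>M m) (\<lambda>c n. tsum T (\<gamma>M n) (\<lambda>d n'. (c \<boxtimes>\<^bsub>tensor k C C\<^esub> d) \<boxtimes>\<^bsub>T\<^esub> n'))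
      = tsum T (\<gamma>M m) (\<lambda>c n. comult C c \<boxtimes>\<^bsub>T\<^esub> n))"
    and lcoact_counit: "m \<in> carrier M \<Longrightarrow> tsum M (\<gamma>M m) (\<lambda>c n. counit C c \<odot>\<^bsub>M\<^esub> n) = m"


section \<open>Flatness and projectivity\<close>

text \<open>HOL does not quantify over types inside a formula, so notions that quantify over all
  (co)modules carry a type argument: the test objects are those whose carrier is a subset of that
  type. When such a notion is a hypothesis, the type has to be large enough. Flatness over \<open>k\<close>
  is detected by the inclusions of the ideals of \<open>k\<close>. For flat \<open>C\<close>, every subset of a left
  \<open>C\<close>-comodule of cardinality at most \<open>\<kappa> = max |k| |C| \<aleph>\<^sub>0\<close> is contained in a subcomodule of
  cardinality at most \<open>\<kappa>\<close>, so projectivity of \<open>C\<close> is detected by the comodules of cardinality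
  at most \<open>\<kappa>\<close>. Any type of cardinality at least \<open>\<kappa>\<close> therefore gives the unrestricted notions.\<close>

definition flat_module ::
  "'u itself \<Rightarrow> ('k, 'w) ring_scheme \<Rightarrow> ('k, 'c, 'x) module_scheme \<Rightarrow> bool"
  where "flat_module U k C \<longleftrightarrow>
    (\<forall>(M :: ('k, 'u) module) (N :: ('k, 'u) module) f.
       module k M \<and> module k N \<and> f \<in> linear_maps k M N \<and> inj_on f (carrier M) \<longrightarrow>
       inj_on (\<lambda>X. tsum (tensor k N C) X (\<lambda>m c. f m \<boxtimes>\<^bsub>tensor k N C\<^esub> c)) (carrier (tensor k M C)))"

definition left_comodule_hom ::
  "('k, 'w) ring_scheme \<Rightarrow> ('k, 'c, 'x) coalgebra_scheme
    \<Rightarrow> ('k, 'm, 'y) module_scheme \<Rightarrow> ('m \<Rightarrow> ('c, 'm) tens)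
    \<Rightarrow> ('k, 'n, 'z) module_scheme \<Rightarrow> ('n \<Rightarrow> ('c, 'n) tens) \<Rightarrow> ('m \<Rightarrow> 'n) \<Rightarrow> bool"
  where "left_comodule_hom k C M \<gamma>M N \<gamma>N f \<longleftrightarrow>
    f \<in> linear_maps k M N \<and>
    (\<forall>m\<in>carrier M. \<gamma>N (f m) = tsum (tensor k C N) (\<gamma>M m) (\<lambda>c x. c \<boxtimes>\<^bsub>tensor k C N\<^esub> f x))"

definition left_comodule_epi ::
  "('k, 'w) ring_scheme \<Rightarrow> ('k, 'c, 'x) coalgebra_scheme
    \<Rightarrow> ('k, 'u) module \<Rightarrow> ('u \<Rightarrow> ('c, 'u) tens)
    \<Rightarrow> ('k, 'u) module \<Rightarrow> ('u \<Rightarrow> ('c, 'u) tens) \<Rightarrow> ('u \<Rightarrow> 'u) \<Rightarrow> bool"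
  where "left_comodule_epi k C M \<gamma>M N \<gamma>N f \<longleftrightarrow>
    left_comodule_hom k C M \<gamma>M N \<gamma>N f \<and>
    (\<forall>(Q :: ('k, 'u) module) \<gamma>Q g h.
       left_comodule k C Q \<gamma>Q \<and> left_comodule_hom k C N \<gamma>N Q \<gamma>Q g \<and> left_comodule_hom k C N \<gamma>N Q \<gamma>Q h \<and>
       (\<forall>m\<in>carrier M. g (f m) = h (f m)) \<longrightarrow> (\<forall>n\<in>carrier N. g n = h n))"

definition projective_left_comodule ::
  "'u itself \<Rightarrow> ('k, 'w) ring_scheme \<Rightarrow> ('k, 'c, 'x) coalgebra_scheme
    \<Rightarrow> ('k, 'm, 'y) module_scheme \<Rightarrow> ('m \<Rightarrow> ('c, 'm) tens) \<Rightarrow> bool"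
  where "projective_left_comodule U k C P \<gamma>P \<longleftrightarrow>
    left_comodule k C P \<gamma>P \<and>
    (\<forall>(M :: ('k, 'u) module) \<gamma>M (N :: ('k, 'u) module) \<gamma>N q f.
       left_comodule k C M \<gamma>M \<and> left_comodule k C N \<gamma>N \<and>
       left_comodule_epi k C M \<gamma>M N \<gamma>N q \<and> left_comodule_hom k C P \<gamma>P N \<gamma>N f \<longrightarrow>
       (\<exists>h. left_comodule_hom k C P \<gamma>P M \<gamma>M h \<and> (\<forall>p\<in>carrier P. q (h p) = f p)))"

text \<open>A module over a \<open>k\<close>-algebra \<open>B\<close>, viewed as a \<open>k\<close>-module.\<close>

definition restrict_scalars ::
  "('k, 'b, 'x) module_scheme \<Rightarrow> ('b, 'n, 'y) module_scheme \<Rightarrow> ('k, 'n) module"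
  where "restrict_scalars B N = \<lparr>carrier = carrier N, monoid.mult = (\<otimes>\<^bsub>N\<^esub>), one = \<one>\<^bsub>N\<^esub>,
           ring.zero = \<zero>\<^bsub>N\<^esub>, add = (\<oplus>\<^bsub>N\<^esub>), smult = (\<lambda>r n. (r \<odot>\<^bsub>B\<^esub> \<one>\<^bsub>B\<^esub>) \<odot>\<^bsub>N\<^esub> n)\<rparr>"

definition relatively_projective ::
  "'n itself \<Rightarrow> ('k, 'w) ring_scheme \<Rightarrow> ('k, 'b, 'x) module_scheme \<Rightarrow> ('b, 'm, 'y) module_scheme \<Rightarrow> bool"
  where "relatively_projective U k B M \<longleftrightarrow>
    left_module B M \<and>
    (\<forall>(N :: ('b, 'n) module) p.
       left_module B N \<and> p \<in> linear_maps B N M \<and> p ` carrier N = carrier M \<and>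
       (\<exists>s \<in> linear_maps k (restrict_scalars B M) (restrict_scalars B N). \<forall>m\<in>carrier M. p (s m) = m) \<longrightarrow>
       (\<exists>t \<in> linear_maps B M N. \<forall>m\<in>carrier M. p (t m) = m))"


section \<open>Weak entwining structures\<close>

locale weak_entwining_rr = assoc_algebra k A + C: coalgebra k C
  for k :: "('k, 'w) ring_scheme" and A :: "('k, 'a, 'x) module_scheme"
    and C :: "('k, 'c, 'y) coalgebra_scheme" (structure) +
  fixes \<psi> :: "('c, 'a) tens \<Rightarrow> ('a, 'c) tens"
  assumes psi_linear: "\<psi> \<in> linear_maps k (tensor k C A) (tensor k A C)"
    and psi_mult: "\<lbrakk>a \<in> carrier A; b \<in> carrier A; c \<in> carrier C\<rbrakk> \<Longrightarrow>
      \<psi> (c \<boxtimes>\<^bsub>tensor k C A\<^esub> (a \<otimes>\<^bsub>A\<^esub> b)) =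
      tsum (tensor k A C) (\<psi> (c \<boxtimes>\<^bsub>tensor k C A\<^esub> a)) (\<lambda>a' c'.
        tsum (tensor k A C) (\<psi> (c' \<boxtimes>\<^bsub>tensor k C A\<^esub> b)) (\<lambda>b' c''. (a' \<otimes>\<^bsub>A\<^esub> b') \<boxtimes>\<^bsub>tensor k A C\<^esub> c''))"
    and psi_counit: "\<lbrakk>a \<in> carrier A; c \<in> carrier C\<rbrakk> \<Longrightarrow>
      tsum A (\<psi> (c \<boxtimes>\<^bsub>tensor k C A\<^esub> a)) (\<lambda>a' c'. counit C c' \<odot>\<^bsub>A\<^esub> a') =
      tsum A (\<psi> (c \<boxtimes>\<^bsub>tensor k C A\<^esub> \<one>\<^bsub>A\<^esub>)) (\<lambda>e c'. counit C c' \<odot>\<^bsub>A\<^esub> (e \<otimes>\<^bsub>A\<^esub> a))"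
    and psi_comult: "\<lbrakk>a \<in> carrier A; c \<in> carrier C\<rbrakk> \<Longrightarrow>
      (let T = tensor k A (tensor k C C) in
        tsum T (\<psi> (c \<boxtimes>\<^bsub>tensor k C A\<^esub> a)) (\<lambda>a' c'. a' \<boxtimes>\<^bsub>T\<^esub> comult C c') =
        tsum T (comult C c) (\<lambda>c1 c2.
          tsum T (\<psi> (c2 \<boxtimes>\<^bsub>tensor k C A\<^esub> a)) (\<lambda>a' c2'.
            tsum T (\<psi> (c1 \<boxtimes>\<^bsub>tensor k C A\<^esub> a')) (\<lambda>a'' c1'. a'' \<boxtimes>\<^bsub>T\<^esub> (c1' \<boxtimes>\<^bsub>tensor k C C\<^esub> c2')))))"
    and psi_one: "c \<in> carrier C \<Longrightarrow>
      \<psi> (c \<boxtimes>\<^bsub>tensor k C A\<^esub> \<one>\<^bsub>A\<^esub>) =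
      tsum (tensor k A C) (comult C c) (\<lambda>c1 c2.
        tsum (tensor k A C) (\<psi> (c1 \<boxtimes>\<^bsub>tensor k C A\<^esub> \<one>\<^bsub>A\<^esub>)) (\<lambda>e c1'.
          (counit C c1' \<odot>\<^bsub>A\<^esub> e) \<boxtimes>\<^bsub>tensor k A C\<^esub> c2))"

locale weak_entwining_ll = assoc_algebra k A + C: coalgebra k C
  for k :: "('k, 'w) ring_scheme" and A :: "('k, 'a, 'x) module_scheme"
    and C :: "('k, 'c, 'y) coalgebra_scheme" (structure) +
  fixes \<psi> :: "('a, 'c) tens \<Rightarrow> ('c, 'a) tens"
  assumes psi_linear: "\<psi> \<in> linear_maps k (tensor k A C) (tensor k C A)"
    and psi_mult: "\<lbrakk>a \<in> carrier A; b \<in> carrier A; c \<in> carrier C\<rbrakk> \<Longrightarrow>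
      \<psi> ((a \<otimes>\<^bsub>A\<^esub> b) \<boxtimes>\<^bsub>tensor k A C\<^esub> c) =
      tsum (tensor k C A) (\<psi> (b \<boxtimes>\<^bsub>tensor k A C\<^esub> c)) (\<lambda>c' b'.
        tsum (tensor k C A) (\<psi> (a \<boxtimes>\<^bsub>tensor k A C\<^esub> c')) (\<lambda>c'' a'. c'' \<boxtimes>\<^bsub>tensor k C A\<^esub> (a' \<otimes>\<^bsub>A\<^esub> b')))"
    and psi_counit: "\<lbrakk>a \<in> carrier A; c \<in> carrier C\<rbrakk> \<Longrightarrow>
      tsum A (\<psi> (a \<boxtimes>\<^bsub>tensor k A C\<^esub> c)) (\<lambda>c' a'. counit C c' \<odot>\<^bsub>A\<^esub> a') =
      tsum A (\<psi> (\<one>\<^bsub>A\<^esub> \<boxtimes>\<^bsub>tensor k A C\<^esub> c)) (\<lambda>c' e. counit C c' \<odot>\<^bsub>A\<^esub> (a \<otimes>\<^bsub>A\<^esub> e))"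
    and psi_comult: "\<lbrakk>a \<in> carrier A; c \<in> carrier C\<rbrakk> \<Longrightarrow>
      (let T = tensor k (tensor k C C) A in
        tsum T (\<psi> (a \<boxtimes>\<^bsub>tensor k A C\<^esub> c)) (\<lambda>c' a'. comult C c' \<boxtimes>\<^bsub>T\<^esub> a') =
        tsum T (comult C c) (\<lambda>c1 c2.
          tsum T (\<psi> (a \<boxtimes>\<^bsub>tensor k A C\<^esub> c1)) (\<lambda>c1' a'.
            tsum T (\<psi> (a' \<boxtimes>\<^bsub>tensor k A C\<^esub> c2)) (\<lambda>c2' a''. (c1' \<boxtimes>\<^bsub>tensor k C C\<^esub> c2') \<boxtimes>\<^bsub>T\<^esub> a''))))"
    and psi_one: "c \<in> carrier C \<Longrightarrow>
      \<psi> (\<one>\<^bsub>A\<^esub> \<boxtimes>\<^bsub>tensor k A C\<^esub> c) =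
      tsum (tensor k C A) (comult C c) (\<lambda>c1 c2.
        tsum (tensor k C A) (\<psi> (\<one>\<^bsub>A\<^esub> \<boxtimes>\<^bsub>tensor k A C\<^esub> c2)) (\<lambda>c2' e.
          c1 \<boxtimes>\<^bsub>tensor k C A\<^esub> (counit C c2' \<odot>\<^bsub>A\<^esub> e)))"

definition proj_right ::
  "('k, 'w) ring_scheme \<Rightarrow> ('k, 'a, 'x) module_scheme \<Rightarrow> ('k, 'c, 'y) coalgebra_scheme
    \<Rightarrow> (('c, 'a) tens \<Rightarrow> ('a, 'c) tens) \<Rightarrow> ('a, 'c) tens \<Rightarrow> ('a, 'c) tens"
  where "proj_right k A C \<psi>R X =
    tsum (tensor k A C) X (\<lambda>a c.
      tsum (tensor k A C) (\<psi>R (c \<boxtimes>\<^bsub>tensor k C A\<^esub> \<one>\<^bsub>A\<^esub>)) (\<lambda>e c'. (a \<otimes>\<^bsub>A\<^esub> e) \<boxtimes>\<^bsub>tensor k A C\<^esub> c'))"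

definition proj_left ::
  "('k, 'w) ring_scheme \<Rightarrow> ('k, 'a, 'x) module_scheme \<Rightarrow> ('k, 'c, 'y) coalgebra_scheme
    \<Rightarrow> (('a, 'c) tens \<Rightarrow> ('c, 'a) tens) \<Rightarrow> ('c, 'a) tens \<Rightarrow> ('c, 'a) tens"
  where "proj_left k A C \<psi>L X =
    tsum (tensor k C A) X (\<lambda>c a.
      tsum (tensor k C A) (\<psi>L (\<one>\<^bsub>A\<^esub> \<boxtimes>\<^bsub>tensor k A C\<^esub> c)) (\<lambda>c' e. c' \<boxtimes>\<^bsub>tensor k C A\<^esub> (e \<otimes>\<^bsub>A\<^esub> a)))"

locale invertible_weak_entwining =
  right: weak_entwining_rr k A C \<psi>R + left: weak_entwining_ll k A C \<psi>L
  for k :: "('k, 'w) ring_scheme" and A :: "('k, 'a, 'x) module_scheme"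
    and C :: "('k, 'c, 'y) coalgebra_scheme" (structure)
    and \<psi>R :: "('c, 'a) tens \<Rightarrow> ('a, 'c) tens" and \<psi>L :: "('a, 'c) tens \<Rightarrow> ('c, 'a) tens" +
  assumes psi_right_left: "X \<in> carrier (tensor k A C) \<Longrightarrow> \<psi>R (\<psi>L X) = proj_right k A C \<psi>R X"
    and psi_left_right: "Y \<in> carrier (tensor k C A) \<Longrightarrow> \<psi>L (\<psi>R Y) = proj_left k A C \<psi>L Y"
    and counit_psi: "c \<in> carrier C \<Longrightarrow>
      tsum A (\<psi>L (\<one>\<^bsub>A\<^esub> \<boxtimes>\<^bsub>tensor k A C\<^esub> c)) (\<lambda>c' e. counit C c' \<odot>\<^bsub>A\<^esub> e) =
      tsum A (\<psi>R (c \<boxtimes>\<^bsub>tensor k C A\<^esub> \<one>\<^bsub>A\<^esub>)) (\<lambda>e c'. counit C c' \<odot>\<^bsub>A\<^esub> e)"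

locale weak_entwined_module =
  weak_entwining_rr k A C \<psi> + right_algebra_module k A M ra + right_comodule k C M \<rho>
  for k :: "('k, 'w) ring_scheme" and A :: "('k, 'a, 'x) module_scheme"
    and C :: "('k, 'c, 'y) coalgebra_scheme" (structure)
    and \<psi> :: "('c, 'a) tens \<Rightarrow> ('a, 'c) tens"
    and M :: "('k, 'm, 'z) module_scheme"
    and ra :: "'m \<Rightarrow> 'a \<Rightarrow> 'm" and \<rho> :: "'m \<Rightarrow> ('m, 'c) tens" +
  assumes coact_act: "\<lbrakk>m \<in> carrier M; a \<in> carrier A\<rbrakk> \<Longrightarrow>
    \<rho> (ra m a) =
    tsum (tensor k M C) (\<rho> m) (\<lambda>m0 m1.
      tsum (tensor k M C) (\<psi> (m1 \<boxtimes>\<^bsub>tensor k C A\<^esub> a)) (\<lambda>a' m1'. ra m0 a' \<boxtimes>\<^bsub>tensor k M C\<^esub> m1'))"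


section \<open>The coring \<open>Im p\<^sub>R\<close> and coinvariants\<close>

text \<open>The underlying \<open>k\<close>-module of the \<open>A\<close>-coring \<open>Im p\<^sub>R\<close>. Its left \<open>A\<close>-action is
  \<open>left_mult A (tensor k A C)\<close>, its right \<open>A\<close>-action is \<open>coring_right_act\<close>.\<close>

definition coring ::
  "('k, 'w) ring_scheme \<Rightarrow> ('k, 'a, 'x) module_scheme \<Rightarrow> ('k, 'c, 'y) coalgebra_scheme
    \<Rightarrow> (('c, 'a) tens \<Rightarrow> ('a, 'c) tens) \<Rightarrow> ('k, ('a, 'c) tens) module"
  where "coring k A C \<psi>R =
    (tensor k A C)\<lparr>carrier := proj_right k A C \<psi>R ` carrier (tensor k A C)\<rparr>"

text \<open>The action of \<open>A\<close> by multiplication on the left factor of a tensor product \<open>T\<close>.\<close>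

definition left_mult ::
  "('a, 'w) ring_scheme \<Rightarrow> (('a, 'n) tens, 'x) ring_scheme \<Rightarrow> 'a \<Rightarrow> ('a, 'n) tens \<Rightarrow> ('a, 'n) tens"
  where "left_mult A T a X = tsum T X (\<lambda>x n. (a \<otimes>\<^bsub>A\<^esub> x) \<boxtimes>\<^bsub>T\<^esub> n)"

definition coring_right_act ::
  "('k, 'w) ring_scheme \<Rightarrow> ('k, 'a, 'x) module_scheme \<Rightarrow> ('k, 'c, 'y) coalgebra_scheme
    \<Rightarrow> (('c, 'a) tens \<Rightarrow> ('a, 'c) tens) \<Rightarrow> ('a, 'c) tens \<Rightarrow> 'a \<Rightarrow> ('a, 'c) tens"
  where "coring_right_act k A C \<psi>R X a =
    tsum (tensor k A C) X (\<lambda>x c.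
      tsum (tensor k A C) (\<psi>R (c \<boxtimes>\<^bsub>tensor k C A\<^esub> a)) (\<lambda>a' c'. (x \<otimes>\<^bsub>A\<^esub> a') \<boxtimes>\<^bsub>tensor k A C\<^esub> c'))"

definition coinvariants ::
  "('k, 'w) ring_scheme \<Rightarrow> ('k, 'a, 'x) module_scheme \<Rightarrow> ('k, 'c, 'y) coalgebra_scheme
    \<Rightarrow> ('a \<Rightarrow> ('a, 'c) tens) \<Rightarrow> ('k, 'a, 'x) module_scheme"
  where "coinvariants k A C \<rho> =
    A\<lparr>carrier := {b \<in> carrier A. \<forall>a\<in>carrier A. \<rho> (b \<otimes>\<^bsub>A\<^esub> a) = left_mult A (tensor k A C) b (\<rho> a)}\<rparr>"

definition coinvariants_tensor ::
  "('k, 'w) ring_scheme \<Rightarrow> ('k, 'a, 'x) module_scheme \<Rightarrow> ('k, 'c, 'y) coalgebra_scheme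
    \<Rightarrow> (('c, 'a) tens \<Rightarrow> ('a, 'c) tens) \<Rightarrow> ('a \<Rightarrow> ('a, 'c) tens) \<Rightarrow> ('a, 'a) tens set"
  where "coinvariants_tensor k A C \<psi>R \<rho> =
    (let T = tensor k A (coring k A C \<psi>R); g = \<rho> \<one>\<^bsub>A\<^esub> in
     {X \<in> carrier (tensor k A A).
        tsum T X (\<lambda>a b. a \<boxtimes>\<^bsub>T\<^esub> coring_right_act k A C \<psi>R g b) =
        tsum T X (\<lambda>a b. a \<boxtimes>\<^bsub>T\<^esub> left_mult A (tensor k A C) b g)})"


section \<open>Canonical maps and weak coalgebra-Galois extensions\<close>

text \<open>The formula \<open>a \<otimes> b \<mapsto> a \<rho>(b)\<close> makes sense on \<open>A \<otimes> A\<close> and on \<open>A \<otimes>\<^sub>B A\<close>.\<close>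

definition canonical_map ::
  "('k, 'w) ring_scheme \<Rightarrow> ('k, 'a, 'x) module_scheme \<Rightarrow> ('k, 'c, 'y) coalgebra_scheme
    \<Rightarrow> ('a \<Rightarrow> ('a, 'c) tens) \<Rightarrow> ('a, 'a) tens \<Rightarrow> ('a, 'c) tens"
  where "canonical_map k A C \<rho> X =
    tsum (tensor k A C) X (\<lambda>a b. left_mult A (tensor k A C) a (\<rho> b))"

text \<open>Morphisms of left \<open>A\<close>-modules and right \<open>C\<close>-comodules from \<open>M\<close> (action \<open>lM\<close>, coaction \<open>\<rho>M\<close>)
  to \<open>N\<close> (action \<open>lN\<close>, coaction \<open>\<rho>N\<close>).\<close>

definition module_comodule_hom ::
  "('k, 'w) ring_scheme \<Rightarrow> ('k, 'a, 'x) module_scheme \<Rightarrow> ('k, 'c, 'y) coalgebra_scheme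
    \<Rightarrow> ('k, 'm) module \<Rightarrow> ('a \<Rightarrow> 'm \<Rightarrow> 'm) \<Rightarrow> ('m \<Rightarrow> ('m, 'c) tens)
    \<Rightarrow> ('k, 'n) module \<Rightarrow> ('a \<Rightarrow> 'n \<Rightarrow> 'n) \<Rightarrow> ('n \<Rightarrow> ('n, 'c) tens) \<Rightarrow> ('m \<Rightarrow> 'n) \<Rightarrow> bool"
  where "module_comodule_hom k A C M lM \<rho>M N lN \<rho>N f \<longleftrightarrow>
    f \<in> linear_maps k M N \<and>
    (\<forall>a\<in>carrier A. \<forall>m\<in>carrier M. f (lM a m) = lN a (f m)) \<and>
    (\<forall>m\<in>carrier M. \<rho>N (f m) = tsum (tensor k N C) (\<rho>M m) (\<lambda>x c. f x \<boxtimes>\<^bsub>tensor k N C\<^esub> c))"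

abbreviation tensor_coinv ::
  "('k, 'w) ring_scheme \<Rightarrow> ('k, 'a, 'x) module_scheme \<Rightarrow> ('k, 'c, 'y) coalgebra_scheme
    \<Rightarrow> ('a \<Rightarrow> ('a, 'c) tens) \<Rightarrow> ('k, ('a, 'a) tens) module"
  where "tensor_coinv k A C \<rho> \<equiv>
    tensor_over (carrier (coinvariants k A C \<rho>)) (\<otimes>\<^bsub>A\<^esub>) (\<otimes>\<^bsub>A\<^esub>) A A"

text \<open>For \<open>B = coinvariants k A C \<rho>\<close>, the coaction below on \<open>A \<otimes>\<^sub>B A\<close> is \<open>A \<otimes>\<^sub>B \<rho>\<close> followed by the
  identification of \<open>A \<otimes>\<^sub>B (A \<otimes> C)\<close> with \<open>(A \<otimes>\<^sub>B A) \<otimes> C\<close>, and similarly for \<open>A \<otimes> \<Delta>\<close>.\<close>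

definition coact_tensor_coinv ::
  "('k, 'w) ring_scheme \<Rightarrow> ('k, 'a, 'x) module_scheme \<Rightarrow> ('k, 'c, 'y) coalgebra_scheme
    \<Rightarrow> ('a \<Rightarrow> ('a, 'c) tens) \<Rightarrow> ('a, 'a) tens \<Rightarrow> (('a, 'a) tens, 'c) tens"
  where "coact_tensor_coinv k A C \<rho> X =
    (let S = tensor_coinv k A C \<rho>; T = tensor k S C in
     tsum T X (\<lambda>a b. tsum T (\<rho> b) (\<lambda>b0 b1. (a \<boxtimes>\<^bsub>S\<^esub> b0) \<boxtimes>\<^bsub>T\<^esub> b1)))"

definition coact_tensor_comult ::
  "('k, 'w) ring_scheme \<Rightarrow> ('k, 'a, 'x) module_scheme \<Rightarrow> ('k, 'c, 'y) coalgebra_scheme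
    \<Rightarrow> ('a, 'c) tens \<Rightarrow> (('a, 'c) tens, 'c) tens"
  where "coact_tensor_comult k A C X =
    (let S = tensor k A C; T = tensor k S C in
     tsum T X (\<lambda>a c. tsum T (comult C c) (\<lambda>c1 c2. (a \<boxtimes>\<^bsub>S\<^esub> c1) \<boxtimes>\<^bsub>T\<^esub> c2)))"

definition weak_coalgebra_Galois ::
  "('k, 'w) ring_scheme \<Rightarrow> ('k, 'a, 'x) module_scheme \<Rightarrow> ('k, 'c, 'y) coalgebra_scheme
    \<Rightarrow> ('a \<Rightarrow> ('a, 'c) tens) \<Rightarrow> bool"
  where "weak_coalgebra_Galois k A C \<rho> \<longleftrightarrow>
    (let S = tensor_coinv k A C \<rho>; T = tensor k A C in
      module_comodule_hom k A C
        S (left_mult A S) (coact_tensor_coinv k A C \<rho>)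
        T (left_mult A T) (coact_tensor_comult k A C) (canonical_map k A C \<rho>) \<and>
      (\<exists>\<sigma>. module_comodule_hom k A C
             T (left_mult A T) (coact_tensor_comult k A C)
             S (left_mult A S) (coact_tensor_coinv k A C \<rho>) \<sigma> \<and>
           (\<forall>X\<in>carrier S. \<sigma> (canonical_map k A C \<rho> X) = X)))"

end

theory Submission
  imports Defs
begin

text \<open>
  Put \<open>g = \<rho>(1)\<close> and \<open>\<lambda>(a) = \<psi>\<^sub>L(a g)\<close>. Then \<open>\<lambda>\<close> makes \<open>A\<close> a left \<open>C\<close>-comodule, and \<open>\<psi>\<^sub>L \<circ> can\<close>,
  which sends \<open>x \<otimes> y\<close> to \<open>\<lambda>(x) y\<close>, is a colinear map of \<open>A \<otimes> A\<close> onto \<open>Im p\<^sub>L\<close>. Projectivity of \<open>C\<close>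
  lifts \<open>c \<mapsto> p\<^sub>L(c \<otimes> 1)\<close> to a colinear map \<open>h : C \<rightarrow> A \<otimes> A\<close> with \<open>can (h(c)) = \<psi>\<^sub>R(c \<otimes> 1)\<close>, and
  \<open>a \<otimes> c \<mapsto> a h(c)\<close> is a left \<open>A\<close>-linear section of \<open>can\<close> over \<open>Im p\<^sub>R\<close>. Colinearity of \<open>h\<close> says that
  the first factor of \<open>\<Sum> a\<^sub>0 h(a\<^sub>1)\<close> is coinvariant; as \<open>(A \<otimes> A)\<^sup>c\<^sup>o\<^sup>C = A \<otimes> B\<close>, with the factors
  exchanged, this element lies in \<open>B \<otimes> A\<close>, and it multiplies to \<open>a\<close>. So \<open>B \<otimes> A \<rightarrow> A\<close> splits
  \<open>B\<close>-linearly, which gives relative projectivity, and in \<open>A \<otimes>\<^sub>B A\<close> the element becomes \<open>1 \<otimes> a\<close>, so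
  that the section inverts \<open>can\<close>. The section is right colinear because \<open>p\<^sub>R\<close> is and \<open>can \<otimes> C\<close> is
  a split monomorphism.
\<close>

section \<open>Tensor products as modules\<close>

text \<open>Projectivity of C concerns left comodules, whereas \<rho> is a right coaction; \<psi>L
  bridges the two sides. It is injective on Im \<open>pR\<close> and turns the right action of the
  coring into plain multiplication on C \<otimes> A, where the coaction of C is visible. As
  \<rho>(a) = g a, an element b is coinvariant iff g b = b g, that is, iff \<psi>L(\<rho>(b)) =
  \<psi>L(b g). This is why a statement on the left coaction can detect B. Weakness enters through
  the idempotents. The lift is only known after \<open>pL\<close>, and \<open>can\<close> after its
  section is \<open>pR\<close>. The opposite composite, on A \<otimes>_B A, is nevertheless the
  identity, and from this it follows that the section absorbs \<open>pR\<close>. A further obstacle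
  is that projectivity is available only against comodules whose elements are sets of lists. A
  tensor is stored there as the set of all lists that denote it. Im \<open>pL\<close> is realised as
  a quotient of C \<otimes> A, with the coaction induced along the quotient map.\<close>

locale tensor_setup = M: module k M + N: abelian_group N
  for k :: "('k, 'w) ring_scheme" (structure) and R :: "'r set" and ra :: "'m \<Rightarrow> 'r \<Rightarrow> 'm"
    and la :: "'r \<Rightarrow> 'n \<Rightarrow> 'n"
    and M :: "('k, 'm, 'x) module_scheme" and N :: "('n, 'y) ring_scheme" +
  assumes ra_closed: "\<lbrakk>m \<in> carrier M; r \<in> R\<rbrakk> \<Longrightarrow> ra m r \<in> carrier M"
    and la_closed: "\<lbrakk>r \<in> R; n \<in> carrier N\<rbrakk> \<Longrightarrow> la r n \<in> carrier N"
    and ra_smult: "\<lbrakk>s \<in> carrier k; m \<in> carrier M; r \<in> R\<rbrakk> \<Longrightarrow> ra (s \<odot>\<^bsub>M\<^esub> m) r = s \<odot>\<^bsub>M\<^esub> ra m r"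
begin

section \<open>The relation subgroup and the arithmetic of its cosets\<close>

definition "F = free_Abelian_group (carrier M \<times> carrier N)"
definition "H = generate F (tensor_rels R ra la M N)"
abbreviation "T \<equiv> tensor_over R ra la M N"
definition "scale r = frag_extend (\<lambda>(m, n). frag_of (r \<odot>\<^bsub>M\<^esub> m, n))"

lemma F_group: "comm_group F"
  unfolding F_def by (rule abelian_free_Abelian_group)

sublocale F: comm_group F
  by (rule F_group)

lemma rels_subset: "tensor_rels R ra la M N \<subseteq> carrier F"
  unfolding F_def by (rule tensor_rels_subset[OF M.abelian_group_axioms N.abelian_group_axioms ra_closed
    la_closed])

lemma H_subgroup: "subgroup H F"
  unfolding H_def using rels_subset by (rule F.generate_is_subgroup)

lemma H_normal: "normal H F"
  by (simp add: F_group H_subgroup comm_group.subgroup_imp_normal)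

lemma F_mult[simp]: "x \<otimes>\<^bsub>F\<^esub> y = x + y"
  by (simp add: F_def)

lemma carrier_T: "X \<in> carrier T \<longleftrightarrow> (\<exists>x\<in>carrier F. X = H #>\<^bsub>F\<^esub> x)"
  by (auto simp: tensor_over_def Let_def FactGroup_def RCOSETS_def F_def H_def)

lemma coset_closed: "x \<in> carrier F \<Longrightarrow> H #>\<^bsub>F\<^esub> x \<in> carrier T"
  using carrier_T by blast

lemma mem_coset: "x \<in> carrier F \<Longrightarrow> x \<in> H #>\<^bsub>F\<^esub> x"
  using H_subgroup by (simp add: F.rcos_self)

lemma add_coset:
  assumes "x \<in> carrier F" "y \<in> carrier F"
  shows "(H #>\<^bsub>F\<^esub> x) \<oplus>\<^bsub>T\<^esub> (H #>\<^bsub>F\<^esub> y) = H #>\<^bsub>F\<^esub> (x + y)"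
  using normal.rcos_sum[OF H_normal assms] by (simp add: tensor_over_def Let_def F_def H_def)

lemma abelian_group: "abelian_group T"
proof -
  have "comm_group (F Mod H)"
    by (rule comm_group.abelian_FactGroup[OF F_group H_subgroup])
  then interpret Q: comm_group "F Mod H" .
  have eqs: "carrier T = carrier (F Mod H)" "\<zero>\<^bsub>T\<^esub> = \<one>\<^bsub>F Mod H\<^esub>" "(\<oplus>\<^bsub>T\<^esub>) = (\<otimes>\<^bsub>F Mod H\<^esub>)"
    by (simp_all add: tensor_over_def Let_def F_def H_def)
  show ?thesis
    by (rule abelian_groupI; unfold eqs)
      (simp_all only: Q.m_closed Q.m_assoc Q.one_closed Q.l_one Q.l_inv_ex, rule Q.m_comm)
qed

sublocale T: abelian_group T
  by (rule abelian_group)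

lemma frag_closed: "\<lbrakk>m \<in> carrier M; n \<in> carrier N\<rbrakk> \<Longrightarrow> frag_of (m, n) \<in> carrier F"
  by (simp add: F_def)

lemma pure_coset: "m \<boxtimes>\<^bsub>T\<^esub> n = H #>\<^bsub>F\<^esub> frag_of (m, n)"
  by (auto simp: pure_tensor_def tensor_over_def Let_def r_coset_def F_def H_def)

lemma pure_closed: "\<lbrakk>m \<in> carrier M; n \<in> carrier N\<rbrakk> \<Longrightarrow> m \<boxtimes>\<^bsub>T\<^esub> n \<in> carrier T"
  by (simp add: pure_coset coset_closed frag_closed)

lemma coset_eqI:
  assumes "x \<in> carrier F" "y \<in> carrier F" "x - y \<in> H"
  shows "H #>\<^bsub>F\<^esub> x = H #>\<^bsub>F\<^esub> y"
proof -
  have "x = (x - y) \<otimes>\<^bsub>F\<^esub> y" by simp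
  then have "x \<in> H #>\<^bsub>F\<^esub> y" using assms(3) unfolding r_coset_def by blast
  then show ?thesis
    using F.repr_independence[OF _ assms(2) H_subgroup] by metis
qed

lemma rel_in_H: "x \<in> tensor_rels R ra la M N \<Longrightarrow> x \<in> H"
  unfolding H_def by (rule generate.incl)

lemma pure_add_left:
  assumes "m \<in> carrier M" "m' \<in> carrier M" "n \<in> carrier N"
  shows "(m \<oplus>\<^bsub>M\<^esub> m') \<boxtimes>\<^bsub>T\<^esub> n = m \<boxtimes>\<^bsub>T\<^esub> n \<oplus>\<^bsub>T\<^esub> m' \<boxtimes>\<^bsub>T\<^esub> n"
proof -
  have "frag_of (m \<oplus>\<^bsub>M\<^esub> m', n) - frag_of (m, n) - frag_of (m', n) \<in> H"
    by (rule rel_in_H) (use assms in \<open>auto simp: tensor_rels_def\<close>)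
  then have "H #>\<^bsub>F\<^esub> frag_of (m \<oplus>\<^bsub>M\<^esub> m', n) = H #>\<^bsub>F\<^esub> (frag_of (m, n) + frag_of (m', n))"
    using assms by (intro coset_eqI)
      (auto simp: diff_diff_eq frag_closed intro: F.m_closed[unfolded F_mult])
  then show ?thesis
    using assms by (simp add: pure_coset add_coset frag_closed)
qed

lemma pure_add_right:
  assumes "m \<in> carrier M" "n \<in> carrier N" "n' \<in> carrier N"
  shows "m \<boxtimes>\<^bsub>T\<^esub> (n \<oplus>\<^bsub>N\<^esub> n') = m \<boxtimes>\<^bsub>T\<^esub> n \<oplus>\<^bsub>T\<^esub> m \<boxtimes>\<^bsub>T\<^esub> n'"
proof -
  have "frag_of (m, n \<oplus>\<^bsub>N\<^esub> n') - frag_of (m, n) - frag_of (m, n') \<in> H"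
    by (rule rel_in_H) (use assms in \<open>auto simp: tensor_rels_def\<close>)
  then have "H #>\<^bsub>F\<^esub> frag_of (m, n \<oplus>\<^bsub>N\<^esub> n') = H #>\<^bsub>F\<^esub> (frag_of (m, n) + frag_of (m, n'))"
    using assms by (intro coset_eqI)
      (auto simp: diff_diff_eq frag_closed intro: F.m_closed[unfolded F_mult])
  then show ?thesis
    using assms by (simp add: pure_coset add_coset frag_closed)
qed

lemma pure_balanced:
  assumes "m \<in> carrier M" "r \<in> R" "n \<in> carrier N"
  shows "ra m r \<boxtimes>\<^bsub>T\<^esub> n = m \<boxtimes>\<^bsub>T\<^esub> la r n"
proof -
  have "frag_of (ra m r, n) - frag_of (m, la r n) \<in> H"
    by (rule rel_in_H) (use assms in \<open>auto simp: tensor_rels_def\<close>)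
  then show ?thesis
    unfolding pure_coset using assms by (intro coset_eqI) (auto simp: frag_closed ra_closed la_closed)
qed

lemma scale_closed:
  assumes "r \<in> carrier k" "x \<in> carrier F" shows "scale r x \<in> carrier F"
  using assms keys_frag_extend[of "\<lambda>(m, n). frag_of (r \<odot>\<^bsub>M\<^esub> m, n)" x] by (fastforce simp: F_def scale_def)

text \<open>Each of the three families of relations is mapped into itself. For the balancing family
  the right action has to commute with scalars, which is the purpose of
  \<open>ra_smult\<close>.\<close>

lemma scale_rels:
  assumes r: "r \<in> carrier k" and "x \<in> tensor_rels R ra la M N"
  shows "scale r x \<in> tensor_rels R ra la M N"
  using assms(2) unfolding tensor_rels_def
  apply (elim UnE CollectE exE conjE)
  subgoal for m m' n
    apply (rule UnI1, rule UnI1, rule CollectI)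
    apply (rule exI[of _ "r \<odot>\<^bsub>M\<^esub> m"], rule exI[of _ "r \<odot>\<^bsub>M\<^esub> m'"])
    using r by (auto simp: scale_def frag_extend_diff M.smult_r_distr)
  subgoal for m n n'
    apply (rule UnI1, rule UnI2, rule CollectI)
    apply (rule exI[of _ "r \<odot>\<^bsub>M\<^esub> m"])
    using r by (auto simp: scale_def frag_extend_diff)
  subgoal for m s n
    apply (rule UnI2, rule CollectI)
    apply (rule exI[of _ "r \<odot>\<^bsub>M\<^esub> m"])
    apply (rule exI[of _ s], rule exI[of _ n])
    using r by (auto simp: scale_def frag_extend_diff ra_smult)
  done

lemma scale_H:
  assumes r: "r \<in> carrier k" and "x \<in> H" shows "scale r x \<in> H"
  using assms(2) unfolding H_def
proof induction
  case one
  show ?case using generate.one[of F] by (simp add: scale_def F_def)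
next
  case (incl h)
  then show ?case by (intro generate.incl scale_rels r)
next
  case (inv h)
  then have "Poly_Mapping.keys h \<subseteq> carrier M \<times> carrier N" "scale r h \<in> carrier F"
    using subsetD[OF rels_subset inv] scale_closed[OF r subsetD[OF rels_subset inv]] by (simp_all add: F_def)
  then have "scale r (inv\<^bsub>F\<^esub> h) = inv\<^bsub>F\<^esub> (scale r h)"
    by (simp add: F_def scale_def frag_extend_minus)
  then show ?case using inv by (metis generate.inv scale_rels r)
next
  case (eng x y)
  then show ?case using generate.eng[of "scale r x" F _ "scale r y"]
    by (simp add: scale_def frag_extend_add)
qed

text \<open>The scalar action in \<open>tensor_over\<close> is a union over all representatives of a
  class. As \<open>scale r\<close> is additive and preserves \<open>H\<close>, all of them yield the
  same coset and the union collapses.\<close>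

lemma smult_coset:
  assumes r: "r \<in> carrier k" and x: "x \<in> carrier F"
  shows "r \<odot>\<^bsub>T\<^esub> (H #>\<^bsub>F\<^esub> x) = H #>\<^bsub>F\<^esub> scale r x"
proof -
  have "H #>\<^bsub>F\<^esub> scale r y = H #>\<^bsub>F\<^esub> scale r x" if y: "y \<in> H #>\<^bsub>F\<^esub> x" for y
  proof -
    obtain h where h: "h \<in> H" "y = h + x" using y by (auto simp: r_coset_def)
    then have yF: "y \<in> carrier F"
      using subgroup.mem_carrier[OF H_subgroup h(1)] x F.m_closed[of h x] by simp
    have "scale r y - scale r x = scale r h"
      using h by (simp add: scale_def frag_extend_add)
    then show ?thesis
      by (intro coset_eqI) (use h scale_closed r x yF scale_H in auto)
  qed
  then have "(\<Union>y\<in>H #>\<^bsub>F\<^esub> x. H #>\<^bsub>F\<^esub> scale r y) = H #>\<^bsub>F\<^esub> scale r x"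
    using mem_coset[OF x] by blast
  then show ?thesis
    unfolding tensor_over_def Let_def scale_def F_def[symmetric] H_def[symmetric] by simp
qed

lemma smult_pure:
  assumes "r \<in> carrier k" "m \<in> carrier M" "n \<in> carrier N"
  shows "r \<odot>\<^bsub>T\<^esub> (m \<boxtimes>\<^bsub>T\<^esub> n) = (r \<odot>\<^bsub>M\<^esub> m) \<boxtimes>\<^bsub>T\<^esub> n"
  using assms by (simp add: pure_coset smult_coset frag_closed) (simp add: scale_def)

lemma smult_T_closed: "\<lbrakk>r \<in> carrier k; X \<in> carrier T\<rbrakk> \<Longrightarrow> r \<odot>\<^bsub>T\<^esub> X \<in> carrier T"
  using carrier_T smult_coset scale_closed by auto

lemma smult_T_add:
  assumes "r \<in> carrier k" "X \<in> carrier T" "Y \<in> carrier T"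
  shows "r \<odot>\<^bsub>T\<^esub> (X \<oplus>\<^bsub>T\<^esub> Y) = r \<odot>\<^bsub>T\<^esub> X \<oplus>\<^bsub>T\<^esub> r \<odot>\<^bsub>T\<^esub> Y"
proof -
  obtain x y where *: "x \<in> carrier F" "X = H #>\<^bsub>F\<^esub> x" "y \<in> carrier F" "Y = H #>\<^bsub>F\<^esub> y"
    using assms carrier_T by auto
  then have "x + y \<in> carrier F"
    using F.m_closed[of x y] by simp
  with * assms show ?thesis
    by (simp add: add_coset smult_coset scale_closed) (simp add: scale_def frag_extend_add)
qed

lemma pure_zero_left: "n \<in> carrier N \<Longrightarrow> \<zero>\<^bsub>M\<^esub> \<boxtimes>\<^bsub>T\<^esub> n = \<zero>\<^bsub>T\<^esub>"
  using pure_add_left[of "\<zero>\<^bsub>M\<^esub>" "\<zero>\<^bsub>M\<^esub>" n] pure_closed[of "\<zero>\<^bsub>M\<^esub>" n]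
  by (metis M.zero_closed M.l_zero T.add.l_cancel_one)

lemma pure_minus_left:
  "\<lbrakk>m \<in> carrier M; n \<in> carrier N\<rbrakk> \<Longrightarrow> \<ominus>\<^bsub>T\<^esub> (m \<boxtimes>\<^bsub>T\<^esub> n) = (\<ominus>\<^bsub>M\<^esub> m) \<boxtimes>\<^bsub>T\<^esub> n"
  by (metis M.M.add.inv_closed M.M.l_neg T.minus_equality pure_add_left pure_closed pure_zero_left)

text \<open>\<open>frag_induction\<close> builds elements of a free abelian group by differences,
  whereas this rule offers only sums. So the induction carries \<open>P\<close> for a class and for
  its negative at once; the negative of a pure tensor is again pure, and so is zero.\<close>

lemma tensor_induct [consumes 1, case_names pure add]:
  assumes X: "X \<in> carrier T"
    and pure: "\<And>m n. \<lbrakk>m \<in> carrier M; n \<in> carrier N\<rbrakk> \<Longrightarrow> P (m \<boxtimes>\<^bsub>T\<^esub> n)"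
    and add: "\<And>X Y. \<lbrakk>X \<in> carrier T; Y \<in> carrier T; P X; P Y\<rbrakk> \<Longrightarrow> P (X \<oplus>\<^bsub>T\<^esub> Y)"
  shows "P X"
proof -
  obtain x where x: "x \<in> carrier F" "X = H #>\<^bsub>F\<^esub> x" using X carrier_T by auto
  have "x \<in> carrier F \<and> P (H #>\<^bsub>F\<^esub> x) \<and> P (\<ominus>\<^bsub>T\<^esub> (H #>\<^bsub>F\<^esub> x))"
    using x(1)[unfolded F_def carrier_free_Abelian_group_iff]
  proof (induction x rule: frag_induction)
    case zero
    have "H #>\<^bsub>F\<^esub> 0 = \<zero>\<^bsub>T\<^esub>"
      using add_coset[of 0 0] coset_closed[of 0] T.add.l_cancel_one by (simp add: F_def)
    moreover have "P \<zero>\<^bsub>T\<^esub>" using pure[of "\<zero>\<^bsub>M\<^esub>" "\<zero>\<^bsub>N\<^esub>"] pure_zero_left by simp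
    moreover have "\<ominus>\<^bsub>T\<^esub> \<zero>\<^bsub>T\<^esub> = \<zero>\<^bsub>T\<^esub>" by (rule T.minus_equality) simp_all
    ultimately have "P (H #>\<^bsub>F\<^esub> 0)" "P (\<ominus>\<^bsub>T\<^esub> (H #>\<^bsub>F\<^esub> 0))" by (simp_all only:)
    then show ?case by (simp add: F_def)
  next
    case (one p)
    obtain m n where p: "p = (m, n)" "m \<in> carrier M" "n \<in> carrier N" using one by auto
    then show ?case
      using pure[of m n] pure[of "\<ominus>\<^bsub>M\<^esub> m" n] by (simp add: frag_closed pure_coset[symmetric] pure_minus_left)
  next
    case (diff a b)
    then have a: "a \<in> carrier F" and b: "b \<in> carrier F" by auto
    have nb: "-b \<in> carrier F" using b by (simp add: F_def)
    have ab: "a - b \<in> carrier F"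
      using F.m_closed[OF a nb] by simp
    have bc: "H #>\<^bsub>F\<^esub> b \<in> carrier T" "H #>\<^bsub>F\<^esub> a \<in> carrier T" using a b coset_closed by auto
    have "H #>\<^bsub>F\<^esub> a = (H #>\<^bsub>F\<^esub> (a - b)) \<oplus>\<^bsub>T\<^esub> (H #>\<^bsub>F\<^esub> b)"
      using add_coset[OF ab b] by simp
    then have e: "H #>\<^bsub>F\<^esub> (a - b) = (H #>\<^bsub>F\<^esub> a) \<oplus>\<^bsub>T\<^esub> (\<ominus>\<^bsub>T\<^esub> (H #>\<^bsub>F\<^esub> b))"
      using bc coset_closed[OF ab] by (metis T.a_inv_closed T.minus_eq T.add.inv_solve_right)
    then have e2: "\<ominus>\<^bsub>T\<^esub> (H #>\<^bsub>F\<^esub> (a - b)) = (H #>\<^bsub>F\<^esub> b) \<oplus>\<^bsub>T\<^esub> (\<ominus>\<^bsub>T\<^esub> (H #>\<^bsub>F\<^esub> a))"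
      using bc by (simp add: T.minus_add T.a_comm)
    show ?case unfolding e2 unfolding e using bc ab diff by (auto intro!: add)
  qed
  with x show ?thesis by simp
qed

lemma T_module: "module k T"
proof (rule moduleI)
  show "cring k" by (rule M.R.is_cring)
  show "abelian_group T" by (rule abelian_group)
  fix a b X assume a: "a \<in> carrier k" and b: "b \<in> carrier k" and X: "X \<in> carrier T"
  show "(a \<oplus>\<^bsub>k\<^esub> b) \<odot>\<^bsub>T\<^esub> X = a \<odot>\<^bsub>T\<^esub> X \<oplus>\<^bsub>T\<^esub> b \<odot>\<^bsub>T\<^esub> X"
    using X
  proof (induction rule: tensor_induct)
    case (pure m n) then show ?case using a b by (simp add: smult_pure M.smult_l_distr pure_add_left)
  next
    case (add X Y)
    then show ?case using a b by (simp add: smult_T_add smult_T_closed T.a_ac)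
  qed
  show "(a \<otimes>\<^bsub>k\<^esub> b) \<odot>\<^bsub>T\<^esub> X = a \<odot>\<^bsub>T\<^esub> (b \<odot>\<^bsub>T\<^esub> X)"
    using X
  proof (induction rule: tensor_induct)
    case (pure m n) then show ?case using a b by (simp add: smult_pure M.smult_assoc1)
  next
    case (add X Y)
    then show ?case using a b by (simp add: smult_T_add smult_T_closed T.a_ac)
  qed
next
  fix X assume X: "X \<in> carrier T"
  show "\<one>\<^bsub>k\<^esub> \<odot>\<^bsub>T\<^esub> X = X"
    using X
  proof (induction rule: tensor_induct)
    case (pure m n) then show ?case by (simp add: smult_pure)
  next
    case (add X Y)
    then show ?case by (simp add: smult_T_add smult_T_closed T.a_ac)
  qed
qed (simp_all add: smult_T_closed smult_T_add)

text \<open>The representative that \<open>tsum\<close> picks is supported on the carriers, so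
  values of a summand elsewhere cannot matter. This is what makes \<open>tsum\<close> and the
  cut-off sum \<open>ts\<close> agree.\<close>

lemma rep_keys:
  assumes "X \<in> carrier T" shows "Poly_Mapping.keys (SOME x. x \<in> X) \<subseteq> carrier M \<times> carrier N"
proof -
  obtain x where x: "x \<in> carrier F" "X = H #>\<^bsub>F\<^esub> x" using assms carrier_T by auto
  then have "(SOME x. x \<in> X) \<in> X" using mem_coset[OF x(1)] by (metis someI)
  moreover have "X \<subseteq> carrier F"
    using x F.r_coset_subset_G[OF subgroup.subset[OF H_subgroup]] by simp
  ultimately have "(SOME x. x \<in> X) \<in> carrier F" by blast
  then show ?thesis by (simp add: F_def)
qed

end

section \<open>Multilinear maps and typed sums\<close>

definition lin :: "('k, 'w) ring_scheme \<Rightarrow> ('k, 'm, 'y) module_scheme \<Rightarrow> ('k, 'n, 'z) module_scheme \<Rightarrow> ('m \<Rightarrow>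
  'n) \<Rightarrow> bool"
  where "lin k M N f \<longleftrightarrow> f \<in> linear_maps k M N"

definition bilin where
  "bilin k M N G f \<longleftrightarrow> (\<forall>m\<in>carrier M. lin k N G (f m)) \<and> (\<forall>n\<in>carrier N. lin k M G (\<lambda>m. f m n))"

lemma lin_iff:
  "lin k M N f \<longleftrightarrow> (\<forall>x\<in>carrier M. f x \<in> carrier N) \<and>
     (\<forall>x\<in>carrier M. \<forall>y\<in>carrier M. f (x \<oplus>\<^bsub>M\<^esub> y) = f x \<oplus>\<^bsub>N\<^esub> f y) \<and>
     (\<forall>r\<in>carrier k. \<forall>x\<in>carrier M. f (r \<odot>\<^bsub>M\<^esub> x) = r \<odot>\<^bsub>N\<^esub> f x)"
  by (auto simp: lin_def linear_maps_def)

lemma lin_closed: "\<lbrakk>lin k M N f; x \<in> carrier M\<rbrakk> \<Longrightarrow> f x \<in> carrier N"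
  and lin_add: "\<lbrakk>lin k M N f; x \<in> carrier M; y \<in> carrier M\<rbrakk> \<Longrightarrow> f (x \<oplus>\<^bsub>M\<^esub> y) = f x \<oplus>\<^bsub>N\<^esub> f y"
  and lin_smult: "\<lbrakk>lin k M N f; r \<in> carrier k; x \<in> carrier M\<rbrakk> \<Longrightarrow> f (r \<odot>\<^bsub>M\<^esub> x) = r \<odot>\<^bsub>N\<^esub> f x"
  by (simp_all add: lin_iff)

lemma lin_ident: "lin k M M (\<lambda>x. x)"
  by (simp add: lin_iff)

lemma lin_comp: "\<lbrakk>lin k N P h; lin k M N f\<rbrakk> \<Longrightarrow> lin k M P (\<lambda>x. h (f x))"
  by (simp add: lin_iff)

lemma lin_cong: "(\<And>x. x \<in> carrier M \<Longrightarrow> f x = g x) \<Longrightarrow> module k M \<Longrightarrow> lin k M N f = lin k M N g"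
proof -
  assume a: "\<And>x. x \<in> carrier M \<Longrightarrow> f x = g x" and "module k M"
  then interpret module k M by simp
  show ?thesis by (simp add: lin_iff a)
qed

lemma module_cring: "module k M \<Longrightarrow> cring k"
  and module_abelian_group: "module k M \<Longrightarrow> abelian_group M"
  by (simp_all add: module_def)

text \<open>\<open>tp\<close> hides \<open>tensor\<close> from the simplifier. \<open>ts\<close> is \<open>tsum\<close> with both factors as arguments, and
  with the summand cut off outside the carriers: this makes the congruence rule \<open>ts_cong\<close>
  unconditional and lets the simplifier find the factors in the side conditions, so that
  computations in Sweedler notation become conditional rewriting.\<close>

definition tp :: "('k, 'w) ring_scheme \<Rightarrow> ('k, 'm, 'x) module_scheme \<Rightarrow> ('k, 'n, 'y) module_scheme
    \<Rightarrow> ('k, ('m, 'n) tens) module"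
  where "tp k M N = tensor k M N"

definition ts :: "('m, 'x) ring_scheme \<Rightarrow> ('n, 'y) ring_scheme \<Rightarrow> ('g, 'z) ring_scheme
    \<Rightarrow> ('m, 'n) tens \<Rightarrow> ('m \<Rightarrow> 'n \<Rightarrow> 'g) \<Rightarrow> 'g"
  where "ts M N G X f = tsum G X (\<lambda>m n. if m \<in> carrier M \<and> n \<in> carrier N then f m n else \<zero>\<^bsub>G\<^esub>)"

lemma ts_cong [cong]:
  assumes "M = M'" "N = N'" "G = G'" "X = X'"
    and "\<And>m n. \<lbrakk>m \<in> carrier M'; n \<in> carrier N'\<rbrakk> \<Longrightarrow> f m n = f' m n"
  shows "ts M N G X f = ts M' N' G' X' f'"
  unfolding ts_def assms(1-4) by (intro arg_cong[where f = "tsum G' X'"] ext) (simp add: assms(5))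

text \<open>Over \<open>k\<close> both actions are scalar actions, and their compatibility with
  scalars is the commutativity of \<open>k\<close>.\<close>

lemma tensor_setup_tensor:
  assumes "module k M" "module k N"
  shows "tensor_setup k (carrier k) (\<lambda>m r. r \<odot>\<^bsub>M\<^esub> m) (\<lambda>r n. r \<odot>\<^bsub>N\<^esub> n) M N"
proof -
  interpret M: module k M by fact
  interpret N: module k N by fact
  show ?thesis
    by unfold_locales (auto simp: M.smult_assoc1[symmetric] M.R.m_comm)
qed

lemma foldSetD_cong:
  "(A, y) \<in> foldSetD D f e \<Longrightarrow> (\<And>x. x \<in> A \<Longrightarrow> f x = g x) \<Longrightarrow> (A, y) \<in> foldSetD D g e"
  by (induction rule: foldSetD.induct) (auto intro!: foldSetD.intros)

text \<open>Unlike \<open>finsum_cong\<close>, this does not ask the summands to lie in the carrier.\<close>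

lemma finsum_cong_on:
  assumes "\<And>x. x \<in> A \<Longrightarrow> f x = g x"
  shows "finsum G f A = finsum G g A"
proof -
  have "(A, y) \<in> foldSetD D (h \<circ> f) e \<longleftrightarrow> (A, y) \<in> foldSetD D (h \<circ> g) e" for y e D and h :: "'b \<Rightarrow> 'b \<Rightarrow> 'b"
    using foldSetD_cong[of A y D "h \<circ> f" e "h \<circ> g"] foldSetD_cong[of A y D "h \<circ> g" e "h \<circ> f"] assms by auto
  then show ?thesis by (simp add: finsum_def finprod_def foldD_def)
qed

text \<open>Nothing is asked of \<open>f\<close>, so axioms stated with \<open>tsum\<close> can be
  rewritten before any property of their summands is known.\<close>

lemma (in tensor_setup) tsum_ts:
  assumes "X \<in> carrier T"
  shows "tsum G X f = ts M N G X f"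
  unfolding ts_def tsum_def lin_ext_def using rep_keys[OF assms] by (intro finsum_cong_on) auto

section \<open>Sums of balanced maps\<close>

context tensor_setup
begin

context
  fixes G :: "('k, 'g, 'z) module_scheme" and f :: "'m \<Rightarrow> 'n \<Rightarrow> 'g"
  assumes G: "module k G"
    and f_lin: "\<And>n. n \<in> carrier N \<Longrightarrow> lin k M G (\<lambda>m. f m n)"
    and f_add: "\<And>m n n'. \<lbrakk>m \<in> carrier M; n \<in> carrier N; n' \<in> carrier N\<rbrakk> \<Longrightarrow> f m (n \<oplus>\<^bsub>N\<^esub> n') = f m n \<oplus>\<^bsub>G\<^esub> f m n'"
    and f_bal: "\<And>m r n. \<lbrakk>m \<in> carrier M; r \<in> R; n \<in> carrier N\<rbrakk> \<Longrightarrow> f (ra m r) n = f m (la r n)"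
begin

interpretation G: module k G by (rule G)

lemmas f_facts = lin_closed[OF f_lin] lin_add[OF f_lin] f_add f_bal

lemma ts_pure: "\<lbrakk>m \<in> carrier M; n \<in> carrier N\<rbrakk> \<Longrightarrow> ts M N G (m \<boxtimes>\<^bsub>T\<^esub> n) f = f m n"
  unfolding tsum_ts[OF pure_closed, symmetric]
  by (rule tsum_pure(2)[OF M.abelian_group_axioms N.abelian_group_axioms G.abelian_group_axioms ra_closed
    la_closed])
    (simp_all add: f_facts)

lemma ts_add:
  assumes "X \<in> carrier T" "Y \<in> carrier T"
  shows "ts M N G (X \<oplus>\<^bsub>T\<^esub> Y) f = ts M N G X f \<oplus>\<^bsub>G\<^esub> ts M N G Y f"
  unfolding tsum_ts[OF assms(1), symmetric] tsum_ts[OF assms(2), symmetric] tsum_ts[OF T.add.m_closed[OF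
    assms], symmetric]
  by (rule tsum_add[OF M.abelian_group_axioms N.abelian_group_axioms G.abelian_group_axioms ra_closed
    la_closed])
    (simp_all add: f_facts assms)

lemma lin_ts: "lin k T G (\<lambda>X. ts M N G X f)"
proof -
  have cl: "ts M N G X f \<in> carrier G" if "X \<in> carrier T" for X
    using that by (induction rule: tensor_induct) (simp_all add: ts_pure f_facts ts_add)
  have "ts M N G (r \<odot>\<^bsub>T\<^esub> X) f = r \<odot>\<^bsub>G\<^esub> ts M N G X f" if r: "r \<in> carrier k" and "X \<in> carrier T" for r X
    using that(2)
  proof (induction rule: tensor_induct)
    case (pure m n)
    with r show ?case by (simp add: smult_pure ts_pure lin_smult[OF f_lin])
  next
    case (add X Y)
    with r show ?case by (simp add: smult_T_add smult_T_closed ts_add cl G.smult_r_distr)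
  qed
  with cl ts_add show ?thesis by (simp add: lin_iff)
qed

end

lemma tensor_ext:
  assumes X: "X \<in> carrier T" and "lin k T G f" "lin k T G g"
    and "\<And>m n. \<lbrakk>m \<in> carrier M; n \<in> carrier N\<rbrakk> \<Longrightarrow> f (m \<boxtimes>\<^bsub>T\<^esub> n) = g (m \<boxtimes>\<^bsub>T\<^esub> n)"
  shows "f X = g X"
  using X by (induction rule: tensor_induct) (use assms in \<open>simp_all add: lin_add\<close>)

end

lemma tsum_ts:
  "\<lbrakk>module k M; module k N; X \<in> carrier (tensor k M N)\<rbrakk> \<Longrightarrow> tsum G X f = ts M N G X f"
  using tensor_setup.tsum_ts[OF tensor_setup_tensor] .

section \<open>Sweedler calculus over \<open>k\<close>\<close>

context
  fixes k :: "('k, 'w) ring_scheme" and M :: "('k, 'm, 'x) module_scheme" and N :: "('k, 'n, 'y) module_scheme"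
  assumes M: "module k M" and N: "module k N"
begin

interpretation M: module k M by (rule M)
interpretation N: module k N by (rule N)
interpretation TS: tensor_setup k "carrier k" "\<lambda>m r. r \<odot>\<^bsub>M\<^esub> m" "\<lambda>r n. r \<odot>\<^bsub>N\<^esub> n" M N
  by (rule tensor_setup_tensor[OF M N])

lemma tp_module: "module k (tp k M N)"
  unfolding tp_def by (rule TS.T_module)

lemma tp_pure_closed: "\<lbrakk>m \<in> carrier M; n \<in> carrier N\<rbrakk> \<Longrightarrow> m \<boxtimes>\<^bsub>tp k M N\<^esub> n \<in> carrier (tp k M N)"
  unfolding tp_def by (rule TS.pure_closed)

lemma tp_pure_smult:
  "\<lbrakk>r \<in> carrier k; m \<in> carrier M; n \<in> carrier N\<rbrakk> \<Longrightarrow> (r \<odot>\<^bsub>M\<^esub> m) \<boxtimes>\<^bsub>tp k M N\<^esub> n = r \<odot>\<^bsub>tp k M N\<^esub> (m \<boxtimes>\<^bsub>tp k M N\<^esub> n)"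
  "\<lbrakk>r \<in> carrier k; m \<in> carrier M; n \<in> carrier N\<rbrakk> \<Longrightarrow> m \<boxtimes>\<^bsub>tp k M N\<^esub> (r \<odot>\<^bsub>N\<^esub> n) = r \<odot>\<^bsub>tp k M N\<^esub> (m \<boxtimes>\<^bsub>tp k M N\<^esub> n)"
  unfolding tp_def using TS.smult_pure TS.pure_balanced by simp_all

lemma lin_pureL: "\<lbrakk>lin k P M f; n \<in> carrier N\<rbrakk> \<Longrightarrow> lin k P (tp k M N) (\<lambda>p. f p \<boxtimes>\<^bsub>tp k M N\<^esub> n)"
  by (simp add: lin_iff tp_pure_smult) (simp add: tp_def TS.pure_closed TS.pure_add_left)

lemma lin_pureR: "\<lbrakk>lin k P N f; m \<in> carrier M\<rbrakk> \<Longrightarrow> lin k P (tp k M N) (\<lambda>p. m \<boxtimes>\<^bsub>tp k M N\<^esub> f p)"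
  by (simp add: lin_iff tp_pure_smult) (simp add: tp_def TS.pure_closed TS.pure_add_right)

lemma tp_induct [consumes 1, case_names pure add]:
  assumes X: "X \<in> carrier (tp k M N)"
    and pure: "\<And>m n. \<lbrakk>m \<in> carrier M; n \<in> carrier N\<rbrakk> \<Longrightarrow> P (m \<boxtimes>\<^bsub>tp k M N\<^esub> n)"
    and add: "\<And>X Y. \<lbrakk>X \<in> carrier (tp k M N); Y \<in> carrier (tp k M N); P X; P Y\<rbrakk> \<Longrightarrow> P (X \<oplus>\<^bsub>tp k M N\<^esub> Y)"
  shows "P X"
  using assms unfolding tp_def by (rule TS.tensor_induct)

lemma tp_ext:
  assumes "X \<in> carrier (tp k M N)" "lin k (tp k M N) G f" "lin k (tp k M N) G g"
    and "\<And>m n. \<lbrakk>m \<in> carrier M; n \<in> carrier N\<rbrakk> \<Longrightarrow> f (m \<boxtimes>\<^bsub>tp k M N\<^esub> n) = g (m \<boxtimes>\<^bsub>tp k M N\<^esub> n)"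
  shows "f X = g X"
  using assms unfolding tp_def by (rule TS.tensor_ext)

context
  fixes G :: "('k, 'g, 'z) module_scheme" and F :: "'m \<Rightarrow> 'n \<Rightarrow> 'g"
  assumes G: "module k G" and F: "bilin k M N G F"
begin

lemma bilin_add_balanced:
  "\<lbrakk>m \<in> carrier M; n \<in> carrier N; n' \<in> carrier N\<rbrakk> \<Longrightarrow> F m (n \<oplus>\<^bsub>N\<^esub> n') = F m n \<oplus>\<^bsub>G\<^esub> F m n'"
  "\<lbrakk>m \<in> carrier M; r \<in> carrier k; n \<in> carrier N\<rbrakk> \<Longrightarrow> F (r \<odot>\<^bsub>M\<^esub> m) n = F m (r \<odot>\<^bsub>N\<^esub> n)"
  using F by (auto simp: bilin_def lin_iff)

lemma bilin_left: "n \<in> carrier N \<Longrightarrow> lin k M G (\<lambda>m. F m n)"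
  using F by (simp add: bilin_def)

lemma ts_pure: "\<lbrakk>m \<in> carrier M; n \<in> carrier N\<rbrakk> \<Longrightarrow> ts M N G (m \<boxtimes>\<^bsub>tp k M N\<^esub> n) F = F m n"
  unfolding tp_def by (rule TS.ts_pure[OF G bilin_left bilin_add_balanced])

lemma lin_ts: "lin k (tp k M N) G (\<lambda>X. ts M N G X F)"
  unfolding tp_def by (rule TS.lin_ts[OF G bilin_left bilin_add_balanced])

lemma ts_closed: "X \<in> carrier (tp k M N) \<Longrightarrow> ts M N G X F \<in> carrier G"
  by (rule lin_closed[OF lin_ts])

lemma lin_tsX: "lin k P (tp k M N) X \<Longrightarrow> lin k P G (\<lambda>p. ts M N G (X p) F)"
  by (rule lin_comp[OF lin_ts])

end

text \<open>Both sides are linear in \<open>X\<close>, so pure tensors suffice. The rules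
  \<open>ts_ts\<close>, \<open>pureL_ts\<close> and \<open>pureR_ts\<close> are the instances where
  \<open>h\<close> is a sum, or a pure tensor with one factor fixed.\<close>

lemma lin_apply_ts:
  assumes G: "module k G" and P: "module k P" and F: "bilin k M N G F" and h: "lin k G P h"
    and X: "X \<in> carrier (tp k M N)"
  shows "h (ts M N G X F) = ts M N P X (\<lambda>m n. h (F m n))"
proof -
  have b: "bilin k M N P (\<lambda>m n. h (F m n))"
    using F unfolding bilin_def by (intro conjI ballI lin_comp[OF h]) simp_all
  show ?thesis
    by (rule tp_ext[OF X lin_comp[OF h lin_ts[OF G F]] lin_ts[OF P b]])
      (simp add: ts_pure[OF G F] ts_pure[OF P b])
qed

text \<open>Here the tensor is fixed and the parameter sits in the summand. Induction on
  \<open>X\<close> works because the sum is additive in \<open>X\<close> for each value of the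
  parameter, while on pure tensors the claim is \<open>L\<close>.\<close>

lemma lin_tsF:
  assumes G: "module k G" and X: "X \<in> carrier (tp k M N)"
    and F: "\<And>p. p \<in> carrier P \<Longrightarrow> bilin k M N G (F p)"
    and L: "\<And>m n. \<lbrakk>m \<in> carrier M; n \<in> carrier N\<rbrakk> \<Longrightarrow> lin k P G (\<lambda>p. F p m n)"
    and P: "module k P"
  shows "lin k P G (\<lambda>p. ts M N G X (F p))"
proof -
  interpret P: module k P by fact
  interpret G: module k G by fact
  have lt: "lin k (tp k M N) G (\<lambda>X. ts M N G X (F p))" if "p \<in> carrier P" for p
    by (rule lin_ts[OF G F[OF that]])
  note cl = lin_closed[OF lt] and ad = lin_add[OF lt]
  have "ts M N G X (F (p \<oplus>\<^bsub>P\<^esub> q)) = ts M N G X (F p) \<oplus>\<^bsub>G\<^esub> ts M N G X (F q)"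
    if "p \<in> carrier P" "q \<in> carrier P" for p q
    using X
  proof (induction rule: tp_induct)
    case (pure m n)
    then show ?case using that lin_add[OF L[OF pure]] F by (simp add: ts_pure[OF G])
  next
    case (add X Y)
    then show ?case using that cl by (simp add: ad G.a_ac)
  qed
  moreover have "ts M N G X (F (r \<odot>\<^bsub>P\<^esub> p)) = r \<odot>\<^bsub>G\<^esub> ts M N G X (F p)"
    if "p \<in> carrier P" "r \<in> carrier k" for p r
    using X
  proof (induction rule: tp_induct)
    case (pure m n)
    then show ?case using that lin_smult[OF L[OF pure]] F by (simp add: ts_pure[OF G])
  next
    case (add X Y)
    then show ?case using that cl by (simp add: ad G.smult_r_distr)
  qed
  ultimately show ?thesis using cl X by (simp add: lin_iff)
qed

lemma ts_pures:
  assumes "X \<in> carrier (tp k M N)"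
  shows "ts M N (tp k M N) X (\<lambda>m n. m \<boxtimes>\<^bsub>tp k M N\<^esub> n) = X"
proof -
  have b: "bilin k M N (tp k M N) (\<lambda>m n. m \<boxtimes>\<^bsub>tp k M N\<^esub> n)"
    unfolding bilin_def using lin_pureL[OF lin_ident] lin_pureR[OF lin_ident] by blast
  show ?thesis
    by (rule tp_ext[OF assms lin_ts[OF tp_module b] lin_ident]) (simp add: ts_pure[OF tp_module b])
qed

end

lemma ts_ts:
  assumes "module k M" "module k N" "module k P" "module k Q" "module k G"
    and "X \<in> carrier (tp k M N)" "bilin k M N (tp k P Q) F" "bilin k P Q G H"
  shows "ts P Q G (ts M N (tp k P Q) X F) H = ts M N G X (\<lambda>m n. ts P Q G (F m n) H)"
  using assms by (intro lin_apply_ts) (auto intro: tp_module lin_ts)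

lemma pureL_ts:
  assumes "module k M" "module k N" "module k P" "module k G"
    and "X \<in> carrier (tp k M N)" "bilin k M N G F" "p \<in> carrier P"
  shows "ts M N G X F \<boxtimes>\<^bsub>tp k G P\<^esub> p = ts M N (tp k G P) X (\<lambda>m n. F m n \<boxtimes>\<^bsub>tp k G P\<^esub> p)"
  by (rule lin_apply_ts) (use assms in \<open>auto intro: tp_module lin_pureL lin_ident\<close>)

lemma pureR_ts:
  assumes "module k M" "module k N" "module k P" "module k G"
    and "X \<in> carrier (tp k M N)" "bilin k M N G F" "p \<in> carrier P"
  shows "p \<boxtimes>\<^bsub>tp k P G\<^esub> ts M N G X F = ts M N (tp k P G) X (\<lambda>m n. p \<boxtimes>\<^bsub>tp k P G\<^esub> F m n)"
  by (rule lin_apply_ts) (use assms in \<open>auto intro: tp_module lin_pureR lin_ident\<close>)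

text \<open>Fubini for independent sums: both sides are linear in \<open>X\<close>, and on a pure
  tensor the sum over \<open>X\<close> evaluates, leaving the same sum over
  \<open>Y\<close>.\<close>

lemma ts_swap:
  assumes "module k M" "module k N" "module k P" "module k Q" "module k G"
    and X: "X \<in> carrier (tp k M N)" and Y: "Y \<in> carrier (tp k P Q)"
    and 1: "\<And>m n. \<lbrakk>m \<in> carrier M; n \<in> carrier N\<rbrakk> \<Longrightarrow> bilin k P Q G (F m n)"
    and 2: "\<And>p q. \<lbrakk>p \<in> carrier P; q \<in> carrier Q\<rbrakk> \<Longrightarrow> bilin k M N G (\<lambda>m n. F m n p q)"
  shows "ts M N G X (\<lambda>m n. ts P Q G Y (F m n)) = ts P Q G Y (\<lambda>p q. ts M N G X (\<lambda>m n. F m n p q))"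
proof -
  have b1: "bilin k M N G (\<lambda>m n. ts P Q G Y (F m n))"
    using assms by (auto simp: bilin_def intro!: lin_tsF)
  have b2: "bilin k P Q G (\<lambda>p q. ts M N G X (\<lambda>m n. F m n p q))" if "X \<in> carrier (tp k M N)" for X
    using assms that by (auto simp: bilin_def intro!: lin_tsF)
  show ?thesis
  proof (rule tp_ext[OF assms(1,2) X, where f = "\<lambda>X. ts M N G X (\<lambda>m n. ts P Q G Y (F m n))" and G = G])
    show "lin k (tp k M N) G (\<lambda>X. ts M N G X (\<lambda>m n. ts P Q G Y (F m n)))"
      by (intro lin_ts assms b1)
    show "lin k (tp k M N) G (\<lambda>X. ts P Q G Y (\<lambda>p q. ts M N G X (\<lambda>m n. F m n p q)))"
      by (intro lin_tsF assms b2 lin_ts tp_module)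
    fix m n assume mn: "m \<in> carrier M" "n \<in> carrier N"
    show "ts M N G (m \<boxtimes>\<^bsub>tp k M N\<^esub> n) (\<lambda>m n. ts P Q G Y (F m n)) =
      ts P Q G Y (\<lambda>p q. ts M N G (m \<boxtimes>\<^bsub>tp k M N\<^esub> n) (\<lambda>m n. F m n p q))"
      unfolding ts_pure[OF assms(1,2,5) b1 mn]
      by (rule ts_cong) (simp_all add: ts_pure[OF assms(1,2,5) 2 mn])
  qed
qed

definition trilin where
  "trilin k M N P G F \<longleftrightarrow> (\<forall>m\<in>carrier M. \<forall>n\<in>carrier N. lin k P G (F m n)) \<and>
     (\<forall>m\<in>carrier M. \<forall>p\<in>carrier P. lin k N G (\<lambda>n. F m n p)) \<and>
     (\<forall>n\<in>carrier N. \<forall>p\<in>carrier P. lin k M G (\<lambda>m. F m n p))"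

text \<open>With \<open>bilin_def\<close> and \<open>trilin_def\<close> unfolded, every side
  condition splits into linearity in one variable at a time, and the linearity rules of this list
  follow the structure of the term.\<close>

lemmas tens_simps = lin_ident lin_pureL lin_pureR lin_tsX lin_tsF tp_module tp_pure_closed ts_closed
  ts_pure ts_ts pureL_ts pureR_ts bilin_def trilin_def

section \<open>The axioms in terms of typed sums\<close>

locale coalg_setup =
  fixes k :: "('k, 'w) ring_scheme" and C :: "('k, 'c, 'y) coalgebra_scheme"
  assumes coalg: "coalgebra k C"
begin

sublocale C: coalgebra k C by (rule coalg)

abbreviation "\<Delta> \<equiv> comult C"
abbreviation "\<epsilon> \<equiv> counit C"

lemma C_module[simp]: "module k C" by (rule C.module_axioms)

lemma Cd_lin: "lin k C (tp k C C) \<Delta>"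
  using C.comult_linear by (simp add: lin_def tp_def)

lemmas Cd_comp[simp] = lin_comp[OF Cd_lin]
lemmas Cd_closed[simp] = lin_closed[OF Cd_lin]

lemma ep_closed[simp]: "c \<in> carrier C \<Longrightarrow> \<epsilon> c \<in> carrier k"
  using C.counit_linear by (auto simp: linear_maps_def left_regular_def)

lemma lin_ep:
  assumes M: "module k M" and "lin k P C f" "x \<in> carrier M"
  shows "lin k P M (\<lambda>p. \<epsilon> (f p) \<odot>\<^bsub>M\<^esub> x)"
proof -
  interpret M: module k M by fact
  show ?thesis
    using assms(2,3) C.counit_linear unfolding lin_iff linear_maps_def left_regular_def
    by (auto simp: M.smult_l_distr M.smult_assoc1)
qed

lemma tsum_Cd: "c \<in> carrier C \<Longrightarrow> tsum G (\<Delta> c) f = ts C C G (\<Delta> c) f"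
  by (rule tsum_ts) (use Cd_closed in \<open>auto simp: tp_def\<close>)

lemma lin_smul:
  assumes M: "module k M" and "a \<in> carrier k" "lin k P M f"
  shows "lin k P M (\<lambda>p. a \<odot>\<^bsub>M\<^esub> f p)"
proof -
  interpret M: module k M by fact
  show ?thesis
    using assms
      by (auto simp: lin_iff M.smult_r_distr M.smult_assoc1[symmetric] cring.cring_simprules(14)[OF
        module_cring[OF M]])
qed

lemma smul_closed: "module k M \<Longrightarrow> a \<in> carrier k \<Longrightarrow> x \<in> carrier M \<Longrightarrow> a \<odot>\<^bsub>M\<^esub> x \<in> carrier M"
  by (rule module.smult_closed)

lemmas sweedler_simps = tens_simps lin_ep lin_smul smul_closed

text \<open>The axiom is one equation in C \<otimes> (C \<otimes> C). Applying the linear map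
  induced by \<open>F\<close> gives the rule for all trilinear summands, which is the form that
  rewriting needs. \<open>L_comult\<close>, \<open>rho_coassoc\<close> and
  \<open>left_comodule_coassoc\<close> arise in the same way.\<close>

lemma coassoc:
  assumes c: "c \<in> carrier C" and G: "module k G" and F: "trilin k C C C G F"
  shows "ts C C G (\<Delta> c) (\<lambda>c1 c2. ts C C G (\<Delta> c1) (\<lambda>d e. F d e c2)) =
    ts C C G (\<Delta> c) (\<lambda>c1 c2. ts C C G (\<Delta> c2) (\<lambda>d e. F c1 d e))"
proof -
  have *: "ts C C (tp k C (tp k C C)) (\<Delta> c) (\<lambda>c1 c2. ts C C (tp k C (tp k C C)) (\<Delta> c1)
    (\<lambda>d e. d \<boxtimes>\<^bsub>tp k C (tp k C C)\<^esub> (e \<boxtimes>\<^bsub>tp k C C\<^esub> c2))) =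
    ts C C (tp k C (tp k C C)) (\<Delta> c) (\<lambda>c1 c2. c1 \<boxtimes>\<^bsub>tp k C (tp k C C)\<^esub> \<Delta> c2)"
    using C.coassoc[OF c] unfolding Let_def tp_def[symmetric]
    by (simp add: tsum_Cd c)
  show ?thesis
    using arg_cong[OF *, of "\<lambda>X. ts C (tp k C C) G X (\<lambda>c1 Z. ts C C G Z (F c1))"] c G F
    by (simp add: sweedler_simps)
qed

lemma counit_left: "c \<in> carrier C \<Longrightarrow> ts C C C (\<Delta> c) (\<lambda>c1 c2. \<epsilon> c1 \<odot>\<^bsub>C\<^esub> c2) = c"
  using C.counit_left by (simp add: tsum_Cd)

lemma counit_right: "c \<in> carrier C \<Longrightarrow> ts C C C (\<Delta> c) (\<lambda>c1 c2. \<epsilon> c2 \<odot>\<^bsub>C\<^esub> c1) = c"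
  using C.counit_right by (simp add: tsum_Cd)

end

section \<open>The entwining axioms as rewrite rules\<close>

locale galois_setup =
  fixes k :: "('k, 'w) ring_scheme" and A :: "('k, 'a, 'x) module_scheme"
    and C :: "('k, 'c, 'y) coalgebra_scheme"
    and \<psi>R :: "('c, 'a) tens \<Rightarrow> ('a, 'c) tens" and \<psi>L :: "('a, 'c) tens \<Rightarrow> ('c, 'a) tens"
    and \<rho> :: "'a \<Rightarrow> ('a, 'c) tens"
  assumes entw: "invertible_weak_entwining k A C \<psi>R \<psi>L"
    and entwmod: "weak_entwined_module k A C \<psi>R A (\<otimes>\<^bsub>A\<^esub>) \<rho>"
begin

sublocale E: invertible_weak_entwining k A C \<psi>R \<psi>L by (rule entw)
sublocale EM: weak_entwined_module k A C \<psi>R A "(\<otimes>\<^bsub>A\<^esub>)" \<rho> by (rule entwmod)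
sublocale coalg_setup k C by unfold_locales

lemma A_assoc_algebra: "assoc_algebra k A"
  using entw by (simp add: invertible_weak_entwining_def weak_entwining_rr_def)

lemma A_module[simp]: "module k A"
  and A_ring: "ring A"
  using A_assoc_algebra by (simp_all add: assoc_algebra_def)

lemmas A_facts = ring.ring_simprules[OF A_ring]

abbreviation "u \<equiv> \<one>\<^bsub>A\<^esub>"
abbreviation mulA (infixl "**" 70) where "a ** b \<equiv> a \<otimes>\<^bsub>A\<^esub> b"
abbreviation "AC \<equiv> tp k A C"
abbreviation "CA \<equiv> tp k C A"
abbreviation "CC \<equiv> tp k C C"
abbreviation "AT \<equiv> tp k A A"

lemma R_lin: "lin k CA AC \<psi>R"
  using E.right.psi_linear by (simp add: lin_def tp_def)
lemmas R_comp[simp] = lin_comp[OF R_lin]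
lemmas R_closed[simp] = lin_closed[OF R_lin]

lemma L_lin: "lin k AC CA \<psi>L"
  using E.left.psi_linear by (simp add: lin_def tp_def)
lemmas L_comp[simp] = lin_comp[OF L_lin]
lemmas L_closed[simp] = lin_closed[OF L_lin]
lemmas L_ts[simp] = lin_apply_ts[OF _ _ tp_module[OF A_module C_module] tp_module[OF C_module A_module] _ L_lin]

lemma rho_lin: "lin k A AC \<rho>"
  using EM.rcoact_linear by (simp add: lin_def tp_def)
lemmas rho_comp[simp] = lin_comp[OF rho_lin]
lemmas rho_closed[simp] = lin_closed[OF rho_lin]

lemma mulL_lin: "a \<in> carrier A \<Longrightarrow> lin k A A (\<lambda>x. a ** x)"
  by (auto simp: lin_iff A_facts assoc_algebra.smult_mult_right[OF A_assoc_algebra])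
lemma mulR_lin: "a \<in> carrier A \<Longrightarrow> lin k A A (\<lambda>x. x ** a)"
  by (auto simp: lin_iff A_facts assoc_algebra.smult_mult_left[OF A_assoc_algebra])
lemma mulL_comp[simp]: "a \<in> carrier A \<Longrightarrow> lin k P A f \<Longrightarrow> lin k P A (\<lambda>p. a ** f p)"
  by (rule lin_comp[OF mulL_lin])
lemma mulR_comp[simp]: "a \<in> carrier A \<Longrightarrow> lin k P A f \<Longrightarrow> lin k P A (\<lambda>p. f p ** a)"
  by (rule lin_comp[OF mulR_lin])
lemmas mulL_ts[simp] = lin_apply_ts[OF _ _ A_module A_module _ mulL_lin]

lemma tsum_R: "Y \<in> carrier CA \<Longrightarrow> tsum G (\<psi>R Y) f = ts A C G (\<psi>R Y) f"
  by (rule tsum_ts) (use R_closed in \<open>auto simp: tp_def\<close>)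
lemma tsum_L: "Y \<in> carrier AC \<Longrightarrow> tsum G (\<psi>L Y) f = ts C A G (\<psi>L Y) f"
  by (rule tsum_ts) (use L_closed in \<open>auto simp: tp_def\<close>)
lemma tsum_rho: "a \<in> carrier A \<Longrightarrow> tsum G (\<rho> a) f = ts A C G (\<rho> a) f"
  by (rule tsum_ts) (use rho_closed in \<open>auto simp: tp_def\<close>)

lemmas tsum_simps = Let_def tsum_R tsum_L tsum_rho tsum_Cd

lemma R_mult: "\<lbrakk>a \<in> carrier A; b \<in> carrier A; c \<in> carrier C\<rbrakk> \<Longrightarrow>
   \<psi>R (c \<boxtimes>\<^bsub>CA\<^esub> (a ** b)) = ts A C AC (\<psi>R (c \<boxtimes>\<^bsub>CA\<^esub> a)) (\<lambda>a' c'. ts A C AC (\<psi>R (c' \<boxtimes>\<^bsub>CA\<^esub> b))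
     (\<lambda>b' c''. (a' ** b') \<boxtimes>\<^bsub>AC\<^esub> c''))"
  using E.right.psi_mult[of a b c] unfolding tp_def[symmetric] by (simp add: tsum_simps sweedler_simps)

lemma R_one: "c \<in> carrier C \<Longrightarrow>
   \<psi>R (c \<boxtimes>\<^bsub>CA\<^esub> u) = ts C C AC (\<Delta> c) (\<lambda>c1 c2. ts A C AC (\<psi>R (c1 \<boxtimes>\<^bsub>CA\<^esub> u)) (\<lambda>e c1'. (\<epsilon> c1' \<odot>\<^bsub>A\<^esub> e) \<boxtimes>\<^bsub>AC\<^esub> c2))"
  using E.right.psi_one[of c] unfolding tp_def[symmetric] by (simp add: tsum_simps sweedler_simps)

lemma L_mult: "\<lbrakk>a \<in> carrier A; b \<in> carrier A; c \<in> carrier C\<rbrakk> \<Longrightarrow>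
   \<psi>L ((a ** b) \<boxtimes>\<^bsub>AC\<^esub> c) = ts C A CA (\<psi>L (b \<boxtimes>\<^bsub>AC\<^esub> c)) (\<lambda>c' b'. ts C A CA (\<psi>L (a \<boxtimes>\<^bsub>AC\<^esub> c'))
     (\<lambda>c'' a'. c'' \<boxtimes>\<^bsub>CA\<^esub> (a' ** b')))"
  using E.left.psi_mult[of a b c] unfolding tp_def[symmetric] by (simp add: tsum_simps sweedler_simps)

lemma L_counit: "\<lbrakk>a \<in> carrier A; c \<in> carrier C\<rbrakk> \<Longrightarrow>
   ts C A A (\<psi>L (a \<boxtimes>\<^bsub>AC\<^esub> c)) (\<lambda>c' a'. \<epsilon> c' \<odot>\<^bsub>A\<^esub> a') = ts C A A (\<psi>L (u \<boxtimes>\<^bsub>AC\<^esub> c)) (\<lambda>c' e. \<epsilon> c' \<odot>\<^bsub>A\<^esub> (a ** e))"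
  using E.left.psi_counit[of a c] unfolding tp_def[symmetric] by (simp add: tsum_simps sweedler_simps)

lemma L_one: "c \<in> carrier C \<Longrightarrow>
   \<psi>L (u \<boxtimes>\<^bsub>AC\<^esub> c) = ts C C CA (\<Delta> c) (\<lambda>c1 c2. ts C A CA (\<psi>L (u \<boxtimes>\<^bsub>AC\<^esub> c2)) (\<lambda>c2' e. c1 \<boxtimes>\<^bsub>CA\<^esub> (\<epsilon> c2' \<odot>\<^bsub>A\<^esub> e)))"
  using E.left.psi_one[of c] unfolding tp_def[symmetric] by (simp add: tsum_simps sweedler_simps)

lemma L_comult:
  assumes a: "a \<in> carrier A" and c: "c \<in> carrier C" and G: "module k G" and F: "trilin k C C A G F"
  shows "ts C A G (\<psi>L (a \<boxtimes>\<^bsub>AC\<^esub> c)) (\<lambda>c' a'. ts C C G (\<Delta> c') (\<lambda>c1 c2. F c1 c2 a')) =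
    ts C C G (\<Delta> c) (\<lambda>c1 c2. ts C A G (\<psi>L (a \<boxtimes>\<^bsub>AC\<^esub> c1)) (\<lambda>c1' a'. ts C A G (\<psi>L (a' \<boxtimes>\<^bsub>AC\<^esub> c2))
      (\<lambda>c2' a''. F c1' c2' a'')))"
proof -
  have *: "ts C A (tp k CC A) (\<psi>L (a \<boxtimes>\<^bsub>AC\<^esub> c)) (\<lambda>c' a'. \<Delta> c' \<boxtimes>\<^bsub>tp k CC A\<^esub> a') =
    ts C C (tp k CC A) (\<Delta> c) (\<lambda>c1 c2. ts C A (tp k CC A) (\<psi>L (a \<boxtimes>\<^bsub>AC\<^esub> c1)) (\<lambda>c1' a'.
      ts C A (tp k CC A) (\<psi>L (a' \<boxtimes>\<^bsub>AC\<^esub> c2))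
      (\<lambda>c2' a''. (c1' \<boxtimes>\<^bsub>CC\<^esub> c2') \<boxtimes>\<^bsub>tp k CC A\<^esub> a'')))"
    using E.left.psi_comult[OF a c] a c unfolding tp_def[symmetric] by (simp add: tsum_simps sweedler_simps)
  show ?thesis
    using arg_cong[OF *, of "\<lambda>X. ts CC A G X (\<lambda>Z a. ts C C G Z (\<lambda>c1 c2. F c1 c2 a))"] a c G F
    by (simp add: sweedler_simps)
qed

lemma rho_coassoc:
  assumes a: "a \<in> carrier A" and G: "module k G" and F: "trilin k A C C G F"
  shows "ts A C G (\<rho> a) (\<lambda>a0 a1. ts A C G (\<rho> a0) (\<lambda>x d. F x d a1)) =
    ts A C G (\<rho> a) (\<lambda>a0 a1. ts C C G (\<Delta> a1) (\<lambda>c1 c2. F a0 c1 c2))"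
proof -
  have *: "ts A C (tp k A CC) (\<rho> a) (\<lambda>a0 a1. ts A C (tp k A CC) (\<rho> a0) (\<lambda>x d. x \<boxtimes>\<^bsub>tp k A CC\<^esub> (d \<boxtimes>\<^bsub>CC\<^esub> a1))) =
     ts A C (tp k A CC) (\<rho> a) (\<lambda>a0 a1. a0 \<boxtimes>\<^bsub>tp k A CC\<^esub> \<Delta> a1)"
    using EM.rcoact_coassoc[OF a] a unfolding tp_def[symmetric] by (simp add: tsum_simps sweedler_simps)
  show ?thesis
    using arg_cong[OF *, of "\<lambda>X. ts A CC G X (\<lambda>x Z. ts C C G Z (F x))"] a G F
    by (simp add: sweedler_simps)
qed

lemma rho_counit: "a \<in> carrier A \<Longrightarrow> ts A C A (\<rho> a) (\<lambda>a0 a1. \<epsilon> a1 \<odot>\<^bsub>A\<^esub> a0) = a"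
  using EM.rcoact_counit by (simp add: tsum_simps)

lemma rho_mult: "\<lbrakk>m \<in> carrier A; a \<in> carrier A\<rbrakk> \<Longrightarrow>
   \<rho> (m ** a) = ts A C AC (\<rho> m) (\<lambda>m0 m1. ts A C AC (\<psi>R (m1 \<boxtimes>\<^bsub>CA\<^esub> a)) (\<lambda>a' m1'. (m0 ** a') \<boxtimes>\<^bsub>AC\<^esub> m1'))"
  using EM.coact_act[of m a] unfolding tp_def[symmetric] by (simp add: tsum_simps sweedler_simps)

definition "pR X = ts A C AC X (\<lambda>a c. ts A C AC (\<psi>R (c \<boxtimes>\<^bsub>CA\<^esub> u)) (\<lambda>e c'. (a ** e) \<boxtimes>\<^bsub>AC\<^esub> c'))"
definition "pL Y = ts C A CA Y (\<lambda>c a. ts C A CA (\<psi>L (u \<boxtimes>\<^bsub>AC\<^esub> c)) (\<lambda>c' e. c' \<boxtimes>\<^bsub>CA\<^esub> (e ** a)))"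

lemma proj_right_eq: "X \<in> carrier AC \<Longrightarrow> proj_right k A C \<psi>R X = pR X"
  unfolding proj_right_def pR_def tp_def[symmetric]
  by (subst tsum_ts[of k A C]) (auto simp: tp_def[symmetric] tsum_simps sweedler_simps)

lemma proj_left_eq: "X \<in> carrier CA \<Longrightarrow> proj_left k A C \<psi>L X = pL X"
  unfolding proj_left_def pL_def tp_def[symmetric]
  by (subst tsum_ts[of k C A]) (auto simp: tp_def[symmetric] tsum_simps sweedler_simps)

lemma R_L: "X \<in> carrier AC \<Longrightarrow> \<psi>R (\<psi>L X) = pR X"
  using E.psi_right_left[of X] unfolding tp_def[symmetric] by (simp add: proj_right_eq)

lemma L_R: "X \<in> carrier CA \<Longrightarrow> \<psi>L (\<psi>R X) = pL X"
  using E.psi_left_right[of X] unfolding tp_def[symmetric] by (simp add: proj_left_eq)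

lemma counit_psi: "c \<in> carrier C \<Longrightarrow>
  ts C A A (\<psi>L (u \<boxtimes>\<^bsub>AC\<^esub> c)) (\<lambda>c' e. \<epsilon> c' \<odot>\<^bsub>A\<^esub> e) = ts A C A (\<psi>R (c \<boxtimes>\<^bsub>CA\<^esub> u)) (\<lambda>e c'. \<epsilon> c' \<odot>\<^bsub>A\<^esub> e)"
  using E.counit_psi[of c] unfolding tp_def[symmetric] by (simp add: tsum_simps sweedler_simps)

subsection \<open>The left coaction on \<open>A\<close>\<close>

lemma mul_closed[simp]: "\<lbrakk>a \<in> carrier A; b \<in> carrier A\<rbrakk> \<Longrightarrow> a ** b \<in> carrier A"
  and u_closed[simp]: "u \<in> carrier A"
  and mul_assoc: "\<lbrakk>a \<in> carrier A; b \<in> carrier A; c \<in> carrier A\<rbrakk> \<Longrightarrow> a ** b ** c = a ** (b ** c)"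
  and u_mul[simp]: "a \<in> carrier A \<Longrightarrow> u ** a = a" "a \<in> carrier A \<Longrightarrow> a ** u = a"
  using A_ring by (simp_all add: ring.ring_simprules ring_def monoid.r_one)

lemma smul_mul: "\<lbrakk>r \<in> carrier k; x \<in> carrier A; y \<in> carrier A\<rbrakk> \<Longrightarrow> r \<odot>\<^bsub>A\<^esub> (x ** y) = x ** (r \<odot>\<^bsub>A\<^esub> y)"
  by (rule assoc_algebra.smult_mult_right[OF A_assoc_algebra])

section \<open>Actions on A \<otimes> C and C \<otimes> A, and their behaviour under \<psi>R and
  \<psi>L\<close>

definition "lact a X = ts A C AC X (\<lambda>x c. (a ** x) \<boxtimes>\<^bsub>AC\<^esub> c)"
definition "ract X b = ts A C AC X (\<lambda>x c. ts A C AC (\<psi>R (c \<boxtimes>\<^bsub>CA\<^esub> b)) (\<lambda>a' c'. (x ** a') \<boxtimes>\<^bsub>AC\<^esub> c'))"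
definition "rmul Y b = ts C A CA Y (\<lambda>c a. c \<boxtimes>\<^bsub>CA\<^esub> (a ** b))"
definition "lcoact a = \<psi>L (lact a (\<rho> u))"

lemma lact_lin1: "a \<in> carrier A \<Longrightarrow> lin k AC AC (lact a)"
  unfolding lact_def by (simp add: sweedler_simps)
lemma lact_lin2: "X \<in> carrier AC \<Longrightarrow> lin k A AC (\<lambda>a. lact a X)"
  unfolding lact_def by (simp add: sweedler_simps)
lemma ract_lin1: "a \<in> carrier A \<Longrightarrow> lin k AC AC (\<lambda>X. ract X a)"
  unfolding ract_def by (simp add: sweedler_simps)
lemma ract_lin2: "X \<in> carrier AC \<Longrightarrow> lin k A AC (ract X)"
  unfolding ract_def by (simp add: sweedler_simps)
lemma rmul_lin1: "a \<in> carrier A \<Longrightarrow> lin k CA CA (\<lambda>X. rmul X a)"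
  unfolding rmul_def by (simp add: sweedler_simps)
lemma rmul_lin2: "X \<in> carrier CA \<Longrightarrow> lin k A CA (rmul X)"
  unfolding rmul_def by (simp add: sweedler_simps)
lemma pR_lin: "lin k AC AC pR"
  unfolding pR_def by (simp add: sweedler_simps)
lemma pL_lin: "lin k CA CA pL"
  unfolding pL_def by (simp add: sweedler_simps)
lemma lcoact_lin: "lin k A CA lcoact"
  unfolding lcoact_def lact_def by (simp add: sweedler_simps)

lemmas op_closed[simp] = lin_closed[OF lact_lin1] lin_closed[OF ract_lin2] lin_closed[OF rmul_lin2]
  lin_closed[OF pR_lin] lin_closed[OF pL_lin] lin_closed[OF lcoact_lin]
lemmas op_comp[simp] = lin_comp[OF lact_lin1] lin_comp[OF lact_lin2] lin_comp[OF ract_lin1] lin_comp[OF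
  ract_lin2]
  lin_comp[OF rmul_lin1] lin_comp[OF rmul_lin2] lin_comp[OF pR_lin] lin_comp[OF pL_lin] lin_comp[OF lcoact_lin]

text \<open>This is the multiplicativity axiom in map form: multiplication on C \<otimes> A
  corresponds to the right action of the coring. Since acting by 1 is \<open>pR\<close>, it follows
  that \<open>pR\<close> fixes all values of \<psi>R.\<close>

lemma ract_R:
  assumes "Y \<in> carrier CA" "b \<in> carrier A"
  shows "ract (\<psi>R Y) b = \<psi>R (rmul Y b)"
  by (rule tp_ext[OF C_module A_module assms(1), where G = AC])
    (use assms in \<open>simp_all add: sweedler_simps R_mult ract_def rmul_def\<close>)

lemma ract_u: "X \<in> carrier AC \<Longrightarrow> ract X u = pR X"
  by (simp add: ract_def pR_def)

lemma rmul_u: "Y \<in> carrier CA \<Longrightarrow> rmul Y u = Y"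
  by (simp add: rmul_def sweedler_simps ts_pures)

lemma pR_R: "Y \<in> carrier CA \<Longrightarrow> pR (\<psi>R Y) = \<psi>R Y"
  by (simp add: ract_u[symmetric] ract_R rmul_u)

lemma rho_ract: "\<lbrakk>a \<in> carrier A; b \<in> carrier A\<rbrakk> \<Longrightarrow> \<rho> (a ** b) = ract (\<rho> a) b"
  by (simp add: rho_mult ract_def)

lemma rho_eq: "a \<in> carrier A \<Longrightarrow> \<rho> a = ract (\<rho> u) a"
  using rho_ract[of u a] by simp

lemma pR_rho: "a \<in> carrier A \<Longrightarrow> pR (\<rho> a) = \<rho> a"
  using rho_ract[of a u] by (simp add: ract_u)

lemma ract_lact:
  assumes "X \<in> carrier AC" "a \<in> carrier A" "b \<in> carrier A"
  shows "ract (lact a X) b = lact a (ract X b)"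
  by (rule tp_ext[OF A_module C_module assms(1), where G = AC])
    (use assms in \<open>simp_all add: sweedler_simps ract_def lact_def mul_assoc\<close>)

lemma lact_lact:
  assumes "X \<in> carrier AC" "a \<in> carrier A" "b \<in> carrier A"
  shows "lact (a ** b) X = lact a (lact b X)"
  by (rule tp_ext[OF A_module C_module assms(1), where G = AC])
    (use assms in \<open>simp_all add: sweedler_simps lact_def mul_assoc\<close>)

lemma lact_u: "X \<in> carrier AC \<Longrightarrow> lact u X = X"
  by (simp add: lact_def sweedler_simps ts_pures)

lemma pR_lact: "\<lbrakk>X \<in> carrier AC; a \<in> carrier A\<rbrakk> \<Longrightarrow> pR (lact a X) = lact a (pR X)"
  by (simp add: ract_u[symmetric] ract_lact)

lemma pL_rmul:
  assumes "Y \<in> carrier CA" "b \<in> carrier A"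
  shows "pL (rmul Y b) = rmul (pL Y) b"
  by (rule tp_ext[OF C_module A_module assms(1), where G = CA])
    (use assms in \<open>simp_all add: sweedler_simps pL_def rmul_def mul_assoc\<close>)

text \<open>An element fixed by \<open>pR\<close> equals \<psi>R(\<psi>L(X)), so acting on it is
  multiplying inside \<psi>R; and \<psi>L \<circ> \<psi>R = \<open>pL\<close> commutes with
  multiplication on the right.\<close>

lemma L_ract:
  assumes X: "X \<in> carrier AC" "pR X = X" and b: "b \<in> carrier A"
  shows "\<psi>L (ract X b) = rmul (\<psi>L X) b"
proof -
  have "\<psi>L (ract (\<psi>R (\<psi>L X)) b) = rmul (\<psi>L (\<psi>R (\<psi>L X))) b"
    using X b by (simp add: ract_R L_R pL_rmul rmul_def[of _ b] del: op_comp) (simp add: rmul_def[symmetric]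
      sweedler_simps L_R pL_rmul)
  then show ?thesis using X by (simp add: R_L)
qed

text \<open>As \<rho>(b) = g b, the element a \<rho>(b) is (a g) b, and \<psi>L takes the right
  action by b out as a multiplication.\<close>

lemma L_lact_rho: "\<lbrakk>a \<in> carrier A; b \<in> carrier A\<rbrakk> \<Longrightarrow> \<psi>L (lact a (\<rho> b)) = rmul (lcoact a) b"
  by (subst rho_eq) (simp_all add: lcoact_def ract_lact[symmetric] L_ract pR_lact pR_rho)

lemma L_lact:
  assumes "X \<in> carrier AC" "a \<in> carrier A"
  shows "\<psi>L (lact a X) = ts C A CA (\<psi>L X) (\<lambda>c' b'. ts C A CA (\<psi>L (a \<boxtimes>\<^bsub>AC\<^esub> c')) (\<lambda>c'' a'. c'' \<boxtimes>\<^bsub>CA\<^esub> (a' ** b')))"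
  by (rule tp_ext[OF A_module C_module assms(1), where G = CA])
    (use assms in \<open>simp_all add: sweedler_simps lact_def L_mult\<close>)

text \<open>\<open>L_comult\<close> splits the C-leg of \<psi>L(a g), and coassociativity of \<rho>
  at 1 replaces the comultiplication of the C-leg of g by \<rho> of its A-leg x. The inner part
  becomes \<psi>L(a \<rho>(x)), which is \<open>lcoact a\<close> times x; this x recombines with the
  remaining leg of g to form the second \<open>lcoact\<close>.\<close>

lemma lcoact_coassoc:
  assumes a: "a \<in> carrier A" and G: "module k G" and F: "trilin k C C A G F"
  shows "ts C A G (lcoact a) (\<lambda>c x. ts C A G (lcoact x) (\<lambda>d y. F c d y)) =
    ts C A G (lcoact a) (\<lambda>c x. ts C C G (\<Delta> c) (\<lambda>c1 c2. F c1 c2 x))"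
proof -
  have "ts C A G (lcoact a) (\<lambda>c x. ts C C G (\<Delta> c) (\<lambda>c1 c2. F c1 c2 x)) =
    ts A C G (\<rho> u) (\<lambda>x c. ts C A G (\<psi>L ((a ** x) \<boxtimes>\<^bsub>AC\<^esub> c)) (\<lambda>c y. ts C C G (\<Delta> c) (\<lambda>c1 c2. F c1 c2 y)))"
    unfolding lcoact_def lact_def using a G F by (simp add: sweedler_simps)
  also have "\<dots> = ts A C G (\<rho> u) (\<lambda>x c. ts C C G (\<Delta> c) (\<lambda>c1 c2. ts C A G (\<psi>L ((a ** x) \<boxtimes>\<^bsub>AC\<^esub> c1)) (\<lambda>c1' a'.
     ts C A G (\<psi>L (a' \<boxtimes>\<^bsub>AC\<^esub> c2)) (\<lambda>c2' a''. F c1' c2' a''))))"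
    using a G F by (simp add: L_comult)
  also have "\<dots> = ts A C G (\<rho> u) (\<lambda>x c. ts A C G (\<rho> x) (\<lambda>y d. ts C A G (\<psi>L ((a ** y) \<boxtimes>\<^bsub>AC\<^esub> d)) (\<lambda>c1' a'.
     ts C A G (\<psi>L (a' \<boxtimes>\<^bsub>AC\<^esub> c)) (\<lambda>c2' a''. F c1' c2' a''))))"
    by (rule rho_coassoc[symmetric]) (use a G F in \<open>simp_all add: sweedler_simps\<close>)
  also have "\<dots> = ts A C G (\<rho> u) (\<lambda>x c. ts C A G (\<psi>L (lact a (\<rho> x))) (\<lambda>c1' a'.
     ts C A G (\<psi>L (a' \<boxtimes>\<^bsub>AC\<^esub> c)) (\<lambda>c2' a''. F c1' c2' a'')))"
    unfolding lact_def using a G F by (simp add: sweedler_simps)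
  also have "\<dots> = ts A C G (\<rho> u) (\<lambda>x c. ts C A G (lcoact a) (\<lambda>c1' a'.
     ts C A G (\<psi>L ((a' ** x) \<boxtimes>\<^bsub>AC\<^esub> c)) (\<lambda>c2' a''. F c1' c2' a'')))"
    using a G F by (simp add: L_lact_rho) (simp add: rmul_def sweedler_simps)
  also have "\<dots> = ts C A G (lcoact a) (\<lambda>c1' a'. ts A C G (\<rho> u) (\<lambda>x c.
     ts C A G (\<psi>L ((a' ** x) \<boxtimes>\<^bsub>AC\<^esub> c)) (\<lambda>c2' a''. F c1' c2' a'')))"
    by (rule ts_swap[where k = k]) (use a G F in \<open>simp_all add: sweedler_simps\<close>)
  also have "\<dots> = ts C A G (lcoact a) (\<lambda>c x. ts C A G (lcoact x) (\<lambda>d y. F c d y))"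
    using a G F by (simp add: lcoact_def[of "_"] lact_def sweedler_simps cong: ts_cong)
  finally show ?thesis ..
qed

text \<open>The counit axiom of \<psi>L takes a x out of the sum, and \<open>counit_psi\<close>
  exchanges \<psi>L(1 \<otimes> c) for \<psi>R(c \<otimes> 1). What appears is the counit applied to
  \<open>pR\<close> of g, and \<open>pR\<close> fixes g.\<close>

lemma lcoact_counit:
  assumes a: "a \<in> carrier A"
  shows "ts C A A (lcoact a) (\<lambda>c x. \<epsilon> c \<odot>\<^bsub>A\<^esub> x) = a"
proof -
  have "ts C A A (lcoact a) (\<lambda>c x. \<epsilon> c \<odot>\<^bsub>A\<^esub> x) =
    ts A C A (\<rho> u) (\<lambda>x c. ts C A A (\<psi>L ((a ** x) \<boxtimes>\<^bsub>AC\<^esub> c)) (\<lambda>c x. \<epsilon> c \<odot>\<^bsub>A\<^esub> x))"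
    unfolding lcoact_def lact_def using a by (simp add: sweedler_simps)
  also have "\<dots> = ts A C A (\<rho> u) (\<lambda>x c. (a ** x) ** ts A C A (\<psi>R (c \<boxtimes>\<^bsub>CA\<^esub> u)) (\<lambda>e c'. \<epsilon> c' \<odot>\<^bsub>A\<^esub> e))"
    using a by (simp add: L_counit[of "a ** _"]) (simp add: smul_mul counit_psi[symmetric] sweedler_simps)
  also have "\<dots> = a ** ts A C A (pR (\<rho> u)) (\<lambda>x c. \<epsilon> c \<odot>\<^bsub>A\<^esub> x)"
    using a by (simp add: pR_def sweedler_simps mul_assoc smul_mul)
  also have "\<dots> = a" using a by (simp add: pR_rho rho_counit)
  finally show ?thesis .
qed

end

section \<open>Left comodules and the lifting property\<close>

lemma ts_pures_pureL:
  assumes "module k M" "module k N" "module k P" "X \<in> carrier (tp k M N)" "p \<in> carrier P"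
  shows "ts M N (tp k (tp k M N) P) X (\<lambda>m n. (m \<boxtimes>\<^bsub>tp k M N\<^esub> n) \<boxtimes>\<^bsub>tp k (tp k M N) P\<^esub> p) =
    X \<boxtimes>\<^bsub>tp k (tp k M N) P\<^esub> p"
proof -
  have "ts M N (tp k (tp k M N) P) X (\<lambda>m n. (m \<boxtimes>\<^bsub>tp k M N\<^esub> n) \<boxtimes>\<^bsub>tp k (tp k M N) P\<^esub> p) =
    ts M N (tp k M N) X (\<lambda>m n. m \<boxtimes>\<^bsub>tp k M N\<^esub> n) \<boxtimes>\<^bsub>tp k (tp k M N) P\<^esub> p"
    by (rule pureL_ts[symmetric]) (use assms in \<open>simp_all add: tens_simps\<close>)
  then show ?thesis using assms by (simp add: ts_pures)
qed

context coalg_setup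
begin

lemma left_comodule_hom_iff:
  assumes M: "module k M" and N: "module k N" and g: "lin k M (tp k C M) \<gamma>M"
  shows "left_comodule_hom k C M \<gamma>M N \<gamma>N f \<longleftrightarrow> lin k M N f \<and>
    (\<forall>m\<in>carrier M. \<gamma>N (f m) = ts C M (tp k C N) (\<gamma>M m) (\<lambda>c x. c \<boxtimes>\<^bsub>tp k C N\<^esub> f x))"
proof -
  have "tsum (tp k C N) (\<gamma>M m) h = ts C M (tp k C N) (\<gamma>M m) h" if "m \<in> carrier M" for m h
    by (rule tsum_ts[OF C_module M]) (use lin_closed[OF g that] in \<open>simp add: tp_def\<close>)
  note * = this
  have "(\<forall>m\<in>carrier M. \<gamma>N (f m) = tsum (tp k C N) (\<gamma>M m) (\<lambda>c x. c \<boxtimes>\<^bsub>tp k C N\<^esub> f x)) \<longleftrightarrow>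
    (\<forall>m\<in>carrier M. \<gamma>N (f m) = ts C M (tp k C N) (\<gamma>M m) (\<lambda>c x. c \<boxtimes>\<^bsub>tp k C N\<^esub> f x))"
    by (rule ball_cong[OF refl]) (simp only: *)
  then show ?thesis unfolding left_comodule_hom_def tp_def[symmetric] lin_def[symmetric] by simp
qed

lemma left_comodule_iff:
  "left_comodule k C M \<gamma> \<longleftrightarrow> module k M \<and> lin k M (tp k C M) \<gamma> \<and>
    (\<forall>m\<in>carrier M. ts C M (tp k (tp k C C) M) (\<gamma> m) (\<lambda>c n. ts C M (tp k (tp k C C) M) (\<gamma> n)
        (\<lambda>d n'. (c \<boxtimes>\<^bsub>tp k C C\<^esub> d) \<boxtimes>\<^bsub>tp k (tp k C C) M\<^esub> n')) =
      ts C M (tp k (tp k C C) M) (\<gamma> m) (\<lambda>c n. \<Delta> c \<boxtimes>\<^bsub>tp k (tp k C C) M\<^esub> n)) \<and>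
    (\<forall>m\<in>carrier M. ts C M M (\<gamma> m) (\<lambda>c n. \<epsilon> c \<odot>\<^bsub>M\<^esub> n) = m)"
proof -
  have "tsum G (\<gamma> m) h = ts C M G (\<gamma> m) h" if "m \<in> carrier M" "module k M" "lin k M (tp k C M) \<gamma>"
    for m and G :: "('g,'z) ring_scheme" and h
    by (rule tsum_ts) (use that lin_closed[OF that(3,1)] in \<open>auto simp: tp_def\<close>)
  note * = this
  show ?thesis
    unfolding left_comodule_def left_comodule_axioms_def tp_def[symmetric] lin_def[symmetric]
    using coalg by (auto simp: * Let_def cong: conj_cong)
qed

lemma left_comodule_module: "left_comodule k C M \<gamma> \<Longrightarrow> module k M"
  and left_comodule_lin: "left_comodule k C M \<gamma> \<Longrightarrow> lin k M (tp k C M) \<gamma>"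
  and left_comodule_counit: "left_comodule k C M \<gamma> \<Longrightarrow> m \<in> carrier M \<Longrightarrow> ts C M M (\<gamma> m) (\<lambda>c n. \<epsilon> c \<odot>\<^bsub>M\<^esub> n) = m"
  by (simp_all add: left_comodule_iff)

lemma left_comodule_coassoc:
  assumes M: "left_comodule k C M \<gamma>" and m: "m \<in> carrier M" and G: "module k G" and F: "trilin k C C M G F"
  shows "ts C M G (\<gamma> m) (\<lambda>c n. ts C M G (\<gamma> n) (\<lambda>d n'. F c d n')) =
    ts C M G (\<gamma> m) (\<lambda>c n. ts C C G (\<Delta> c) (\<lambda>c1 c2. F c1 c2 n))"
proof -
  note Mm[simp] = left_comodule_module[OF M]
  note g = left_comodule_lin[OF M]
  note [simp] = lin_closed[OF g] lin_comp[OF g]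
  have *: "ts C M (tp k (tp k C C) M) (\<gamma> m) (\<lambda>c n. ts C M (tp k (tp k C C) M) (\<gamma> n)
        (\<lambda>d n'. (c \<boxtimes>\<^bsub>tp k C C\<^esub> d) \<boxtimes>\<^bsub>tp k (tp k C C) M\<^esub> n')) =
      ts C M (tp k (tp k C C) M) (\<gamma> m) (\<lambda>c n. \<Delta> c \<boxtimes>\<^bsub>tp k (tp k C C) M\<^esub> n)"
    using M m by (simp add: left_comodule_iff)
  show ?thesis
    using arg_cong[OF *, of "\<lambda>X. ts (tp k C C) M G X (\<lambda>Z n. ts C C G Z (\<lambda>c1 c2. F c1 c2 n))"] m G F
    by (simp add: sweedler_simps)
qed

lemma left_comodule_C: "left_comodule k C C \<Delta>"
  unfolding left_comodule_iff
proof (intro conjI ballI)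
  fix c assume c: "c \<in> carrier C"
  show "ts C C (tp k (tp k C C) C) (\<Delta> c) (\<lambda>c n. ts C C (tp k (tp k C C) C) (\<Delta> n)
    (\<lambda>d n'. (c \<boxtimes>\<^bsub>tp k C C\<^esub> d) \<boxtimes>\<^bsub>tp k (tp k C C) C\<^esub> n')) =
         ts C C (tp k (tp k C C) C) (\<Delta> c) (\<lambda>c n. \<Delta> c \<boxtimes>\<^bsub>tp k (tp k C C) C\<^esub> n)"
    using coassoc[OF c, of "tp k (tp k C C) C" "\<lambda>c d n'. (c \<boxtimes>\<^bsub>tp k C C\<^esub> d) \<boxtimes>\<^bsub>tp k (tp k C C) C\<^esub> n'"]
    by (simp add: sweedler_simps ts_pures_pureL c ts_pures)
qed (simp_all add: Cd_lin counit_left)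

section \<open>Comodules of the form M \<otimes> V\<close>

definition "coact_tensor M V \<gamma> X =
  ts M V (tp k C (tp k M V)) X (\<lambda>m v. ts C M (tp k C (tp k M V)) (\<gamma> m)
    (\<lambda>c n. c \<boxtimes>\<^bsub>tp k C (tp k M V)\<^esub> (n \<boxtimes>\<^bsub>tp k M V\<^esub> v)))"

text \<open>\<open>V\<close> is a spectator: on pure tensors each axiom is the one for
  \<open>M\<close> with v carried along.\<close>

lemma left_comodule_tensor:
  assumes M: "left_comodule k C M \<gamma>" and V[simp]: "module k V"
  shows "left_comodule k C (tp k M V) (coact_tensor M V \<gamma>)"
proof -
  note Mm[simp] = left_comodule_module[OF M]
  note g = left_comodule_lin[OF M]
  note [simp] = lin_closed[OF g] lin_comp[OF g]
  let ?T = "tp k (tp k C C) (tp k M V)"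
  show ?thesis
    unfolding left_comodule_iff
  proof (intro conjI ballI)
    show L: "lin k (tp k M V) (tp k C (tp k M V)) (coact_tensor M V \<gamma>)"
      unfolding coact_tensor_def by (simp add: sweedler_simps)
    note [simp] = lin_comp[OF L] lin_closed[OF L]
    fix X assume X: "X \<in> carrier (tp k M V)"
    show "ts C (tp k M V) ?T (coact_tensor M V \<gamma> X) (\<lambda>c n. ts C (tp k M V) ?T (coact_tensor M V \<gamma> n)
      (\<lambda>d n'. (c \<boxtimes>\<^bsub>tp k C C\<^esub> d) \<boxtimes>\<^bsub>?T\<^esub> n')) =
         ts C (tp k M V) ?T (coact_tensor M V \<gamma> X) (\<lambda>c n. \<Delta> c \<boxtimes>\<^bsub>?T\<^esub> n)"
    proof (rule tp_ext[OF Mm V X, where G = ?T])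
      fix m v assume mv: "m \<in> carrier M" "v \<in> carrier V"
      have "ts C M ?T (\<gamma> m) (\<lambda>c n. ts C M ?T (\<gamma> n) (\<lambda>d n'. (c \<boxtimes>\<^bsub>tp k C C\<^esub> d) \<boxtimes>\<^bsub>?T\<^esub> (n' \<boxtimes>\<^bsub>tp k M V\<^esub> v))) =
         ts C M ?T (\<gamma> m) (\<lambda>c n. ts C C ?T (\<Delta> c) (\<lambda>c1 c2. (c1 \<boxtimes>\<^bsub>tp k C C\<^esub> c2) \<boxtimes>\<^bsub>?T\<^esub> (n \<boxtimes>\<^bsub>tp k M V\<^esub> v)))"
        by (rule left_comodule_coassoc[OF M]) (use mv in \<open>simp_all add: sweedler_simps\<close>)
      also have "\<dots> = ts C M ?T (\<gamma> m) (\<lambda>c n. \<Delta> c \<boxtimes>\<^bsub>?T\<^esub> (n \<boxtimes>\<^bsub>tp k M V\<^esub> v))"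
        using mv by (simp add: sweedler_simps ts_pures_pureL)
      finally show "ts C (tp k M V) ?T (coact_tensor M V \<gamma> (m \<boxtimes>\<^bsub>tp k M V\<^esub> v)) (\<lambda>c n.
        ts C (tp k M V) ?T (coact_tensor M V \<gamma> n) (\<lambda>d n'. (c \<boxtimes>\<^bsub>tp k C C\<^esub> d) \<boxtimes>\<^bsub>?T\<^esub> n')) =
         ts C (tp k M V) ?T (coact_tensor M V \<gamma> (m \<boxtimes>\<^bsub>tp k M V\<^esub> v)) (\<lambda>c n. \<Delta> c \<boxtimes>\<^bsub>?T\<^esub> n)"
        using mv by (simp add: sweedler_simps coact_tensor_def)
    qed (simp_all add: sweedler_simps)
    show "ts C (tp k M V) (tp k M V) (coact_tensor M V \<gamma> X) (\<lambda>c n. \<epsilon> c \<odot>\<^bsub>tp k M V\<^esub> n) = X"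
    proof (rule tp_ext[OF Mm V X, where G = "tp k M V"])
      fix m v assume mv: "m \<in> carrier M" "v \<in> carrier V"
      have "ts C M (tp k M V) (\<gamma> m) (\<lambda>c n. \<epsilon> c \<odot>\<^bsub>tp k M V\<^esub> (n \<boxtimes>\<^bsub>tp k M V\<^esub> v)) =
        ts C M (tp k M V) (\<gamma> m) (\<lambda>c n. (\<epsilon> c \<odot>\<^bsub>M\<^esub> n) \<boxtimes>\<^bsub>tp k M V\<^esub> v)"
        using mv by (simp add: tp_pure_smult)
      also have "\<dots> = ts C M M (\<gamma> m) (\<lambda>c n. \<epsilon> c \<odot>\<^bsub>M\<^esub> n) \<boxtimes>\<^bsub>tp k M V\<^esub> v"
        using mv by (simp add: sweedler_simps)
      finally show "ts C (tp k M V) (tp k M V) (coact_tensor M V \<gamma> (m \<boxtimes>\<^bsub>tp k M V\<^esub> v))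
        (\<lambda>c n. \<epsilon> c \<odot>\<^bsub>tp k M V\<^esub> n) = m \<boxtimes>\<^bsub>tp k M V\<^esub> v"
        using mv by (simp add: sweedler_simps coact_tensor_def left_comodule_counit[OF M])
    qed (simp_all add: sweedler_simps)
  qed (simp_all add: sweedler_simps)
qed

end

text \<open>The quotient of \<open>M\<close> by the relation \<open>q x = q y\<close>, realised on
  the values of \<open>q\<close>; operations are carried out on chosen preimages. For injective
  \<open>q\<close> it is a copy of \<open>M\<close> in another type, and this is how comodules reach
  the type of the projectivity hypothesis.\<close>

definition quot_module :: "('k, 'm, 'x) module_scheme \<Rightarrow> ('m \<Rightarrow> 'u) \<Rightarrow> ('k, 'u) module"
  where "quot_module M q = (let r = inv_into (carrier M) q in
    \<lparr>carrier = q ` carrier M, monoid.mult = undefined, one = undefined, ring.zero = q \<zero>\<^bsub>M\<^esub>,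
     add = (\<lambda>x y. q (r x \<oplus>\<^bsub>M\<^esub> r y)), smult = (\<lambda>a x. q (a \<odot>\<^bsub>M\<^esub> r x))\<rparr>)"

lemma quot_module:
  assumes M: "module k M"
    and add: "\<And>x x' y y'. \<lbrakk>x \<in> carrier M; x' \<in> carrier M; y \<in> carrier M; y' \<in> carrier M; q x = q x'; q y = q y'\<rbrakk>
      \<Longrightarrow> q (x \<oplus>\<^bsub>M\<^esub> y) = q (x' \<oplus>\<^bsub>M\<^esub> y')"
    and smult: "\<And>r x x'. \<lbrakk>r \<in> carrier k; x \<in> carrier M; x' \<in> carrier M; q x = q x'\<rbrakk> \<Longrightarrow> q (r \<odot>\<^bsub>M\<^esub> x) =
      q (r \<odot>\<^bsub>M\<^esub> x')"
  shows "module k (quot_module M q)" and "lin k M (quot_module M q) q"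
    and "carrier (quot_module M q) = q ` carrier M"
proof -
  interpret M: module k M by fact
  let ?N = "quot_module M q"
  have c: "carrier ?N = q ` carrier M" and z: "\<zero>\<^bsub>?N\<^esub> = q \<zero>\<^bsub>M\<^esub>" by (simp_all add: quot_module_def Let_def)
  have r: "inv_into (carrier M) q (q x) \<in> carrier M" "q (inv_into (carrier M) q (q x)) =
    q x" if "x \<in> carrier M" for x
    using that by (simp_all add: inv_into_into f_inv_into_f)
  have a: "q x \<oplus>\<^bsub>?N\<^esub> q y = q (x \<oplus>\<^bsub>M\<^esub> y)" if "x \<in> carrier M" "y \<in> carrier M" for x y
    unfolding quot_module_def Let_def by simp (rule add; simp add: r that)
  have s: "t \<odot>\<^bsub>?N\<^esub> q x = q (t \<odot>\<^bsub>M\<^esub> x)" if "t \<in> carrier k" "x \<in> carrier M" for t x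
    unfolding quot_module_def Let_def by simp (rule smult; simp add: r that)
  have inv: "\<exists>y\<in>carrier M. q (x \<oplus>\<^bsub>M\<^esub> y) = q \<zero>\<^bsub>M\<^esub>" if "x \<in> carrier M" for x
    using that by (intro bexI[of _ "\<ominus>\<^bsub>M\<^esub> x"]) (simp_all add: M.M.r_neg)
  show "module k ?N"
  proof (rule moduleI)
    show "abelian_group ?N"
      by (rule abelian_groupI) (auto simp: c z a M.a_ac inv)
  qed (auto simp: M.R.is_cring c s a M.smult_l_distr M.smult_r_distr M.smult_assoc1)
  show "lin k M ?N q" by (auto simp: lin_iff c a s)
  show "carrier ?N = q ` carrier M" by (rule c)
qed

section \<open>Comodule maps and quotient comodules\<close>

context coalg_setup
begin

lemma left_comodule_hom_comp:
  assumes M: "left_comodule k C M \<gamma>M" and N: "left_comodule k C N \<gamma>N" and P: "left_comodule k C P \<gamma>P"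
    and f: "left_comodule_hom k C M \<gamma>M N \<gamma>N f" and g: "left_comodule_hom k C N \<gamma>N P \<gamma>P g"
  shows "left_comodule_hom k C M \<gamma>M P \<gamma>P (\<lambda>x. g (f x))"
proof -
  note mods[simp] = left_comodule_module[OF M] left_comodule_module[OF N] left_comodule_module[OF P]
  note lins = left_comodule_lin[OF M] left_comodule_lin[OF N] left_comodule_lin[OF P]
  note iff = left_comodule_hom_iff[OF mods(1,2) lins(1)] left_comodule_hom_iff[OF mods(2,3) lins(2)]
    left_comodule_hom_iff[OF mods(1,3) lins(1)]
  have fl: "lin k M N f" and gl: "lin k N P g" using f g unfolding iff by auto
  note [simp] = fl gl lin_closed[OF gl] lin_closed[OF lins(1)] lin_closed[OF fl] lin_comp[OF fl] lin_comp[OF gl]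
  show ?thesis
    unfolding iff
  proof (intro conjI ballI)
    fix m assume m: "m \<in> carrier M"
    then have "\<gamma>P (g (f m)) = ts C N (tp k C P) (\<gamma>N (f m)) (\<lambda>c x. c \<boxtimes>\<^bsub>tp k C P\<^esub> g x)"
      using g unfolding iff by simp
    also have "\<gamma>N (f m) = ts C M (tp k C N) (\<gamma>M m) (\<lambda>c x. c \<boxtimes>\<^bsub>tp k C N\<^esub> f x)"
      using f m unfolding iff by simp
    finally show "\<gamma>P (g (f m)) = ts C M (tp k C P) (\<gamma>M m) (\<lambda>c x. c \<boxtimes>\<^bsub>tp k C P\<^esub> g (f x))"
      using m by (simp add: sweedler_simps)
  qed (simp add: sweedler_simps)
qed

text \<open>Linearity and colinearity of \<open>t\<close> may be tested on values of
  \<open>q\<close>, as \<open>q\<close> is onto. It serves to show that the inverse of a transport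
  of structure is again colinear.\<close>

lemma left_comodule_hom_factor:
  assumes M: "left_comodule k C M \<gamma>M" and N: "left_comodule k C N \<gamma>N" and P: "left_comodule k C P \<gamma>P"
    and q: "left_comodule_hom k C M \<gamma>M N \<gamma>N q" and surj: "carrier N = q ` carrier M"
    and s: "left_comodule_hom k C M \<gamma>M P \<gamma>P s" and t: "\<And>x. x \<in> carrier M \<Longrightarrow> t (q x) = s x"
  shows "left_comodule_hom k C N \<gamma>N P \<gamma>P t"
proof -
  note mods[simp] = left_comodule_module[OF M] left_comodule_module[OF N] left_comodule_module[OF P]
  note lins = left_comodule_lin[OF M] left_comodule_lin[OF N] left_comodule_lin[OF P]
  note iff = left_comodule_hom_iff[OF mods(1,2) lins(1)] left_comodule_hom_iff[OF mods(2,3) lins(2)]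
    left_comodule_hom_iff[OF mods(1,3) lins(1)]
  interpret M: module k M by simp
  have ql: "lin k M N q" and sl: "lin k M P s" using q s unfolding iff by auto
  have tl: "lin k N P t"
    unfolding lin_iff surj
    by (auto simp: t lin_closed[OF sl] lin_add[OF ql, symmetric] lin_smult[OF ql, symmetric] lin_add[OF sl]
      lin_smult[OF sl])
  note [simp] = ql tl lin_closed[OF tl] lin_closed[OF lins(1)] lin_closed[OF ql] lin_comp[OF ql] lin_comp[OF tl]
  show ?thesis
    unfolding iff
  proof (intro conjI ballI)
    fix n assume "n \<in> carrier N"
    then obtain m where m: "m \<in> carrier M" "n = q m" using surj by auto
    have "\<gamma>P (t n) = ts C M (tp k C P) (\<gamma>M m) (\<lambda>c x. c \<boxtimes>\<^bsub>tp k C P\<^esub> t (q x))"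
      using s m t unfolding iff by simp
    also have "\<dots> = ts C N (tp k C P) (ts C M (tp k C N) (\<gamma>M m) (\<lambda>c x. c \<boxtimes>\<^bsub>tp k C N\<^esub> q x))
      (\<lambda>c x. c \<boxtimes>\<^bsub>tp k C P\<^esub> t x)"
      using m by (simp add: sweedler_simps)
    also have "\<dots> = ts C N (tp k C P) (\<gamma>N n) (\<lambda>c x. c \<boxtimes>\<^bsub>tp k C P\<^esub> t x)"
      using q m unfolding iff by simp
    finally show "\<gamma>P (t n) = ts C N (tp k C P) (\<gamma>N n) (\<lambda>c x. c \<boxtimes>\<^bsub>tp k C P\<^esub> t x)" .
  qed (rule tl)
qed

text \<open>The coaction of \<open>q x\<close> is forced to be the image of \<gamma>(x) under C
  \<otimes> q, and \<open>compat\<close> says that this does not depend on x. Coassociativity and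
  the counit law then descend from \<open>M\<close>.\<close>

lemma left_comodule_quotient:
  assumes M: "left_comodule k C M \<gamma>" and N: "module k N" and q: "lin k M N q" and surj: "carrier N =
    q ` carrier M"
    and compat: "\<And>x y. \<lbrakk>x \<in> carrier M; y \<in> carrier M; q x = q y\<rbrakk> \<Longrightarrow>
      ts C M (tp k C N) (\<gamma> x) (\<lambda>c m. c \<boxtimes>\<^bsub>tp k C N\<^esub> q m) = ts C M (tp k C N) (\<gamma> y) (\<lambda>c m. c \<boxtimes>\<^bsub>tp k C N\<^esub> q m)"
  obtains \<gamma>N where "left_comodule k C N \<gamma>N" "left_comodule_hom k C M \<gamma> N \<gamma>N q"
proof
  note mods[simp] = left_comodule_module[OF M] N
  note g = left_comodule_lin[OF M]
  note [simp] = g q lin_closed[OF g] lin_comp[OF g] lin_closed[OF q] lin_comp[OF q]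
  interpret M: module k M by simp
  interpret N: module k N by simp
  define \<gamma>N where "\<gamma>N n = ts C M (tp k C N) (\<gamma> (inv_into (carrier M) q n)) (\<lambda>c m. c \<boxtimes>\<^bsub>tp k C N\<^esub> q m)" for n
  have gN: "\<gamma>N (q x) = ts C M (tp k C N) (\<gamma> x) (\<lambda>c m. c \<boxtimes>\<^bsub>tp k C N\<^esub> q m)" if "x \<in> carrier M" for x
    unfolding \<gamma>N_def by (rule compat) (use that in \<open>simp_all add: inv_into_into f_inv_into_f\<close>)
  have gN_lin: "lin k N (tp k C N) \<gamma>N"
  proof -
    have l: "lin k M (tp k C N) (\<lambda>x. \<gamma>N (q x))"
      using lin_cong[where f = "\<lambda>x. \<gamma>N (q x)" and M = M and k = k and N = "tp k C N", OF gN]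
      by (simp add: sweedler_simps)
    show ?thesis
      unfolding lin_iff surj
      by (auto simp: lin_closed[OF l] lin_add[OF q, symmetric] lin_smult[OF q, symmetric] lin_add[OF l]
        lin_smult[OF l])
  qed
  note [simp] = gN_lin lin_closed[OF gN_lin] lin_comp[OF gN_lin]
  show "left_comodule_hom k C M \<gamma> N \<gamma>N q"
    unfolding left_comodule_hom_iff[OF mods g] by (simp add: q gN)
  show "left_comodule k C N \<gamma>N"
    unfolding left_comodule_iff
  proof (intro conjI ballI gN_lin N)
    fix n assume "n \<in> carrier N"
    then obtain m where m: "m \<in> carrier M" "n = q m" using surj by auto
    let ?T = "tp k (tp k C C) N"
    have "ts C M ?T (\<gamma> m) (\<lambda>c n. ts C M ?T (\<gamma> n) (\<lambda>d n'. (c \<boxtimes>\<^bsub>tp k C C\<^esub> d) \<boxtimes>\<^bsub>?T\<^esub> q n')) =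
        ts C M ?T (\<gamma> m) (\<lambda>c n. ts C C ?T (\<Delta> c) (\<lambda>c1 c2. (c1 \<boxtimes>\<^bsub>tp k C C\<^esub> c2) \<boxtimes>\<^bsub>?T\<^esub> q n))"
      by (rule left_comodule_coassoc[OF M]) (use m in \<open>simp_all add: sweedler_simps\<close>)
    also have "\<dots> = ts C M ?T (\<gamma> m) (\<lambda>c n. \<Delta> c \<boxtimes>\<^bsub>?T\<^esub> q n)"
      using m by (simp add: sweedler_simps ts_pures_pureL)
    finally show "ts C N ?T (\<gamma>N n) (\<lambda>c n. ts C N ?T (\<gamma>N n) (\<lambda>d n'. (c \<boxtimes>\<^bsub>tp k C C\<^esub> d) \<boxtimes>\<^bsub>?T\<^esub> n')) =
         ts C N ?T (\<gamma>N n) (\<lambda>c n. \<Delta> c \<boxtimes>\<^bsub>?T\<^esub> n)"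
      using m by (simp add: gN sweedler_simps)
    have "ts C N N (\<gamma>N n) (\<lambda>c n. \<epsilon> c \<odot>\<^bsub>N\<^esub> n) = q (ts C M M (\<gamma> m) (\<lambda>c n. \<epsilon> c \<odot>\<^bsub>M\<^esub> n))"
      using m by (simp add: gN sweedler_simps lin_apply_ts[OF _ _ _ _ _ q] lin_smult[OF q])
    then show "ts C N N (\<gamma>N n) (\<lambda>c n. \<epsilon> c \<odot>\<^bsub>N\<^esub> n) = n"
      using m by (simp add: left_comodule_counit[OF M])
  qed
qed

text \<open>Projectivity is only assumed against comodules carried by the type \<open>'u\<close>; this transports it to
  comodules that embed into that type.\<close>

lemma projective_lift:
  assumes proj: "projective_left_comodule TYPE('u) k C C \<Delta>"
    and M: "left_comodule k C M \<gamma>M" and P: "left_comodule k C P \<gamma>P"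
    and \<theta>: "left_comodule_hom k C M \<gamma>M P \<gamma>P \<theta>" and \<phi>: "left_comodule_hom k C P \<gamma>P P \<gamma>P \<phi>"
    and idem: "\<And>y. y \<in> carrier P \<Longrightarrow> \<phi> (\<phi> y) = \<phi> y"
    and surj: "\<And>y. y \<in> carrier P \<Longrightarrow> \<exists>x\<in>carrier M. \<theta> x = \<phi> y"
    and f: "left_comodule_hom k C C \<Delta> P \<gamma>P f"
    and eM: "inj_on (eM :: _ \<Rightarrow> 'u) (carrier M)" and eP: "inj_on (eP :: _ \<Rightarrow> 'u) (carrier P)"
  obtains h where "left_comodule_hom k C C \<Delta> M \<gamma>M h" "\<And>c. c \<in> carrier C \<Longrightarrow> \<phi> (\<theta> (h c)) = \<phi> (f c)"
proof -
  note mods[simp] = left_comodule_module[OF M] left_comodule_module[OF P]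
  note gM = left_comodule_lin[OF M] and gP = left_comodule_lin[OF P]
  interpret M: module k M by simp
  interpret P: module k P by simp
  note iff = left_comodule_hom_iff[OF mods gM] left_comodule_hom_iff[OF mods(2,2) gP]
    left_comodule_hom_iff[OF C_module mods(2) Cd_lin]
  have \<theta>l: "lin k M P \<theta>" using \<theta> unfolding iff by (rule conjunct1)
  have \<phi>l: "lin k P P \<phi>" using \<phi> unfolding iff by (rule conjunct1)
  have fl: "lin k C P f" using f unfolding iff by (rule conjunct1)
  note [simp] = gP \<phi>l \<theta>l fl lin_closed[OF gP] lin_comp[OF gP] lin_closed[OF \<phi>l] lin_comp[OF \<phi>l]
    lin_closed[OF \<theta>l] lin_closed[OF fl]
  \<comment> \<open>A copy of the comodule \<open>M\<close> with elements in
    \<open>'u\<close>.\<close>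
  define M' where "M' = quot_module M eM"
  have M': "module k M'" "lin k M M' eM" "carrier M' = eM ` carrier M"
  proof -
    have 1: "eM (x \<oplus>\<^bsub>M\<^esub> y) = eM (x' \<oplus>\<^bsub>M\<^esub> y')"
      if "x \<in> carrier M" "x' \<in> carrier M" "y \<in> carrier M" "y' \<in> carrier M" "eM x = eM x'" "eM y =
        eM y'" for x x' y y'
      using inj_onD[OF eM that(5,1,2)] inj_onD[OF eM that(6,3,4)] by simp
    have 2: "eM (r \<odot>\<^bsub>M\<^esub> x) = eM (r \<odot>\<^bsub>M\<^esub> x')"
      if "r \<in> carrier k" "x \<in> carrier M" "x' \<in> carrier M" "eM x = eM x'" for r x x'
      using inj_onD[OF eM that(4,2,3)] by simp
    show "module k M'" "lin k M M' eM" "carrier M' = eM ` carrier M"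
      unfolding M'_def by (rule quot_module[OF mods(1) 1 2]; assumption)+
  qed
  obtain \<gamma>M' where gM': "left_comodule k C M' \<gamma>M'" "left_comodule_hom k C M \<gamma>M M' \<gamma>M' eM"
  proof (rule left_comodule_quotient[OF M M'])
    fix x y assume *: "x \<in> carrier M" "y \<in> carrier M" "eM x = eM y"
    show "ts C M (tp k C M') (\<gamma>M x) (\<lambda>c m. c \<boxtimes>\<^bsub>tp k C M'\<^esub> eM m) =
      ts C M (tp k C M') (\<gamma>M y) (\<lambda>c m. c \<boxtimes>\<^bsub>tp k C M'\<^esub> eM m)"
      unfolding inj_onD[OF eM *(3,1,2)] ..
  qed
  \<comment> \<open>As \<open>eP\<close> is injective, \<open>q\<close> identifies exactly what
    \<phi> identifies. Its values form a copy in \<open>'u\<close> of the image of \<phi>, presented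
    as a quotient of \<open>P\<close>; \<theta> followed by \<open>q\<close> is onto it.\<close>
  define q where "q y = eP (\<phi> y)" for y
  have qD: "\<phi> x = \<phi> y" if "q x = q y" "x \<in> carrier P" "y \<in> carrier P" for x y
    using that by (simp add: q_def inj_on_eq_iff[OF eP])
  define N where "N = quot_module P q"
  have N: "module k N" "lin k P N q" "carrier N = q ` carrier P"
  proof -
    have "q (x \<oplus>\<^bsub>P\<^esub> y) = q (x' \<oplus>\<^bsub>P\<^esub> y')"
      if "x \<in> carrier P" "x' \<in> carrier P" "y \<in> carrier P" "y' \<in> carrier P" "q x = q x'" "q y =
        q y'" for x x' y y'
      using that qD[of x x'] qD[of y y'] unfolding q_def by (simp add: lin_add[OF \<phi>l])
    note 1 = this
    have "q (r \<odot>\<^bsub>P\<^esub> x) = q (r \<odot>\<^bsub>P\<^esub> x')"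
      if "r \<in> carrier k" "x \<in> carrier P" "x' \<in> carrier P" "q x = q x'" for r x x'
      using that qD[of x x'] unfolding q_def by (simp add: lin_smult[OF \<phi>l])
    note 2 = this
    show "module k N" "lin k P N q" "carrier N = q ` carrier P"
      unfolding N_def by (rule quot_module[OF mods(2) 1 2]; assumption)+
  qed
  note [simp] = N(1,2) lin_closed[OF N(2)] lin_comp[OF N(2)]
  have q\<phi>: "q (\<phi> y) = q y" if "y \<in> carrier P" for y using that by (simp add: q_def idem)
  \<comment> \<open>\<phi> is colinear and \<open>q\<close> absorbs it, so the coaction pushed
    forward along \<open>q\<close> depends on \<phi>(x) only. This is the well-definedness that the
    quotient needs.\<close>
  have co: "ts C P (tp k C N) (\<gamma>P x) (\<lambda>c m. c \<boxtimes>\<^bsub>tp k C N\<^esub> q m) =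
    ts C P (tp k C N) (\<gamma>P (\<phi> x)) (\<lambda>c m. c \<boxtimes>\<^bsub>tp k C N\<^esub> q m)"
    if "x \<in> carrier P" for x
  proof -
    have "\<gamma>P (\<phi> x) = ts C P (tp k C P) (\<gamma>P x) (\<lambda>c m. c \<boxtimes>\<^bsub>tp k C P\<^esub> \<phi> m)"
      using \<phi> that unfolding iff by simp
    then show ?thesis using that by (simp add: sweedler_simps q\<phi>)
  qed
  obtain \<gamma>N where gN: "left_comodule k C N \<gamma>N" "left_comodule_hom k C P \<gamma>P N \<gamma>N q"
  proof (rule left_comodule_quotient[OF P N])
    fix x y assume *: "x \<in> carrier P" "y \<in> carrier P" "q x = q y"
    show "ts C P (tp k C N) (\<gamma>P x) (\<lambda>c m. c \<boxtimes>\<^bsub>tp k C N\<^esub> q m) =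
      ts C P (tp k C N) (\<gamma>P y) (\<lambda>c m. c \<boxtimes>\<^bsub>tp k C N\<^esub> q m)"
      using co[OF *(1)] co[OF *(2)] unfolding qD[OF *(3,1,2)] by (rule trans[OF _ sym])
  qed
  define r where "r = inv_into (carrier M) eM"
  have r: "r (eM x) = x" if "x \<in> carrier M" for x using that eM by (simp add: r_def)
  have rh: "left_comodule_hom k C M' \<gamma>M' M \<gamma>M r"
  proof (rule left_comodule_hom_factor[OF M gM'(1) M gM'(2) M'(3)])
    show "left_comodule_hom k C M \<gamma>M M \<gamma>M (\<lambda>x. x)"
      unfolding left_comodule_hom_iff[OF mods(1,1) gM] using lin_closed[OF gM] by (simp add: lin_ident ts_pures)
  qed (rule r)
  define t where "t z = q (\<theta> (r z))" for z
  have th: "left_comodule_hom k C M' \<gamma>M' N \<gamma>N t"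
    unfolding t_def
    by (rule left_comodule_hom_comp[OF gM'(1) M gN(1) rh left_comodule_hom_comp[OF M P gN(1) \<theta> gN(2)]])
  have ts: "\<exists>m\<in>carrier M'. t m = n" if n: "n \<in> carrier N" for n
  proof -
    obtain y where y: "y \<in> carrier P" "n = q y" using n N(3) by auto
    obtain x where "x \<in> carrier M" "\<theta> x = \<phi> y" using surj[OF y(1)] by auto
    then show ?thesis using y q\<phi>[of y] by (intro bexI[of _ "eM x"]) (auto simp: t_def r M'(3))
  qed
  \<comment> \<open>A surjective map can be cancelled on the right, whatever the test
    comodule.\<close>
  have "left_comodule_epi k C M' \<gamma>M' N \<gamma>N t"
    unfolding left_comodule_epi_def using th ts by metis
  moreover have fh: "left_comodule_hom k C C \<Delta> N \<gamma>N (\<lambda>c. q (f c))"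
    by (rule left_comodule_hom_comp[OF left_comodule_C P gN(1) f gN(2)])
  ultimately obtain h' where h': "left_comodule_hom k C C \<Delta> M' \<gamma>M' h'" "\<forall>c\<in>carrier C. t (h' c) = q (f c)"
    using proj gM'(1) gN(1) unfolding projective_left_comodule_def by blast
  have h: "left_comodule_hom k C C \<Delta> M \<gamma>M (\<lambda>c. r (h' c))"
    by (rule left_comodule_hom_comp[OF left_comodule_C gM'(1) M h'(1) rh])
  show ?thesis
  proof (rule that[OF h])
    fix c assume c: "c \<in> carrier C"
    have "r (h' c) \<in> carrier M"
      using h c unfolding left_comodule_hom_iff[OF C_module mods(1) Cd_lin] by (auto dest: lin_closed)
    then show "\<phi> (\<theta> (r (h' c))) = \<phi> (f c)"
      using h'(2) c by (intro qD) (auto simp: t_def)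
  qed
qed

end

text \<open>A list is read two letters at a time, with \<open>p\<close> decoding the first factor
  and \<open>q\<close> the second, so that one letter type serves for several pairs of modules. The
  empty list and a single leftover letter denote zero, which makes the function total.\<close>

fun tensor_list :: "(('m, 'n) tens, 'x) ring_scheme \<Rightarrow> ('v \<Rightarrow> 'm) \<Rightarrow> ('v \<Rightarrow> 'n) \<Rightarrow> 'v list \<Rightarrow> ('m, 'n) tens"
  where "tensor_list T p q (x # y # xs) = p x \<boxtimes>\<^bsub>T\<^esub> q y \<oplus>\<^bsub>T\<^esub> tensor_list T p q xs"
  | "tensor_list T p q _ = \<zero>\<^bsub>T\<^esub>"

text \<open>Every tensor is a finite sum of pure ones, so it is determined by the set of all its
  representations as such a sum, written as lists.\<close>

lemma inj_on_tensor_list: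
  fixes p :: "'v \<Rightarrow> 'm" and q :: "'v \<Rightarrow> 'n"
  assumes M: "module k M" and N: "module k N"
    and p: "surj p" and q: "surj q"
  shows "inj_on (\<lambda>X. {xs. tensor_list (tp k M N) p q xs = X}) (carrier (tp k M N))"
proof -
  interpret T: module k "tp k M N" by (rule tp_module[OF M N])
  let ?d = "tensor_list (tp k M N) p q"
  define pair_sum where "pair_sum = (\<lambda>ps. foldr (\<lambda>(m, n) Y. m \<boxtimes>\<^bsub>tp k M N\<^esub> n \<oplus>\<^bsub>tp k M N\<^esub> Y) ps \<zero>\<^bsub>tp k M N\<^esub>)"
  have pair_sum[simp]: "pair_sum [] = \<zero>\<^bsub>tp k M N\<^esub>" "pair_sum ((m, n) # ps) =
    m \<boxtimes>\<^bsub>tp k M N\<^esub> n \<oplus>\<^bsub>tp k M N\<^esub> pair_sum ps" for m n ps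
    by (simp_all add: pair_sum_def)
  have pair_sum_closed: "pair_sum ps \<in> carrier (tp k M N)" if "set ps \<subseteq> carrier M \<times> carrier N" for ps
    using that by (induction ps) (auto simp: tp_pure_closed[OF M N])
  have pair_sum_append: "pair_sum (ps @ qs) = pair_sum ps \<oplus>\<^bsub>tp k M N\<^esub> pair_sum qs"
    if "set ps \<subseteq> carrier M \<times> carrier N" "set qs \<subseteq> carrier M \<times> carrier N" for ps qs
    using that by (induction ps) (auto simp: tp_pure_closed[OF M N] pair_sum_closed T.a_assoc)
  \<comment> \<open>Right inverses of \<open>p\<close> and \<open>q\<close> choose letters for the
    factors, and every pair turns into two consecutive letters.\<close>
  have pair_sum_list: "pair_sum ps = ?d (concat (map (\<lambda>(m, n). [inv_into UNIV p m, inv_into UNIV q n]) ps))"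
    for ps
    by (induction ps) (auto simp: surj_f_inv_f p q)
  have "\<exists>xs. X = ?d xs" if X: "X \<in> carrier (tp k M N)" for X
  proof -
    have "\<exists>ps. set ps \<subseteq> carrier M \<times> carrier N \<and> X = pair_sum ps"
      using X
    proof (induction rule: tp_induct[OF M N, consumes 1, case_names pure add])
      case (pure m n)
      then show ?case by (intro exI[of _ "[(m, n)]"]) (simp add: tp_pure_closed[OF M N])
    next
      case (add X Y)
      from add.IH obtain ps qs where *: "set ps \<subseteq> carrier M \<times> carrier N" "X = pair_sum ps"
        "set qs \<subseteq> carrier M \<times> carrier N" "Y = pair_sum qs" by (elim exE conjE)
      then show ?case by (intro exI[of _ "ps @ qs"] conjI) (simp_all add: pair_sum_append)
    qed
    then obtain ps where "X = pair_sum ps" by (elim exE conjE)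
    then have "X = ?d (concat (map (\<lambda>(m, n). [inv_into UNIV p m, inv_into UNIV q n]) ps))" unfolding
      pair_sum_list .
    then show ?thesis ..
  qed
  note ex = this
  show ?thesis
  proof (rule inj_onI)
    fix X Y assume X: "X \<in> carrier (tp k M N)" and eq: "{xs. ?d xs = X} = {xs. ?d xs = Y}"
    obtain xs where xs: "X = ?d xs" using ex[OF X] ..
    then have "xs \<in> {xs. ?d xs = Y}" unfolding eq[symmetric] by simp
    with xs show "X = Y" by simp
  qed
qed

section \<open>The canonical map and its section\<close>

context galois_setup
begin

text \<open>\<open>ts\<close> sees only the class and the carriers of the two factors, so the same
  definition also serves on A \<otimes>_B A once the summand is known to be balanced.\<close>

definition "can X = ts A A AC X (\<lambda>a b. lact a (\<rho> b))"

lemma can_lin: "lin k AT AC can"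
  unfolding can_def by (simp add: sweedler_simps)

lemmas can_closed[simp] = lin_closed[OF can_lin]
lemmas can_comp[simp] = can_lin lin_comp[OF can_lin]
lemmas can_ts[simp] = lin_apply_ts[OF _ _ tp_module[OF A_module A_module] tp_module[OF A_module C_module] _
  can_lin]

lemma can_pure: "\<lbrakk>x \<in> carrier A; y \<in> carrier A\<rbrakk> \<Longrightarrow> can (x \<boxtimes>\<^bsub>AT\<^esub> y) = lact x (\<rho> y)"
  unfolding can_def by (simp add: sweedler_simps)

lemma tsum_AC: "X \<in> carrier AC \<Longrightarrow> tsum G X f = ts A C G X f"
  by (rule tsum_ts) (simp_all add: tp_def)
lemma tsum_AT: "X \<in> carrier AT \<Longrightarrow> tsum G X f = ts A A G X f"
  by (rule tsum_ts) (simp_all add: tp_def)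

lemma left_mult_eq: "X \<in> carrier AC \<Longrightarrow> left_mult A AC a X = lact a X"
  by (simp add: left_mult_def lact_def tsum_AC)

lemma canonical_map_eq: "X \<in> carrier AT \<Longrightarrow> canonical_map k A C \<rho> X = can X"
  unfolding canonical_map_def tp_def[symmetric] can_def by (simp add: tsum_AT left_mult_eq)

lemma pR_can: "X \<in> carrier AT \<Longrightarrow> pR (can X) = can X"
  by (rule tp_ext[OF A_module A_module _ , where G = AC]) (simp_all add: sweedler_simps can_pure pR_lact pR_rho)

definition "theta X = \<psi>L (can X)"

lemma theta_lin: "lin k AT CA theta"
  unfolding theta_def by simp

lemmas theta_closed[simp] = lin_closed[OF theta_lin]
lemmas theta_comp[simp] = theta_lin lin_comp[OF theta_lin]

lemma theta_pure: "\<lbrakk>x \<in> carrier A; y \<in> carrier A\<rbrakk> \<Longrightarrow> theta (x \<boxtimes>\<^bsub>AT\<^esub> y) = rmul (lcoact x) y"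
  by (simp add: theta_def can_pure L_lact_rho)

lemma left_comodule_lcoact: "left_comodule k C A lcoact"
  unfolding left_comodule_iff
proof (intro conjI ballI)
  fix a assume a: "a \<in> carrier A"
  let ?T = "tp k CC A"
  show "ts C A ?T (lcoact a) (\<lambda>c n. ts C A ?T (lcoact n) (\<lambda>d n'. (c \<boxtimes>\<^bsub>CC\<^esub> d) \<boxtimes>\<^bsub>?T\<^esub> n')) =
    ts C A ?T (lcoact a) (\<lambda>c n. \<Delta> c \<boxtimes>\<^bsub>?T\<^esub> n)"
    using a by (subst lcoact_coassoc) (simp_all add: sweedler_simps ts_pures_pureL)
qed (simp_all add: lcoact_lin lcoact_counit)

section \<open>Left colinearity of \<theta> and of \<open>pL\<close>\<close>

abbreviation "gA \<equiv> coact_tensor A A lcoact"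
abbreviation "gC \<equiv> coact_tensor C A \<Delta>"

lemma gA_comodule: "left_comodule k C AT gA"
  by (rule left_comodule_tensor[OF left_comodule_lcoact A_module])
lemma gC_comodule: "left_comodule k C CA gC"
  by (rule left_comodule_tensor[OF left_comodule_C A_module])

lemmas gA_lin = left_comodule_lin[OF gA_comodule]
lemmas gC_lin = left_comodule_lin[OF gC_comodule]
lemmas g_simps[simp] = gA_lin gC_lin lin_closed[OF gA_lin] lin_closed[OF gC_lin] lin_comp[OF gA_lin]
  lin_comp[OF gC_lin]

lemma gA_pure: "\<lbrakk>x \<in> carrier A; y \<in> carrier A\<rbrakk> \<Longrightarrow>
   gA (x \<boxtimes>\<^bsub>AT\<^esub> y) = ts C A (tp k C AT) (lcoact x) (\<lambda>c n. c \<boxtimes>\<^bsub>tp k C AT\<^esub> (n \<boxtimes>\<^bsub>AT\<^esub> y))"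
  by (simp add: coact_tensor_def sweedler_simps)
lemma gC_pure: "\<lbrakk>x \<in> carrier C; y \<in> carrier A\<rbrakk> \<Longrightarrow>
   gC (x \<boxtimes>\<^bsub>CA\<^esub> y) = ts C C (tp k C CA) (\<Delta> x) (\<lambda>c n. c \<boxtimes>\<^bsub>tp k C CA\<^esub> (n \<boxtimes>\<^bsub>CA\<^esub> y))"
  by (simp add: coact_tensor_def sweedler_simps)
lemmas gC_ts = lin_apply_ts[OF _ _ tp_module[OF C_module A_module] tp_module[OF C_module tp_module[OF
  C_module A_module]] _ gC_lin]

text \<open>The coaction of A \<otimes> A lives on the first factor and \<open>theta\<close> sends x
  \<otimes> y to \<open>lcoact x\<close> times y, so the claim is coassociativity of
  \<open>lcoact\<close> with y carried along.\<close>

lemma theta_hom: "left_comodule_hom k C AT gA CA gC theta"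
  unfolding left_comodule_hom_iff[OF tp_module[OF A_module A_module] tp_module[OF C_module A_module] gA_lin]
proof (intro conjI ballI)
  fix X assume X: "X \<in> carrier AT"
  show "gC (theta X) = ts C AT (tp k C CA) (gA X) (\<lambda>c x. c \<boxtimes>\<^bsub>tp k C CA\<^esub> theta x)"
  proof (rule tp_ext[OF A_module A_module X, where G = "tp k C CA"])
    fix x y assume xy: "x \<in> carrier A" "y \<in> carrier A"
    have "gC (theta (x \<boxtimes>\<^bsub>AT\<^esub> y)) = ts C A (tp k C CA) (lcoact x) (\<lambda>c n. ts C C (tp k C CA) (\<Delta> c)
      (\<lambda>c1 c2. c1 \<boxtimes>\<^bsub>tp k C CA\<^esub> (c2 \<boxtimes>\<^bsub>CA\<^esub> (n ** y))))"
      using xy by (simp add: theta_pure rmul_def gC_ts sweedler_simps gC_pure)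
    also have "\<dots> = ts C A (tp k C CA) (lcoact x) (\<lambda>c n. ts C A (tp k C CA) (lcoact n)
      (\<lambda>d n'. c \<boxtimes>\<^bsub>tp k C CA\<^esub> (d \<boxtimes>\<^bsub>CA\<^esub> (n' ** y))))"
      by (rule lcoact_coassoc[symmetric]) (use xy in \<open>simp_all add: sweedler_simps\<close>)
    also have "\<dots> = ts C AT (tp k C CA) (gA (x \<boxtimes>\<^bsub>AT\<^esub> y)) (\<lambda>c x. c \<boxtimes>\<^bsub>tp k C CA\<^esub> theta x)"
      using xy by (simp add: gA_pure sweedler_simps theta_pure) (simp add: rmul_def sweedler_simps)
    finally show "gC (theta (x \<boxtimes>\<^bsub>AT\<^esub> y)) =
      ts C AT (tp k C CA) (gA (x \<boxtimes>\<^bsub>AT\<^esub> y)) (\<lambda>c x. c \<boxtimes>\<^bsub>tp k C CA\<^esub> theta x)" .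
  qed (simp_all add: sweedler_simps)
qed simp

text \<open>The linear map \<open>c \<mapsto> \<Sum> \<epsilon>(c\<^sub>E) 1\<^sup>E\<close>, through which both projections factor.\<close>

definition "eps c = ts C A A (\<psi>L (u \<boxtimes>\<^bsub>AC\<^esub> c)) (\<lambda>c' e. \<epsilon> c' \<odot>\<^bsub>A\<^esub> e)"

lemma eps_lin: "lin k C A eps"
  unfolding eps_def by (simp add: sweedler_simps)

lemmas eps_simps[simp] = eps_lin lin_closed[OF eps_lin] lin_comp[OF eps_lin]

lemma L_one_eps: "c \<in> carrier C \<Longrightarrow> \<psi>L (u \<boxtimes>\<^bsub>AC\<^esub> c) = ts C C CA (\<Delta> c) (\<lambda>c1 c2. c1 \<boxtimes>\<^bsub>CA\<^esub> eps c2)"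
  by (subst L_one) (simp_all add: eps_def sweedler_simps)

text \<open>The axiom involves the counit of \<psi>R(c \<otimes> 1), which \<open>counit_psi\<close>
  identifies with the counit of \<psi>L(1 \<otimes> c). Hence the same \<open>eps\<close> appears
  for both projections.\<close>

lemma R_one_eps: "c \<in> carrier C \<Longrightarrow> \<psi>R (c \<boxtimes>\<^bsub>CA\<^esub> u) = ts C C AC (\<Delta> c) (\<lambda>c1 c2. eps c1 \<boxtimes>\<^bsub>AC\<^esub> c2)"
  by (subst R_one) (simp_all add: eps_def counit_psi sweedler_simps)

lemma pL_pure: "\<lbrakk>c \<in> carrier C; a \<in> carrier A\<rbrakk> \<Longrightarrow> pL (c \<boxtimes>\<^bsub>CA\<^esub> a) =
  ts C C CA (\<Delta> c) (\<lambda>c1 c2. c1 \<boxtimes>\<^bsub>CA\<^esub> (eps c2 ** a))"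
  by (simp add: pL_def L_one_eps sweedler_simps)

lemma pR_pure: "\<lbrakk>c \<in> carrier C; a \<in> carrier A\<rbrakk> \<Longrightarrow> pR (a \<boxtimes>\<^bsub>AC\<^esub> c) =
  ts C C AC (\<Delta> c) (\<lambda>c1 c2. (a ** eps c1) \<boxtimes>\<^bsub>AC\<^esub> c2)"
  by (simp add: pR_def R_one_eps sweedler_simps)

text \<open>By \<open>pL_pure\<close> only the right leg of the comultiplication is altered, while
  \<open>gC\<close> splits off the left leg; so colinearity is coassociativity of C.\<close>

lemma pL_hom: "left_comodule_hom k C CA gC CA gC pL"
  unfolding left_comodule_hom_iff[OF tp_module[OF C_module A_module] tp_module[OF C_module A_module] gC_lin]
proof (intro conjI ballI pL_lin)
  fix X assume X: "X \<in> carrier CA"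
  show "gC (pL X) = ts C CA (tp k C CA) (gC X) (\<lambda>c x. c \<boxtimes>\<^bsub>tp k C CA\<^esub> pL x)"
  proof (rule tp_ext[OF C_module A_module X, where G = "tp k C CA"])
    fix c y assume cy: "c \<in> carrier C" "y \<in> carrier A"
    have "gC (pL (c \<boxtimes>\<^bsub>CA\<^esub> y)) =
      ts C C (tp k C CA) (\<Delta> c) (\<lambda>c1 c2. ts C C (tp k C CA) (\<Delta> c1) (\<lambda>d e. d \<boxtimes>\<^bsub>tp k C CA\<^esub> (e \<boxtimes>\<^bsub>CA\<^esub> (eps c2 **
        y))))"
      using cy by (simp add: pL_pure gC_ts sweedler_simps gC_pure)
    also have "\<dots> =
      ts C C (tp k C CA) (\<Delta> c) (\<lambda>c1 c2. ts C C (tp k C CA) (\<Delta> c2) (\<lambda>d e. c1 \<boxtimes>\<^bsub>tp k C CA\<^esub> (d \<boxtimes>\<^bsub>CA\<^esub> (eps e **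
        y))))"
      by (rule coassoc) (use cy in \<open>simp_all add: sweedler_simps\<close>)
    also have "\<dots> = ts C CA (tp k C CA) (gC (c \<boxtimes>\<^bsub>CA\<^esub> y)) (\<lambda>c x. c \<boxtimes>\<^bsub>tp k C CA\<^esub> pL x)"
      using cy by (simp add: gC_pure sweedler_simps pL_pure)
    finally show "gC (pL (c \<boxtimes>\<^bsub>CA\<^esub> y)) = ts C CA (tp k C CA) (gC (c \<boxtimes>\<^bsub>CA\<^esub> y)) (\<lambda>c x. c \<boxtimes>\<^bsub>tp k C CA\<^esub> pL x)" .
  qed (simp_all add: sweedler_simps)
qed

lemma pL_pL: "Y \<in> carrier CA \<Longrightarrow> pL (pL Y) = pL Y"
  by (simp add: L_R[symmetric] R_L pR_R)

text \<open>The lift of c \<mapsto> c \<otimes> 1 along \<open>theta\<close> is correct only after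
  \<open>pL\<close>. Applying \<psi>R removes this defect: \<psi>R absorbs \<open>pL\<close> and
  sends \<open>theta X\<close> back to \<open>can X\<close>.\<close>

lemma exists_lift:
  assumes proj: "projective_left_comodule TYPE('u) k C C \<Delta>"
    and surj: "canonical_map k A C \<rho> ` carrier AT = carrier (coring k A C \<psi>R)"
    and e1: "inj_on (e1 :: _ \<Rightarrow> 'u) (carrier AT)" and e2: "inj_on (e2 :: _ \<Rightarrow> 'u) (carrier CA)"
  obtains h where "lin k C AT h" "\<And>c. c \<in> carrier C \<Longrightarrow> can (h c) = \<psi>R (c \<boxtimes>\<^bsub>CA\<^esub> u)"
    "\<And>c. c \<in> carrier C \<Longrightarrow> gA (h c) = ts C C (tp k C AT) (\<Delta> c) (\<lambda>c x. c \<boxtimes>\<^bsub>tp k C AT\<^esub> h x)"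
proof -
  \<comment> \<open>\<psi>R(Y) lies in the coring and so has a preimage under \<open>can\<close>;
    \<psi>L turns this into a preimage of \<open>pL Y\<close> under \<open>theta\<close>.\<close>
  have c\<theta>: "\<exists>X\<in>carrier AT. theta X = pL Y" if Y: "Y \<in> carrier CA" for Y
  proof -
    have "proj_right k A C \<psi>R (\<psi>R Y) \<in> carrier (coring k A C \<psi>R)"
      unfolding coring_def tp_def[symmetric] using Y by simp
    then obtain X where "X \<in> carrier AT" "canonical_map k A C \<rho> X = proj_right k A C \<psi>R (\<psi>R Y)"
      unfolding surj[symmetric] by auto
    with Y show ?thesis
      by (intro bexI[of _ X]) (simp_all add: theta_def canonical_map_eq proj_right_eq pR_R L_R)
  qed
  have f: "left_comodule_hom k C C \<Delta> CA gC (\<lambda>c. c \<boxtimes>\<^bsub>CA\<^esub> u)"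
    unfolding left_comodule_hom_iff[OF C_module tp_module[OF C_module A_module] Cd_lin]
    by (simp add: sweedler_simps gC_pure)
  obtain h where h: "left_comodule_hom k C C \<Delta> AT gA h" "\<And>c. c \<in> carrier C \<Longrightarrow> pL (theta (h c)) = pL (c \<boxtimes>\<^bsub>CA\<^esub> u)"
    by (rule projective_lift[OF proj gA_comodule gC_comodule theta_hom pL_hom pL_pL c\<theta> f e1 e2]) simp_all
  have hl: "lin k C AT h" and hc: "\<And>c. c \<in> carrier C \<Longrightarrow> gA (h c) =
    ts C C (tp k C AT) (\<Delta> c) (\<lambda>c x. c \<boxtimes>\<^bsub>tp k C AT\<^esub> h x)"
    using h(1) unfolding left_comodule_hom_iff[OF C_module tp_module[OF A_module A_module] Cd_lin] by simp_all
  note [simp] = lin_closed[OF hl]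
  show ?thesis
  proof (rule that[OF hl _ hc])
    fix c assume c: "c \<in> carrier C"
    have "can (h c) = \<psi>R (theta (h c))" using c by (simp add: theta_def R_L pR_can)
    also have "\<dots> = \<psi>R (pL (theta (h c)))" using c by (simp add: L_R[symmetric] R_L pR_R)
    also have "\<dots> = \<psi>R (c \<boxtimes>\<^bsub>CA\<^esub> u)" unfolding h(2)[OF c] using c
      by (simp add: L_R[symmetric] R_L pR_R sweedler_simps)
    finally show "can (h c) = \<psi>R (c \<boxtimes>\<^bsub>CA\<^esub> u)" .
  qed
qed

end

section \<open>The left linear section given by a lift\<close>

locale galois_split = galois_setup +
  fixes h
  assumes h_lin: "lin k C AT h"
    and can_h: "\<And>c. c \<in> carrier C \<Longrightarrow> can (h c) = \<psi>R (c \<boxtimes>\<^bsub>CA\<^esub> u)"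
    and gA_h: "\<And>c. c \<in> carrier C \<Longrightarrow> gA (h c) = ts C C (tp k C AT) (\<Delta> c) (\<lambda>c x. c \<boxtimes>\<^bsub>tp k C AT\<^esub> h x)"
begin

lemmas h_simps[simp] = h_lin lin_closed[OF h_lin] lin_comp[OF h_lin]

text \<open>This is \<open>gA_h\<close> tested against trilinear maps: a left coaction on the first
  factor of \<open>h c\<close> is traded for a comultiplication of c.\<close>

lemma h_colinear:
  assumes c: "c \<in> carrier C" and G: "module k G" and F: "trilin k C A A G F"
  shows "ts A A G (h c) (\<lambda>x y. ts C A G (lcoact x) (\<lambda>d z. F d z y)) =
    ts C C G (\<Delta> c) (\<lambda>c1 c2. ts A A G (h c2) (\<lambda>x y. F c1 x y))"
proof -
  have "ts A A G (h c) (\<lambda>x y. ts C A G (lcoact x) (\<lambda>d z. F d z y)) =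
    ts C AT G (gA (h c)) (\<lambda>d Z. ts A A G Z (F d))"
    using c G F by (simp add: coact_tensor_def sweedler_simps)
  also have "\<dots> = ts C C G (\<Delta> c) (\<lambda>c1 c2. ts A A G (h c2) (\<lambda>x y. F c1 x y))"
    unfolding gA_h[OF c] using c G F by (simp add: sweedler_simps)
  finally show ?thesis .
qed

definition "can_section X = ts A C AT X (\<lambda>a c. ts A A AT (h c) (\<lambda>x y. (a ** x) \<boxtimes>\<^bsub>AT\<^esub> y))"

lemma can_section_lin: "lin k AC AT can_section"
  unfolding can_section_def by (simp add: sweedler_simps)

lemmas can_section_simps[simp] = can_section_lin lin_closed[OF can_section_lin] lin_comp[OF can_section_lin]

text \<open>Left linearity of \<open>can\<close> reduces this to \<open>can_h\<close>. The composite
  is \<open>pR\<close> rather than the identity because \<psi>R(c \<otimes> 1) need not be 1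
  \<otimes> c.\<close>

lemma can_can_section:
  assumes X: "X \<in> carrier AC" shows "can (can_section X) = pR X"
proof (rule tp_ext[OF A_module C_module X, where G = AC])
  fix a c assume ac: "a \<in> carrier A" "c \<in> carrier C"
  have "can (can_section (a \<boxtimes>\<^bsub>AC\<^esub> c)) = ts A A AC (h c) (\<lambda>x y. lact a (lact x (\<rho> y)))"
    using ac by (simp add: can_section_def sweedler_simps can_pure lact_lact)
  also have "\<dots> = lact a (can (h c))"
    unfolding can_def by (rule lin_apply_ts[symmetric, OF _ _ _ _ _ lact_lin1]) (use ac in \<open>simp_all add:
      sweedler_simps\<close>)
  also have "\<dots> = pR (a \<boxtimes>\<^bsub>AC\<^esub> c)"
    using ac by (simp add: can_h pR_def sweedler_simps lact_def)
  finally show "can (can_section (a \<boxtimes>\<^bsub>AC\<^esub> c)) = pR (a \<boxtimes>\<^bsub>AC\<^esub> c)" .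
qed (simp_all add: sweedler_simps)

text \<open>The element is the sum of a_0 h(a_1). Multiplicativity of \<psi>L expresses
  \<open>lcoact\<close> of a_0 x through \<open>lcoact x\<close>; colinearity of \<open>h\<close>
  turns the latter into a comultiplication of a_1, and coassociativity of \<rho> moves this to
  \<rho>(a_0). What remains is \<psi>L(\<rho>(a_0)) x, which is \<psi>L(\<rho>(a_0 x)).\<close>

lemma can_section_rho_coinvariant:
  assumes a: "a \<in> carrier A"
  shows "ts A A (tp k CA A) (can_section (\<rho> a)) (\<lambda>x y. lcoact x \<boxtimes>\<^bsub>tp k CA A\<^esub> y) =
    ts A A (tp k CA A) (can_section (\<rho> a)) (\<lambda>x y. \<psi>L (\<rho> x) \<boxtimes>\<^bsub>tp k CA A\<^esub> y)"
proof -
  let ?T = "tp k CA A"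
  have lcoact_mult: "lcoact (a0 ** x) =
    ts C A CA (lcoact x) (\<lambda>c' b'. ts C A CA (\<psi>L (a0 \<boxtimes>\<^bsub>AC\<^esub> c')) (\<lambda>c'' a'. c'' \<boxtimes>\<^bsub>CA\<^esub> (a' ** b')))"
    if "a0 \<in> carrier A" "x \<in> carrier A" for a0 x
    using that by (simp add: lcoact_def lact_lact L_lact)
  have "ts A A ?T (can_section (\<rho> a)) (\<lambda>x y. lcoact x \<boxtimes>\<^bsub>?T\<^esub> y) =
    ts A C ?T (\<rho> a) (\<lambda>a0 a1. ts A A ?T (h a1) (\<lambda>x y. ts C A ?T (lcoact x) (\<lambda>c' b'. ts C A ?T (\<psi>L (a0 \<boxtimes>\<^bsub>AC\<^esub> c'))
      (\<lambda>c'' a'. (c'' \<boxtimes>\<^bsub>CA\<^esub> (a' ** b')) \<boxtimes>\<^bsub>?T\<^esub> y))))"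
    using a by (simp add: can_section_def sweedler_simps lcoact_mult)
  also have "\<dots> = ts A C ?T (\<rho> a) (\<lambda>a0 a1. ts C C ?T (\<Delta> a1) (\<lambda>c1 c2. ts A A ?T (h c2) (\<lambda>x y.
    ts C A ?T (\<psi>L (a0 \<boxtimes>\<^bsub>AC\<^esub> c1))
      (\<lambda>c'' a'. (c'' \<boxtimes>\<^bsub>CA\<^esub> (a' ** x)) \<boxtimes>\<^bsub>?T\<^esub> y))))"
    by (intro ts_cong refl h_colinear) (simp_all add: sweedler_simps)
  also have "\<dots> = ts A C ?T (\<rho> a) (\<lambda>a0 a1. ts A C ?T (\<rho> a0) (\<lambda>z d. ts A A ?T (h a1) (\<lambda>x y.
    ts C A ?T (\<psi>L (z \<boxtimes>\<^bsub>AC\<^esub> d))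
      (\<lambda>c'' a'. (c'' \<boxtimes>\<^bsub>CA\<^esub> (a' ** x)) \<boxtimes>\<^bsub>?T\<^esub> y))))"
    by (rule rho_coassoc[symmetric]) (use a in \<open>simp_all add: sweedler_simps\<close>)
  also have "\<dots> = ts A C ?T (\<rho> a) (\<lambda>a0 a1. ts A A ?T (h a1) (\<lambda>x y. ts A C ?T (\<rho> a0) (\<lambda>z d.
    ts C A ?T (\<psi>L (z \<boxtimes>\<^bsub>AC\<^esub> d))
      (\<lambda>c'' a'. (c'' \<boxtimes>\<^bsub>CA\<^esub> (a' ** x)) \<boxtimes>\<^bsub>?T\<^esub> y))))"
    by (intro ts_cong refl ts_swap[where k = k]) (use a in \<open>simp_all add: sweedler_simps\<close>)
  also have "\<dots> = ts A C ?T (\<rho> a) (\<lambda>a0 a1. ts A A ?T (h a1) (\<lambda>x y. rmul (\<psi>L (\<rho> a0)) x \<boxtimes>\<^bsub>?T\<^esub> y))"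
  proof (intro ts_cong refl)
    fix a0 a1 x y assume *: "a0 \<in> carrier A" "a1 \<in> carrier C" "x \<in> carrier A" "y \<in> carrier A"
    have "rmul (\<psi>L (\<rho> a0)) x \<boxtimes>\<^bsub>?T\<^esub> y = rmul (\<psi>L (ts A C AC (\<rho> a0) (\<lambda>z d. z \<boxtimes>\<^bsub>AC\<^esub> d))) x \<boxtimes>\<^bsub>?T\<^esub> y"
      using * by (simp add: ts_pures)
    then show "ts A C ?T (\<rho> a0) (\<lambda>z d. ts C A ?T (\<psi>L (z \<boxtimes>\<^bsub>AC\<^esub> d)) (\<lambda>c'' a'. (c'' \<boxtimes>\<^bsub>CA\<^esub> (a' ** x)) \<boxtimes>\<^bsub>?T\<^esub> y)) =
      rmul (\<psi>L (\<rho> a0)) x \<boxtimes>\<^bsub>?T\<^esub> y"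
      using * by (simp add: rmul_def sweedler_simps)
  qed
  also have "\<dots> = ts A A ?T (can_section (\<rho> a)) (\<lambda>x y. \<psi>L (\<rho> x) \<boxtimes>\<^bsub>?T\<^esub> y)"
    using a by (simp add: can_section_def sweedler_simps rho_ract L_ract pR_rho)
  finally show ?thesis .
qed

text \<open>Following \<open>can\<close> by A \<otimes> \<epsilon> gives the multiplication of A,
  and \<open>can\<close> takes the element in question to \<open>pR\<close> of \<rho>(a), that is,
  to \<rho>(a).\<close>

lemma mult_can_section_rho:
  assumes a: "a \<in> carrier A"
  shows "ts A A A (can_section (\<rho> a)) (\<lambda>x y. x ** y) = a"
proof -
  have *: "ts A C A (can X) (\<lambda>x c. \<epsilon> c \<odot>\<^bsub>A\<^esub> x) = ts A A A X (\<lambda>x y. x ** y)" if X: "X \<in> carrier AT" for X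
  proof (rule tp_ext[OF A_module A_module X, where G = A])
    fix x y assume xy: "x \<in> carrier A" "y \<in> carrier A"
    have "ts A C A (can (x \<boxtimes>\<^bsub>AT\<^esub> y)) (\<lambda>x c. \<epsilon> c \<odot>\<^bsub>A\<^esub> x) = x ** ts A C A (\<rho> y) (\<lambda>y0 y1. \<epsilon> y1 \<odot>\<^bsub>A\<^esub> y0)"
      using xy by (simp add: can_pure lact_def sweedler_simps smul_mul)
    then show "ts A C A (can (x \<boxtimes>\<^bsub>AT\<^esub> y)) (\<lambda>x c. \<epsilon> c \<odot>\<^bsub>A\<^esub> x) = ts A A A (x \<boxtimes>\<^bsub>AT\<^esub> y) (\<lambda>x y. x ** y)"
      using xy by (simp add: rho_counit sweedler_simps)
  qed (simp_all add: sweedler_simps)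
  have "ts A A A (can_section (\<rho> a)) (\<lambda>x y. x ** y) = ts A C A (can (can_section (\<rho> a))) (\<lambda>x c. \<epsilon> c \<odot>\<^bsub>A\<^esub> x)"
    using a by (simp add: *)
  then show ?thesis using a by (simp add: can_can_section pR_rho rho_counit)
qed

end

section \<open>Coinvariants and relative projectivity\<close>

lemma module_carrier_update:
  assumes M: "module k M" and sub: "H \<subseteq> carrier M" and ne: "\<zero>\<^bsub>M\<^esub> \<in> H"
    and add: "\<And>x y. \<lbrakk>x \<in> H; y \<in> H\<rbrakk> \<Longrightarrow> x \<oplus>\<^bsub>M\<^esub> y \<in> H"
    and smult: "\<And>r x. \<lbrakk>r \<in> carrier k; x \<in> H\<rbrakk> \<Longrightarrow> r \<odot>\<^bsub>M\<^esub> x \<in> H"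
  shows "module k (M\<lparr>carrier := H\<rparr>)"
proof -
  interpret M: module k M by fact
  have cl: "x \<in> carrier M" if "x \<in> H" for x using that sub by auto
  have neg: "\<exists>y\<in>H. x \<oplus>\<^bsub>M\<^esub> y = \<zero>\<^bsub>M\<^esub>" if x: "x \<in> H" for x
  proof -
    \<comment> \<open>Closure under negatives comes from the scalar -1.\<close>
    have "\<ominus>\<^bsub>M\<^esub> x = (\<ominus>\<^bsub>k\<^esub> \<one>\<^bsub>k\<^esub>) \<odot>\<^bsub>M\<^esub> x" using cl[OF x] by (simp add: M.smult_l_minus)
    then have "\<ominus>\<^bsub>M\<^esub> x \<in> H" using smult[of "\<ominus>\<^bsub>k\<^esub> \<one>\<^bsub>k\<^esub>" x] x by simp
    then show ?thesis using cl[OF x] by (intro bexI[of _ "\<ominus>\<^bsub>M\<^esub> x"]) (simp_all add: M.M.r_neg)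
  qed
  show ?thesis
  proof (rule moduleI)
    show "abelian_group (M\<lparr>carrier := H\<rparr>)"
      by (rule abelian_groupI) (auto simp: cl ne add neg M.a_ac)
  qed (auto simp: M.R.is_cring cl smult M.smult_l_distr M.smult_r_distr M.smult_assoc1)
qed

section \<open>The subalgebra of coinvariants\<close>

context galois_setup
begin

definition "B = coinvariants k A C \<rho>"

lemma B_iff: "b \<in> carrier B \<longleftrightarrow> b \<in> carrier A \<and> (\<forall>a\<in>carrier A. \<rho> (b ** a) = lact b (\<rho> a))"
  unfolding B_def coinvariants_def tp_def[symmetric] by (auto simp: left_mult_eq)

lemma B_ops[simp]: "(\<oplus>\<^bsub>B\<^esub>) = (\<oplus>\<^bsub>A\<^esub>)" "(\<otimes>\<^bsub>B\<^esub>) = (\<otimes>\<^bsub>A\<^esub>)" "(\<odot>\<^bsub>B\<^esub>) = (\<odot>\<^bsub>A\<^esub>)" "\<one>\<^bsub>B\<^esub> = u" "\<zero>\<^bsub>B\<^esub> = \<zero>\<^bsub>A\<^esub>"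
  by (simp_all add: B_def coinvariants_def)

lemma B_A[simp]: "b \<in> carrier B \<Longrightarrow> b \<in> carrier A"
  by (simp add: B_iff)

lemma rho_B: "\<lbrakk>b \<in> carrier B; a \<in> carrier A\<rbrakk> \<Longrightarrow> \<rho> (b ** a) = lact b (\<rho> a)"
  unfolding B_iff by blast

lemma A_add_closed[simp]: "\<lbrakk>a \<in> carrier A; b \<in> carrier A\<rbrakk> \<Longrightarrow> a \<oplus>\<^bsub>A\<^esub> b \<in> carrier A"
  using module_abelian_group[OF A_module] by (simp add: abelian_group_def abelian_monoid.a_closed)

lemma A_smult_closed[simp]: "\<lbrakk>r \<in> carrier k; a \<in> carrier A\<rbrakk> \<Longrightarrow> r \<odot>\<^bsub>A\<^esub> a \<in> carrier A"
  by (simp add: smul_closed)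

lemma B_add:
  assumes "b \<in> carrier B" "b' \<in> carrier B" shows "b \<oplus>\<^bsub>A\<^esub> b' \<in> carrier B"
  unfolding B_iff
proof (intro conjI ballI)
  fix a assume "a \<in> carrier A"
  with assms show "\<rho> ((b \<oplus>\<^bsub>A\<^esub> b') ** a) = lact (b \<oplus>\<^bsub>A\<^esub> b') (\<rho> a)"
    by (simp add: lin_add[OF mulR_lin] lin_add[OF rho_lin] lin_add[OF lact_lin2] rho_B)
qed (simp add: assms)

lemma B_smult:
  assumes "r \<in> carrier k" "b \<in> carrier B" shows "r \<odot>\<^bsub>A\<^esub> b \<in> carrier B"
  unfolding B_iff
proof (intro conjI ballI)
  fix a assume "a \<in> carrier A"
  with assms show "\<rho> ((r \<odot>\<^bsub>A\<^esub> b) ** a) = lact (r \<odot>\<^bsub>A\<^esub> b) (\<rho> a)"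
    by (simp add: lin_smult[OF mulR_lin] lin_smult[OF rho_lin] lin_smult[OF lact_lin2] rho_B)
qed (simp add: assms)

lemma B_mult[simp]:
  assumes "b \<in> carrier B" "b' \<in> carrier B" shows "b ** b' \<in> carrier B"
  unfolding B_iff
proof (intro conjI ballI)
  fix a assume "a \<in> carrier A"
  with assms show "\<rho> (b ** b' ** a) = lact (b ** b') (\<rho> a)"
    by (simp add: mul_assoc rho_B lact_lact)
qed (simp add: assms)

lemma B_one[simp]: "u \<in> carrier B"
  unfolding B_iff by (simp add: lact_u)

lemma B_zero: "\<zero>\<^bsub>A\<^esub> \<in> carrier B"
proof -
  interpret module k A by simp
  show ?thesis using B_smult[of "\<zero>\<^bsub>k\<^esub>" u] by simp
qed

lemma B_module[simp]: "module k B"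
proof -
  have eq: "A\<lparr>carrier := carrier B\<rparr> = B" by (simp add: B_def coinvariants_def del: B_A)
  have "module k (A\<lparr>carrier := carrier B\<rparr>)"
    by (rule module_carrier_update) (auto simp: B_zero B_add B_smult)
  then show ?thesis unfolding eq .
qed

lemma B_ring: "ring B"
proof -
  interpret B: module k B by simp
  show ?thesis
    by (rule ringI[OF B.abelian_group_axioms monoidI])
      (simp_all add: mul_assoc lin_add[OF mulR_lin] lin_add[OF mulL_lin])
qed

lemma lin_B_A[simp]: "lin k B A (\<lambda>b. b)"
  by (auto simp: lin_iff)

lemma lin_B_mult[simp]: "b \<in> carrier B \<Longrightarrow> lin k B B (\<lambda>x. b ** x)"
  using mulL_lin[of b] by (auto simp: lin_iff)

section \<open>The coring as a module, and the coinvariants of A \<otimes> A\<close>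

definition "cor = coring k A C \<psi>R"

text \<open>The image of an idempotent is its set of fixed elements; \<open>pR\<close> is idempotent
  because it is \<psi>R \<circ> \<psi>L and fixes all values of \<psi>R.\<close>

lemma cor_iff: "X \<in> carrier cor \<longleftrightarrow> X \<in> carrier AC \<and> pR X = X"
proof -
  have "carrier cor = pR ` carrier AC"
    unfolding cor_def coring_def tp_def[symmetric] by (simp add: proj_right_eq cong: image_cong)
  moreover have "pR (pR X) = pR X" if "X \<in> carrier AC" for X
    using that pR_R[of "\<psi>L X"] by (simp add: R_L)
  ultimately show ?thesis by (auto simp: image_iff)
qed

lemma cor_ops: "(\<oplus>\<^bsub>cor\<^esub>) = (\<oplus>\<^bsub>AC\<^esub>)" "(\<odot>\<^bsub>cor\<^esub>) = (\<odot>\<^bsub>AC\<^esub>)"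
  by (simp_all add: cor_def coring_def tp_def)

lemma cor_module[simp]: "module k cor"
proof -
  interpret AC: module k AC by (simp add: sweedler_simps)
  have eq: "AC\<lparr>carrier := carrier cor\<rparr> = cor" by (simp add: cor_def coring_def tp_def)
  have "module k (AC\<lparr>carrier := carrier cor\<rparr>)"
  proof (rule module_carrier_update)
    have "pR \<zero>\<^bsub>AC\<^esub> = \<zero>\<^bsub>AC\<^esub>" using lin_smult[OF pR_lin, of "\<zero>\<^bsub>k\<^esub>" "\<zero>\<^bsub>AC\<^esub>"] by simp
    then show "\<zero>\<^bsub>AC\<^esub> \<in> carrier cor" by (simp add: cor_iff)
  qed (auto simp: cor_iff sweedler_simps lin_add[OF pR_lin] lin_smult[OF pR_lin])
  then show ?thesis unfolding eq .
qed

lemma lin_cor: "lin k P cor f \<longleftrightarrow> lin k P AC f \<and> (\<forall>x\<in>carrier P. pR (f x) = f x)"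
  by (auto simp: lin_iff cor_ops cor_iff)

definition "swap_tensor X = ts A A AT X (\<lambda>x y. y \<boxtimes>\<^bsub>AT\<^esub> x)"

lemma swap_lin[simp]: "lin k AT AT swap_tensor"
  unfolding swap_tensor_def by (simp add: sweedler_simps)

lemmas swap_simps[simp] = lin_closed[OF swap_lin] lin_comp[OF swap_lin]

lemma swap_swap: "X \<in> carrier AT \<Longrightarrow> swap_tensor (swap_tensor X) = X"
  by (rule tp_ext[OF A_module A_module, where G = AT]) (simp_all add: sweedler_simps swap_tensor_def)

lemma coring_right_act_eq: "\<lbrakk>X \<in> carrier AC; b \<in> carrier A\<rbrakk> \<Longrightarrow> coring_right_act k A C \<psi>R X b = ract X b"
  unfolding coring_right_act_def tp_def[symmetric] ract_def by (simp add: tsum_AC tsum_R sweedler_simps)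

text \<open>Applying \<psi>R to the C \<otimes> A leg turns \<open>lcoact x\<close> into x g and
  \<psi>L(\<rho>(x)) into \<rho>(x) = g x. The exchange of factors puts x into the second place,
  where the definition tests coinvariance.\<close>

lemma coinvariants_tensorI:
  assumes X: "X \<in> carrier AT"
    and eq: "ts A A (tp k CA A) X (\<lambda>x y. lcoact x \<boxtimes>\<^bsub>tp k CA A\<^esub> y) =
      ts A A (tp k CA A) X (\<lambda>x y. \<psi>L (\<rho> x) \<boxtimes>\<^bsub>tp k CA A\<^esub> y)"
  shows "swap_tensor X \<in> coinvariants_tensor k A C \<psi>R \<rho>"
proof -
  let ?T = "tp k A cor"
  \<comment> \<open>The equation to be proved lives in the tensor product of A with the coring, not
    with A \<otimes> C, so \<psi>R has to be used as a map into \<open>cor\<close>.\<close>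
  have linR: "lin k CA cor \<psi>R" by (simp add: lin_cor R_lin pR_R)
  note [simp] = linR lin_comp[OF linR] lin_closed[OF linR]
  have lin1: "lin k A cor \<rho>" by (simp add: lin_cor rho_lin pR_rho)
  have lin2: "lin k A cor (\<lambda>x. lact x (\<rho> u))" by (simp add: lin_cor lact_lin2 pR_lact pR_rho)
  note [simp] = lin1 lin2 lin_closed[OF lin1] lin_closed[OF lin2]
  have r1: "\<rho> x = \<psi>R (\<psi>L (\<rho> x))" if "x \<in> carrier A" for x using that by (simp add: R_L pR_rho)
  have r2: "lact x (\<rho> u) = \<psi>R (lcoact x)" if "x \<in> carrier A" for x using that
    by (simp add: lcoact_def R_L pR_rho pR_lact)
  have "tsum ?T (swap_tensor X) (\<lambda>a b. a \<boxtimes>\<^bsub>?T\<^esub> coring_right_act k A C \<psi>R (\<rho> u) b) =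
    ts A A ?T (swap_tensor X) (\<lambda>a b. a \<boxtimes>\<^bsub>?T\<^esub> \<rho> b)"
    using X by (simp add: tsum_AT coring_right_act_eq rho_ract[symmetric])
  also have "\<dots> = ts A A ?T X (\<lambda>x y. y \<boxtimes>\<^bsub>?T\<^esub> \<psi>R (\<psi>L (\<rho> x)))"
    using X by (simp add: swap_tensor_def sweedler_simps r1[symmetric])
  also have "\<dots> = ts CA A ?T (ts A A (tp k CA A) X (\<lambda>x y. \<psi>L (\<rho> x) \<boxtimes>\<^bsub>tp k CA A\<^esub> y)) (\<lambda>w y. y \<boxtimes>\<^bsub>?T\<^esub> \<psi>R w)"
    using X by (simp add: sweedler_simps)
  also have "\<dots> = ts A A ?T X (\<lambda>x y. y \<boxtimes>\<^bsub>?T\<^esub> \<psi>R (lcoact x))"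
    unfolding eq[symmetric] using X by (simp add: sweedler_simps)
  also have "\<dots> = ts A A ?T (swap_tensor X) (\<lambda>a b. a \<boxtimes>\<^bsub>?T\<^esub> lact b (\<rho> u))"
    using X by (simp add: swap_tensor_def sweedler_simps r2)
  also have "\<dots> = tsum ?T (swap_tensor X) (\<lambda>a b. a \<boxtimes>\<^bsub>?T\<^esub> left_mult A AC b (\<rho> u))"
    using X by (simp add: tsum_AT left_mult_eq)
  finally show ?thesis
    using X unfolding coinvariants_tensor_def Let_def cor_def[symmetric] tp_def[symmetric] by simp
qed

end

lemma abelian_group_cong:
  assumes "abelian_group M" and "carrier N = carrier M" "(\<oplus>\<^bsub>N\<^esub>) = (\<oplus>\<^bsub>M\<^esub>)" "\<zero>\<^bsub>N\<^esub> = \<zero>\<^bsub>M\<^esub>"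
  shows "abelian_group N"
proof -
  interpret M: abelian_group M by fact
  have inv: "\<exists>y\<in>carrier M. y \<oplus>\<^bsub>M\<^esub> x = \<zero>\<^bsub>M\<^esub>" if "x \<in> carrier M" for x
    using that by (intro bexI[of _ "\<ominus>\<^bsub>M\<^esub> x"]) (simp_all add: M.l_neg)
  show ?thesis
    by (rule abelian_groupI; unfold assms(2-4)) (simp_all add: M.a_assoc inv, rule M.a_comm)
qed

lemma module_restrict_scalars:
  assumes BM: "module k B" and BR: "ring B" and N: "left_module B N"
    and comm: "\<And>r s. \<lbrakk>r \<in> carrier k; s \<in> carrier k\<rbrakk> \<Longrightarrow> (r \<odot>\<^bsub>B\<^esub> \<one>\<^bsub>B\<^esub>) \<otimes>\<^bsub>B\<^esub> (s \<odot>\<^bsub>B\<^esub> \<one>\<^bsub>B\<^esub>) = (r \<otimes>\<^bsub>k\<^esub> s) \<odot>\<^bsub>B\<^esub> \<one>\<^bsub>B\<^esub>"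
  shows "module k (restrict_scalars B N)"
proof -
  interpret B: module k B by fact
  interpret BR: ring B by fact
  interpret N: left_module B N by fact
  show ?thesis
  proof (rule moduleI)
    show "abelian_group (restrict_scalars B N)"
      by (rule abelian_group_cong[OF N.M.abelian_group_axioms]) (simp_all add: restrict_scalars_def)
  qed (auto simp: restrict_scalars_def B.R.is_cring N.act_closed N.act_add_right N.act_one B.smult_l_distr
      N.act_add_left N.act_mult[symmetric] comm)
qed

section \<open>The B-linear splitting of the multiplication map\<close>

locale galois_coinvariants = galois_split k A C \<psi>R \<psi>L \<rho> h
  for k :: "('k, 'w) ring_scheme" and A :: "('k, 'a, 'x) module_scheme" and C :: "('k, 'c, 'y) coalgebra_scheme"
    and \<psi>R :: "('c, 'a) tens \<Rightarrow> ('a, 'c) tens" and \<psi>L :: "('a, 'c) tens \<Rightarrow> ('c, 'a) tens"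
    and \<rho> :: "'a \<Rightarrow> ('a, 'c) tens" and h :: "'c \<Rightarrow> ('a, 'a) tens" +
  assumes bij: "bij_betw (\<lambda>X. tsum (tensor k A A) X (\<lambda>a b. a \<boxtimes>\<^bsub>tensor k A A\<^esub> b))
         (carrier (tensor k A (coinvariants k A C \<rho>))) (coinvariants_tensor k A C \<psi>R \<rho>)"
begin

abbreviation "AB \<equiv> tp k A B"

definition "incl_AB Z = ts A B AT Z (\<lambda>a b. a \<boxtimes>\<^bsub>AT\<^esub> b)"
text \<open>B acts on the second factor because the hypothesis has the coinvariant factor there;
  before the exchange this is left multiplication on B \<otimes> A.\<close>

definition "lactAB b Z = ts A B AB Z (\<lambda>y b'. y \<boxtimes>\<^bsub>AB\<^esub> (b ** b'))"

lemma incl_AB_lin: "lin k AB AT incl_AB"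
  unfolding incl_AB_def by (simp add: sweedler_simps)

lemma lactAB_lin: "b \<in> carrier B \<Longrightarrow> lin k AB AB (lactAB b)"
  unfolding lactAB_def by (simp add: sweedler_simps)

lemmas incl_AB_simps[simp] = incl_AB_lin lin_closed[OF incl_AB_lin] lin_comp[OF incl_AB_lin]
  lactAB_lin lin_closed[OF lactAB_lin] lin_comp[OF lactAB_lin]

lemma incl_AB_bij: "bij_betw incl_AB (carrier AB) (coinvariants_tensor k A C \<psi>R \<rho>)"
proof -
  have "tsum AT X (\<lambda>a b. a \<boxtimes>\<^bsub>AT\<^esub> b) = incl_AB X" if "X \<in> carrier AB" for X
    unfolding incl_AB_def by (rule tsum_ts) (use that in \<open>simp_all add: tp_def\<close>)
  then show ?thesis
    using bij unfolding B_def[symmetric] tp_def[symmetric]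
      by (subst bij_betw_cong[of _ _ incl_AB, symmetric]) auto
qed

lemma incl_AB_inj: "\<lbrakk>incl_AB X = incl_AB Y; X \<in> carrier AB; Y \<in> carrier AB\<rbrakk> \<Longrightarrow> X = Y"
  using incl_AB_bij by (auto simp: bij_betw_def dest: inj_onD)

text \<open>The sum of a_0 h(a_1), pulled back to A \<otimes> B along the bijection of the
  hypothesis. Since \<open>incl_AB\<close> is injective, linearity over \<open>k\<close> and over B
  can be checked after applying it.\<close>

definition "splitting a = inv_into (carrier AB) incl_AB (swap_tensor (can_section (\<rho> a)))"

lemma splitting: assumes a: "a \<in> carrier A" shows "splitting a \<in> carrier AB" "incl_AB (splitting a) =
  swap_tensor (can_section (\<rho> a))"
proof -
  have "swap_tensor (can_section (\<rho> a)) \<in> coinvariants_tensor k A C \<psi>R \<rho>"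
    by (rule coinvariants_tensorI[OF _ can_section_rho_coinvariant]) (use a in simp_all)
  then have "swap_tensor (can_section (\<rho> a)) \<in> incl_AB ` carrier AB"
    using incl_AB_bij by (simp add: bij_betw_def)
  then show "splitting a \<in> carrier AB" "incl_AB (splitting a) = swap_tensor (can_section (\<rho> a))"
    unfolding splitting_def by (simp_all only: inv_into_into f_inv_into_f)
qed

lemma splitting_lin: "lin k A AB splitting"
proof -
  interpret AB: module k AB by (simp add: sweedler_simps)
  have l: "lin k A AT (\<lambda>a. swap_tensor (can_section (\<rho> a)))" by (simp add: rho_lin)
  have "splitting (a \<oplus>\<^bsub>A\<^esub> b) = splitting a \<oplus>\<^bsub>AB\<^esub> splitting b" if "a \<in> carrier A" "b \<in> carrier A" for a b
    by (rule incl_AB_inj) (use that in \<open>simp_all add: splitting lin_add[OF incl_AB_lin] lin_add[OF l]\<close>)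
  moreover have "splitting (r \<odot>\<^bsub>A\<^esub> b) = r \<odot>\<^bsub>AB\<^esub> splitting b" if "r \<in> carrier k" "b \<in> carrier A" for r b
    by (rule incl_AB_inj) (use that in \<open>simp_all add: splitting lin_smult[OF incl_AB_lin] lin_smult[OF l]\<close>)
  ultimately show ?thesis by (simp add: lin_iff splitting)
qed

lemmas splitting_simps[simp] = splitting(1) splitting_lin lin_comp[OF splitting_lin]

text \<open>For b in B the coaction satisfies \<rho>(b a) = b \<rho>(a), and
  \<open>can_section\<close> is left A-linear; after the exchange of factors the factor b sits in
  the second place.\<close>

lemma splitting_lactAB:
  assumes b: "b \<in> carrier B" and a: "a \<in> carrier A"
  shows "splitting (b ** a) = lactAB b (splitting a)"
proof (rule incl_AB_inj)
  have s: "can_section (lact b X) =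
    ts A A AT (can_section X) (\<lambda>x y. (b ** x) \<boxtimes>\<^bsub>AT\<^esub> y)" if X: "X \<in> carrier AC" for X
    by (rule tp_ext[OF A_module C_module X, where G =
      AT]) (use b in \<open>simp_all add: sweedler_simps can_section_def lact_def mul_assoc\<close>)
  have i: "incl_AB (lactAB b Z) = ts A A AT (incl_AB Z) (\<lambda>y x. y \<boxtimes>\<^bsub>AT\<^esub> (b ** x))" if Z: "Z \<in> carrier AB" for Z
    by (rule tp_ext[OF A_module B_module Z, where G =
      AT]) (use b in \<open>simp_all add: sweedler_simps incl_AB_def lactAB_def\<close>)
  have "incl_AB (lactAB b (splitting a)) = ts A A AT (swap_tensor (can_section (\<rho> a))) (\<lambda>y x. y \<boxtimes>\<^bsub>AT\<^esub> (b ** x))"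
    using a by (simp add: i splitting)
  also have "\<dots> = swap_tensor (can_section (\<rho> (b ** a)))"
    using a b by (simp add: rho_B s swap_tensor_def sweedler_simps)
  finally show "incl_AB (splitting (b ** a)) = incl_AB (lactAB b (splitting a))" using a b
    by (simp add: splitting)
qed (use a b in simp_all)

lemma mult_splitting: assumes a: "a \<in> carrier A" shows "ts A B A (splitting a) (\<lambda>y b. b ** y) = a"
proof -
  have "ts A B A (splitting a) (\<lambda>y b. b ** y) = ts A A A (incl_AB (splitting a)) (\<lambda>y b. b ** y)"
    using a by (simp add: incl_AB_def sweedler_simps)
  also have "\<dots> = ts A A A (can_section (\<rho> a)) (\<lambda>x y. x ** y)"
    using a by (simp add: splitting swap_tensor_def sweedler_simps)
  finally show ?thesis using a by (simp add: mult_can_section_rho)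
qed

section \<open>Relative projectivity over B\<close>

lemma left_module_B_A: "left_module B (left_regular A)"
proof -
  have "abelian_group (left_regular A)"
    by (rule abelian_group_cong[OF module_abelian_group[OF A_module]]) (simp_all add: left_regular_def)
  then show ?thesis
    unfolding left_module_def left_module_axioms_def using B_ring
    by (auto simp: left_regular_def mul_assoc lin_add[OF mulR_lin] lin_add[OF mulL_lin])
qed

lemma A_smult_mult: "\<lbrakk>r \<in> carrier k; x \<in> carrier A; y \<in> carrier A\<rbrakk> \<Longrightarrow> (r \<odot>\<^bsub>A\<^esub> x) ** y = r \<odot>\<^bsub>A\<^esub> (x ** y)"
  "\<lbrakk>r \<in> carrier k; x \<in> carrier A; y \<in> carrier A\<rbrakk> \<Longrightarrow> x ** (r \<odot>\<^bsub>A\<^esub> y) = r \<odot>\<^bsub>A\<^esub> (x ** y)"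
  by (simp_all add: lin_smult[OF mulR_lin] lin_smult[OF mulL_lin])

lemma A_smult_smult:
  assumes "r \<in> carrier k" "s \<in> carrier k" "x \<in> carrier A"
  shows "s \<odot>\<^bsub>A\<^esub> (r \<odot>\<^bsub>A\<^esub> x) = r \<odot>\<^bsub>A\<^esub> (s \<odot>\<^bsub>A\<^esub> x)"
  using assms module.smult_assoc1[OF A_module, of s r x] module.smult_assoc1[OF A_module, of r s x]
    cring.cring_simprules(14)[OF module_cring[OF A_module], of r s] by simp

text \<open>The splitting lands in a tensor product over \<open>k\<close>, so a section s that is
  merely k-linear suffices to define b \<otimes> y \<mapsto> b s(y), which is B-linear in b. Its
  composite with the splitting is the required B-linear section.\<close>

lemma relatively_projective_A: "relatively_projective TYPE('n) k B (left_regular A)"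
  unfolding relatively_projective_def
proof (intro conjI allI impI left_module_B_A; elim conjE bexE)
  fix N :: "('a, 'n) module" and p s
  assume N: "left_module B N" and p: "p \<in> linear_maps B N (left_regular A)"
    and s: "s \<in> linear_maps k (restrict_scalars B (left_regular A)) (restrict_scalars B N)"
    and ps: "\<forall>m\<in>carrier (left_regular A). p (s m) = m"
  interpret N: left_module B N by fact
  \<comment> \<open>Viewed as a k-module, the test module becomes a legitimate target for the
    sums.\<close>
  define N' where "N' = restrict_scalars B N"
  have N'_ops: "carrier N' = carrier N" "(\<oplus>\<^bsub>N'\<^esub>) = (\<oplus>\<^bsub>N\<^esub>)" "\<And>r n. r \<odot>\<^bsub>N'\<^esub> n = (r \<odot>\<^bsub>A\<^esub> u) \<odot>\<^bsub>N\<^esub> n"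
    by (simp_all add: N'_def restrict_scalars_def)
  have N'[simp]: "module k N'"
    unfolding N'_def by (rule module_restrict_scalars[OF B_module B_ring N]) (simp add: A_smult_mult
      A_smult_smult module.smult_assoc1[OF A_module])
  have s_lin: "lin k A N' s"
  proof -
    let ?A = "restrict_scalars B (left_regular A)"
    have "carrier ?A = carrier A" "(\<oplus>\<^bsub>?A\<^esub>) = (\<oplus>\<^bsub>A\<^esub>)"
      "\<And>r x. \<lbrakk>r \<in> carrier k; x \<in> carrier A\<rbrakk> \<Longrightarrow> r \<odot>\<^bsub>?A\<^esub> x = r \<odot>\<^bsub>A\<^esub> x"
      by (simp_all add: restrict_scalars_def left_regular_def A_smult_mult)
    with s show ?thesis
      unfolding N'_def[symmetric] by (auto simp: lin_iff linear_maps_def)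
  qed
  have "p n \<in> carrier A" if "n \<in> carrier N" for n
    using p that by (auto simp: linear_maps_def left_regular_def)
  then have p_lin: "lin k N' A p"
    using p by (auto simp: lin_iff linear_maps_def N'_ops left_regular_def A_smult_mult B_smult)
  have p_B: "p (b \<odot>\<^bsub>N\<^esub> n) = b ** p n" if "b \<in> carrier B" "n \<in> carrier N" for b n
    using p that by (auto simp: linear_maps_def left_regular_def)
  have actL: "lin k N' N' (\<lambda>n. b \<odot>\<^bsub>N\<^esub> n)" if b: "b \<in> carrier B" for b
    using b by (auto simp: lin_iff N'_ops N.act_closed N.act_add_right N.act_mult[symmetric] B_smult
      A_smult_mult)
  have actR: "lin k B N' (\<lambda>b. b \<odot>\<^bsub>N\<^esub> n)" if n: "n \<in> carrier N" for n
    using n N.act_add_left by (auto simp: lin_iff N'_ops N.act_closed N.act_mult[symmetric] B_smult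
      A_smult_mult)
  have s_closed: "s y \<in> carrier N" if "y \<in> carrier A" for y
    using lin_closed[OF s_lin that] by (simp add: N'_ops)
  note [simp] = s_lin lin_comp[OF s_lin] actL lin_comp[OF actL] actR s_closed N.act_closed
  define t where "t a = ts A B N' (splitting a) (\<lambda>y b. b \<odot>\<^bsub>N\<^esub> s y)" for a
  have bil: "bilin k A B N' (\<lambda>y b. b \<odot>\<^bsub>N\<^esub> s y)"
    by (simp add: bilin_def)
  have t_lin: "lin k A N' t"
    unfolding t_def by (rule lin_tsX) (simp_all add: bil)
  have t_B: "t (b ** a) = b \<odot>\<^bsub>N\<^esub> t a" if b: "b \<in> carrier B" and a: "a \<in> carrier A" for a b
  proof -
    have "t (b ** a) = ts A B N' (splitting a) (\<lambda>y b'. (b ** b') \<odot>\<^bsub>N\<^esub> s y)"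
      using a b by (simp add: t_def splitting_lactAB lactAB_def sweedler_simps)
    also have "\<dots> = ts A B N' (splitting a) (\<lambda>y b'. b \<odot>\<^bsub>N\<^esub> (b' \<odot>\<^bsub>N\<^esub> s y))"
      using b N.act_mult by (intro ts_cong refl) simp
    also have "\<dots> = b \<odot>\<^bsub>N\<^esub> t a"
      unfolding t_def by (rule lin_apply_ts[symmetric, OF _ _ _ _ bil actL]) (use a b in simp_all)
    finally show ?thesis .
  qed
  have p_t: "p (t a) = a" if a: "a \<in> carrier A" for a
  proof -
    have "p (t a) = ts A B A (splitting a) (\<lambda>y b. p (b \<odot>\<^bsub>N\<^esub> s y))"
      unfolding t_def by (rule lin_apply_ts[OF _ _ _ _ bil p_lin]) (use a in simp_all)
    also have "\<dots> = ts A B A (splitting a) (\<lambda>y b. b ** y)"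
      using ps by (intro ts_cong refl) (simp add: p_B left_regular_def)
    finally show ?thesis using mult_splitting[OF a] by simp
  qed
  have "t \<in> linear_maps B (left_regular A) N"
    using t_lin t_B by (auto simp: lin_iff linear_maps_def left_regular_def N'_ops)
  then show "\<exists>t\<in>linear_maps B (left_regular A) N. \<forall>m\<in>carrier (left_regular A). p (t m) = m"
    by (rule bexI[rotated]) (simp add: p_t left_regular_def)
qed

section \<open>The tensor product over B and the canonical map on it\<close>

definition "TB = tensor_over (carrier B) (\<otimes>\<^bsub>A\<^esub>) (\<otimes>\<^bsub>A\<^esub>) A A"

lemma TB_setup: "tensor_setup k (carrier B) (\<otimes>\<^bsub>A\<^esub>) (\<otimes>\<^bsub>A\<^esub>) A A"
  unfolding tensor_setup_def tensor_setup_axioms_def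
  using module_abelian_group[OF A_module] by (simp add: A_smult_mult)

interpretation TB: tensor_setup k "carrier B" "(\<otimes>\<^bsub>A\<^esub>)" "(\<otimes>\<^bsub>A\<^esub>)" A A
  by (rule TB_setup)

lemma TB_module[simp]: "module k TB"
  unfolding TB_def by (rule TB.T_module)

lemma TB_pure_closed[simp]: "\<lbrakk>x \<in> carrier A; y \<in> carrier A\<rbrakk> \<Longrightarrow> x \<boxtimes>\<^bsub>TB\<^esub> y \<in> carrier TB"
  unfolding TB_def by (rule TB.pure_closed)

lemma TB_balanced: "\<lbrakk>x \<in> carrier A; b \<in> carrier B; y \<in> carrier A\<rbrakk> \<Longrightarrow> (x ** b) \<boxtimes>\<^bsub>TB\<^esub> y = x \<boxtimes>\<^bsub>TB\<^esub> (b ** y)"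
  unfolding TB_def by (rule TB.pure_balanced)

text \<open>On the right factor the scalar r is written as multiplication by r 1, which lies in B
  and may cross the tensor sign.\<close>

lemma TB_pure_smult:
  assumes "r \<in> carrier k" "x \<in> carrier A" "y \<in> carrier A"
  shows "(r \<odot>\<^bsub>A\<^esub> x) \<boxtimes>\<^bsub>TB\<^esub> y = r \<odot>\<^bsub>TB\<^esub> (x \<boxtimes>\<^bsub>TB\<^esub> y)" "x \<boxtimes>\<^bsub>TB\<^esub> (r \<odot>\<^bsub>A\<^esub> y) = r \<odot>\<^bsub>TB\<^esub> (x \<boxtimes>\<^bsub>TB\<^esub> y)"
proof -
  show 1: "(r \<odot>\<^bsub>A\<^esub> x) \<boxtimes>\<^bsub>TB\<^esub> y = r \<odot>\<^bsub>TB\<^esub> (x \<boxtimes>\<^bsub>TB\<^esub> y)"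
    unfolding TB_def using TB.smult_pure assms by simp
  have "x \<boxtimes>\<^bsub>TB\<^esub> ((r \<odot>\<^bsub>A\<^esub> u) ** y) = (x ** (r \<odot>\<^bsub>A\<^esub> u)) \<boxtimes>\<^bsub>TB\<^esub> y"
    using assms B_smult by (simp add: TB_balanced)
  then show "x \<boxtimes>\<^bsub>TB\<^esub> (r \<odot>\<^bsub>A\<^esub> y) = r \<odot>\<^bsub>TB\<^esub> (x \<boxtimes>\<^bsub>TB\<^esub> y)"
    using assms by (simp add: A_smult_mult 1)
qed

lemma TB_linL[simp]: "\<lbrakk>lin k P A f; y \<in> carrier A\<rbrakk> \<Longrightarrow> lin k P TB (\<lambda>p. f p \<boxtimes>\<^bsub>TB\<^esub> y)"
  by (simp add: lin_iff TB_pure_smult) (simp add: TB_def TB.pure_add_left)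

lemma TB_linR[simp]: "\<lbrakk>lin k P A f; x \<in> carrier A\<rbrakk> \<Longrightarrow> lin k P TB (\<lambda>p. x \<boxtimes>\<^bsub>TB\<^esub> f p)"
  by (simp add: lin_iff TB_pure_smult) (simp add: TB_def TB.pure_add_right)

definition "balanced F \<longleftrightarrow> (\<forall>x\<in>carrier A. \<forall>b\<in>carrier B. \<forall>y\<in>carrier A. F (x ** b) y = F x (b ** y))"

lemma TB_ts_pure:
  assumes "module k G" "bilin k A A G F" "balanced F" "x \<in> carrier A" "y \<in> carrier A"
  shows "ts A A G (x \<boxtimes>\<^bsub>TB\<^esub> y) F = F x y"
  unfolding TB_def by (rule TB.ts_pure) (use assms in \<open>auto simp: bilin_def balanced_def lin_add\<close>)

lemma TB_lin_ts:
  assumes "module k G" "bilin k A A G F" "balanced F"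
  shows "lin k TB G (\<lambda>X. ts A A G X F)"
  unfolding TB_def by (rule TB.lin_ts) (use assms in \<open>auto simp: bilin_def balanced_def lin_add\<close>)

lemma TB_ext:
  assumes "X \<in> carrier TB" "lin k TB G f" "lin k TB G g"
    and "\<And>x y. \<lbrakk>x \<in> carrier A; y \<in> carrier A\<rbrakk> \<Longrightarrow> f (x \<boxtimes>\<^bsub>TB\<^esub> y) = g (x \<boxtimes>\<^bsub>TB\<^esub> y)"
  shows "f X = g X"
  using assms unfolding TB_def by (rule TB.tensor_ext)

lemma tsum_TB: "X \<in> carrier TB \<Longrightarrow> tsum G X f = ts A A G X f"
  unfolding TB_def by (rule TB.tsum_ts)

definition "to_TB X = ts A A TB X (\<lambda>x y. x \<boxtimes>\<^bsub>TB\<^esub> y)"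

lemma to_TB_lin: "lin k AT TB to_TB"
  unfolding to_TB_def by (simp add: sweedler_simps)

lemmas to_TB_simps[simp] = to_TB_lin lin_closed[OF to_TB_lin] lin_comp[OF to_TB_lin]

lemma to_TB_pure: "\<lbrakk>x \<in> carrier A; y \<in> carrier A\<rbrakk> \<Longrightarrow> to_TB (x \<boxtimes>\<^bsub>AT\<^esub> y) = x \<boxtimes>\<^bsub>TB\<^esub> y"
  by (simp add: to_TB_def sweedler_simps)

text \<open>This is the defining property of B, namely \<rho>(b y) = b \<rho>(y).\<close>

lemma can_balanced: "balanced (\<lambda>x y. lact x (\<rho> y))"
  by (simp add: balanced_def rho_B lact_lact)

lemma can_TB_lin: "lin k TB AC can"
  unfolding can_def by (rule TB_lin_ts[OF _ _ can_balanced]) (simp_all add: sweedler_simps rho_lin)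

lemmas can_TB_simps[simp] = can_TB_lin lin_closed[OF can_TB_lin] lin_comp[OF can_TB_lin]

lemma can_TB_pure: "\<lbrakk>x \<in> carrier A; y \<in> carrier A\<rbrakk> \<Longrightarrow> can (x \<boxtimes>\<^bsub>TB\<^esub> y) = lact x (\<rho> y)"
  unfolding can_def by (rule TB_ts_pure[OF _ _ can_balanced]) (simp_all add: sweedler_simps rho_lin)

lemma can_to_TB: "X \<in> carrier AT \<Longrightarrow> can (to_TB X) = can X"
  by (rule tp_ext[OF A_module A_module, where G =
    AC]) (simp_all add: sweedler_simps to_TB_pure can_TB_pure can_pure)

definition "lactB a Z = ts A A TB Z (\<lambda>x y. (a ** x) \<boxtimes>\<^bsub>TB\<^esub> y)"

lemma lactB_balanced: "a \<in> carrier A \<Longrightarrow> balanced (\<lambda>x y. (a ** x) \<boxtimes>\<^bsub>TB\<^esub> y)"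
  by (simp add: balanced_def mul_assoc[symmetric] TB_balanced)

lemma lactB_lin: "a \<in> carrier A \<Longrightarrow> lin k TB TB (lactB a)"
  unfolding lactB_def by (rule TB_lin_ts[OF _ _ lactB_balanced]) (simp_all add: sweedler_simps)

lemmas lactB_simps[simp] = lactB_lin lin_closed[OF lactB_lin] lin_comp[OF lactB_lin]

lemma lactB_pure: "\<lbrakk>a \<in> carrier A; x \<in> carrier A; y \<in> carrier A\<rbrakk> \<Longrightarrow> lactB a (x \<boxtimes>\<^bsub>TB\<^esub> y) = (a ** x) \<boxtimes>\<^bsub>TB\<^esub> y"
  unfolding lactB_def by (rule TB_ts_pure[OF _ _ lactB_balanced]) (simp_all add: sweedler_simps)

lemma can_lactB: "\<lbrakk>a \<in> carrier A; Z \<in> carrier TB\<rbrakk> \<Longrightarrow> can (lactB a Z) = lact a (can Z)"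
  by (rule TB_ext[of Z AC]) (simp_all add: lactB_pure can_TB_pure lact_lact lact_lin1)

section \<open>The section with values in A \<otimes>_B A\<close>

definition "sect X = to_TB (can_section X)"

lemma sect_lin: "lin k AC TB sect"
  unfolding sect_def by simp

lemmas sect_simps[simp] = sect_lin lin_closed[OF sect_lin] lin_comp[OF sect_lin]

lemma can_sect: "X \<in> carrier AC \<Longrightarrow> can (sect X) = pR X"
  by (simp add: sect_def can_to_TB can_can_section)

lemma sect_lact:
  assumes a: "a \<in> carrier A" and X: "X \<in> carrier AC"
  shows "sect (lact a X) = lactB a (sect X)"
proof (rule tp_ext[OF A_module C_module X, where G = TB])
  fix x c assume xc: "x \<in> carrier A" "c \<in> carrier C"
  have "lactB a (sect (x \<boxtimes>\<^bsub>AC\<^esub> c)) = lactB a (ts A A TB (h c) (\<lambda>p q. (x ** p) \<boxtimes>\<^bsub>TB\<^esub> q))"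
    using xc by (simp add: sect_def to_TB_def can_section_def sweedler_simps)
  also have "\<dots> = ts A A TB (h c) (\<lambda>p q. lactB a ((x ** p) \<boxtimes>\<^bsub>TB\<^esub> q))"
    by (rule lin_apply_ts[OF _ _ _ _ _ lactB_lin]) (use a xc in \<open>simp_all add: sweedler_simps\<close>)
  finally show "sect (lact a (x \<boxtimes>\<^bsub>AC\<^esub> c)) = lactB a (sect (x \<boxtimes>\<^bsub>AC\<^esub> c))"
    using a xc by (simp add: sect_def to_TB_def can_section_def lact_def lactB_pure mul_assoc sweedler_simps)
qed (use a in \<open>simp_all add: sweedler_simps\<close>)

lemma sect_rho:
  assumes a: "a \<in> carrier A"
  shows "sect (\<rho> a) = u \<boxtimes>\<^bsub>TB\<^esub> a"
proof -
  have "sect (\<rho> a) = to_TB (swap_tensor (incl_AB (splitting a)))"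
    using a by (simp add: sect_def splitting swap_swap)
  also have "\<dots> = ts A B TB (splitting a) (\<lambda>y b. b \<boxtimes>\<^bsub>TB\<^esub> y)"
    using a by (simp add: to_TB_def swap_tensor_def incl_AB_def sweedler_simps)
  also have "\<dots> = ts A B TB (splitting a) (\<lambda>y b. u \<boxtimes>\<^bsub>TB\<^esub> (b ** y))"
    by (intro ts_cong refl) (simp add: TB_balanced[symmetric])
  also have "\<dots> = u \<boxtimes>\<^bsub>TB\<^esub> ts A B A (splitting a) (\<lambda>y b. b ** y)"
    by (rule lin_apply_ts[symmetric, OF _ _ _ _ _ TB_linR[OF lin_ident]]) (use a in \<open>simp_all add:
      sweedler_simps\<close>)
  finally show ?thesis using a by (simp add: mult_splitting)
qed

text \<open>As x \<otimes> y is x times 1 \<otimes> y and the section is left A-linear, it is enough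
  to know its value at \<rho>(y).\<close>

lemma sect_can: "Z \<in> carrier TB \<Longrightarrow> sect (can Z) = Z"
  by (rule TB_ext[of Z TB]) (simp_all add: can_TB_pure sect_lact sect_rho lactB_pure lin_ident)

text \<open>\<open>pR\<close> is \<open>can\<close> after the section, and the section undoes
  \<open>can\<close>.\<close>

lemma sect_pR: "X \<in> carrier AC \<Longrightarrow> sect (pR X) = sect X"
  by (simp add: can_sect[symmetric] sect_can)

section \<open>Right colinearity of the canonical map and of its section\<close>

abbreviation "TBC \<equiv> tp k TB C"
abbreviation "ACC \<equiv> tp k AC C"

definition "coactTB Z = ts A A TBC Z (\<lambda>a b. ts A C TBC (\<rho> b) (\<lambda>b0 b1. (a \<boxtimes>\<^bsub>TB\<^esub> b0) \<boxtimes>\<^bsub>TBC\<^esub> b1))"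
definition "coactAC X = ts A C ACC X (\<lambda>a c. ts C C ACC (\<Delta> c) (\<lambda>c1 c2. (a \<boxtimes>\<^bsub>AC\<^esub> c1) \<boxtimes>\<^bsub>ACC\<^esub> c2))"

lemma coactTB_bilin: "bilin k A A TBC (\<lambda>a b. ts A C TBC (\<rho> b) (\<lambda>b0 b1. (a \<boxtimes>\<^bsub>TB\<^esub> b0) \<boxtimes>\<^bsub>TBC\<^esub> b1))"
  by (simp add: sweedler_simps rho_lin)

lemma coactTB_balanced: "balanced (\<lambda>a b. ts A C TBC (\<rho> b) (\<lambda>b0 b1. (a \<boxtimes>\<^bsub>TB\<^esub> b0) \<boxtimes>\<^bsub>TBC\<^esub> b1))"
  unfolding balanced_def by (simp add: rho_B TB_balanced) (simp add: lact_def sweedler_simps)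

lemma coactTB_lin: "lin k TB TBC coactTB"
  unfolding coactTB_def by (rule TB_lin_ts[OF _ coactTB_bilin coactTB_balanced]) (simp add: sweedler_simps)

lemma coactTB_pure: "\<lbrakk>x \<in> carrier A; y \<in> carrier A\<rbrakk> \<Longrightarrow>
  coactTB (x \<boxtimes>\<^bsub>TB\<^esub> y) = ts A C TBC (\<rho> y) (\<lambda>b0 b1. (x \<boxtimes>\<^bsub>TB\<^esub> b0) \<boxtimes>\<^bsub>TBC\<^esub> b1)"
  unfolding coactTB_def by (rule TB_ts_pure[OF _ coactTB_bilin coactTB_balanced]) (simp_all add: sweedler_simps)

lemma coactAC_lin: "lin k AC ACC coactAC"
  unfolding coactAC_def by (simp add: sweedler_simps)

lemmas coact_simps[simp] = coactTB_lin lin_closed[OF coactTB_lin] lin_comp[OF coactTB_lin]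
  coactAC_lin lin_closed[OF coactAC_lin] lin_comp[OF coactAC_lin]

lemma can_colinear:
  assumes Z: "Z \<in> carrier TB"
  shows "coactAC (can Z) = ts TB C ACC (coactTB Z) (\<lambda>x c. can x \<boxtimes>\<^bsub>ACC\<^esub> c)"
proof (rule TB_ext[OF Z, of ACC])
  fix a b assume ab: "a \<in> carrier A" "b \<in> carrier A"
  have "coactAC (can (a \<boxtimes>\<^bsub>TB\<^esub> b)) =
    ts A C ACC (\<rho> b) (\<lambda>b0 b1. ts C C ACC (\<Delta> b1) (\<lambda>c1 c2. ((a ** b0) \<boxtimes>\<^bsub>AC\<^esub> c1) \<boxtimes>\<^bsub>ACC\<^esub> c2))"
    using ab by (simp add: can_TB_pure coactAC_def lact_def sweedler_simps)
  also have "\<dots> = ts A C ACC (\<rho> b) (\<lambda>b0 b1. ts A C ACC (\<rho> b0) (\<lambda>z d. ((a ** z) \<boxtimes>\<^bsub>AC\<^esub> d) \<boxtimes>\<^bsub>ACC\<^esub> b1))"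
    by (rule rho_coassoc[symmetric]) (use ab in \<open>simp_all add: sweedler_simps\<close>)
  also have "\<dots> = ts TB C ACC (coactTB (a \<boxtimes>\<^bsub>TB\<^esub> b)) (\<lambda>x c. can x \<boxtimes>\<^bsub>ACC\<^esub> c)"
    using ab by (simp add: coactTB_pure sweedler_simps can_TB_pure) (simp add: lact_def sweedler_simps)
  finally show "coactAC (can (a \<boxtimes>\<^bsub>TB\<^esub> b)) = ts TB C ACC (coactTB (a \<boxtimes>\<^bsub>TB\<^esub> b)) (\<lambda>x c. can x \<boxtimes>\<^bsub>ACC\<^esub> c)" .
qed (simp_all add: sweedler_simps)

text \<open>The mirror image of \<open>pL_hom\<close>: \<open>pR_pure\<close> alters the left leg of
  the comultiplication and the coaction splits off the right one.\<close>

lemma pR_colinear: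
  assumes X: "X \<in> carrier AC"
  shows "coactAC (pR X) = ts AC C ACC (coactAC X) (\<lambda>x c. pR x \<boxtimes>\<^bsub>ACC\<^esub> c)"
proof (rule tp_ext[OF A_module C_module X, where G = ACC])
  fix a c assume ac: "a \<in> carrier A" "c \<in> carrier C"
  have "coactAC (pR (a \<boxtimes>\<^bsub>AC\<^esub> c)) =
    ts C C ACC (\<Delta> c) (\<lambda>c1 c2. ts C C ACC (\<Delta> c2) (\<lambda>d e. ((a ** eps c1) \<boxtimes>\<^bsub>AC\<^esub> d) \<boxtimes>\<^bsub>ACC\<^esub> e))"
    using ac by (simp add: pR_pure coactAC_def sweedler_simps)
  also have "\<dots> = ts C C ACC (\<Delta> c) (\<lambda>c1 c2. ts C C ACC (\<Delta> c1) (\<lambda>d e. ((a ** eps d) \<boxtimes>\<^bsub>AC\<^esub> e) \<boxtimes>\<^bsub>ACC\<^esub> c2))"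
    by (rule coassoc[symmetric]) (use ac in \<open>simp_all add: sweedler_simps\<close>)
  also have "\<dots> = ts AC C ACC (coactAC (a \<boxtimes>\<^bsub>AC\<^esub> c)) (\<lambda>x c. pR x \<boxtimes>\<^bsub>ACC\<^esub> c)"
    using ac by (simp add: coactAC_def sweedler_simps pR_pure)
  finally show "coactAC (pR (a \<boxtimes>\<^bsub>AC\<^esub> c)) = ts AC C ACC (coactAC (a \<boxtimes>\<^bsub>AC\<^esub> c)) (\<lambda>x c. pR x \<boxtimes>\<^bsub>ACC\<^esub> c)" .
qed (simp_all add: sweedler_simps pR_lin)

lemma sect_colinear:
  assumes X: "X \<in> carrier AC"
  shows "coactTB (sect X) = ts AC C TBC (coactAC X) (\<lambda>x c. sect x \<boxtimes>\<^bsub>TBC\<^esub> c)"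
proof -
  \<comment> \<open>A left inverse of can \<otimes> C. It reduces the claim to an equation after can
    \<otimes> C, where colinearity of \<open>can\<close> and of \<open>pR\<close> applies.\<close>
  have *: "Y =
    ts AC C TBC (ts TB C ACC Y (\<lambda>x c. can x \<boxtimes>\<^bsub>ACC\<^esub> c)) (\<lambda>x c. sect x \<boxtimes>\<^bsub>TBC\<^esub> c)" if Y: "Y \<in> carrier TBC" for Y
    using Y by (simp add: sweedler_simps sect_can ts_pures)
  have "coactTB (sect X) = ts AC C TBC (coactAC (can (sect X))) (\<lambda>x c. sect x \<boxtimes>\<^bsub>TBC\<^esub> c)"
    using *[of "coactTB (sect X)"] X by (simp add: can_colinear)
  also have "\<dots> = ts AC C TBC (coactAC X) (\<lambda>x c. sect x \<boxtimes>\<^bsub>TBC\<^esub> c)"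
    using X by (simp add: can_sect pR_colinear sweedler_simps sect_pR)
  finally show ?thesis .
qed

section \<open>Return to the maps of the definition\<close>

lemma tensor_coinv_eq: "tensor_coinv k A C \<rho> = TB"
  unfolding TB_def B_def ..

lemma weak_Galois: "weak_coalgebra_Galois k A C \<rho>"
proof -
  \<comment> \<open>The maps of the definition are compared with the working versions on carriers
    only, since that is where \<open>tsum\<close> is rewritten to \<open>ts\<close>.\<close>
  have eq1: "canonical_map k A C \<rho> Z = can Z" if "Z \<in> carrier TB" for Z
    using that unfolding canonical_map_def tp_def[symmetric] can_def by (simp add: tsum_TB left_mult_eq)
  have eq2: "left_mult A TB a Z = lactB a Z" if "Z \<in> carrier TB" for a Z
    using that by (simp add: left_mult_def lactB_def tsum_TB)
  have eq3: "coact_tensor_coinv k A C \<rho> Z = coactTB Z" if "Z \<in> carrier TB" for Z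
    using that unfolding coact_tensor_coinv_def Let_def tensor_coinv_eq tp_def[symmetric] coactTB_def
    by (simp add: tsum_TB tsum_rho)
  have eq4: "coact_tensor_comult k A C X = coactAC X" if "X \<in> carrier AC" for X
    using that unfolding coact_tensor_comult_def Let_def tp_def[symmetric] coactAC_def
    by (simp add: tsum_AC tsum_Cd)
  have t1: "tsum G Y f = ts TB C G Y f" if "Y \<in> carrier TBC" for G Y f
    by (rule tsum_ts) (use that in \<open>simp_all add: tp_def\<close>)
  have t2: "tsum G Y f = ts AC C G Y f" if "Y \<in> carrier ACC" for G Y f
    by (rule tsum_ts) (use that in \<open>simp_all add: sweedler_simps tp_def[of k AC C]\<close>)
  have 1: "module_comodule_hom k A C TB (left_mult A TB) (coact_tensor_coinv k A C \<rho>)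
        AC (left_mult A AC) (coact_tensor_comult k A C) (canonical_map k A C \<rho>)"
    unfolding module_comodule_hom_def lin_def[symmetric] tp_def[symmetric]
  proof (intro conjI ballI)
    show "lin k TB AC (canonical_map k A C \<rho>)"
      using can_TB_lin by (subst lin_cong[where g = can]) (simp_all add: eq1)
  next
    fix a m assume "a \<in> carrier A" "m \<in> carrier TB"
    then show "canonical_map k A C \<rho> (left_mult A TB a m) = left_mult A AC a (canonical_map k A C \<rho> m)"
      by (simp add: eq1 eq2 left_mult_eq can_lactB)
  next
    fix m assume m: "m \<in> carrier TB"
    then show "coact_tensor_comult k A C (canonical_map k A C \<rho> m) =
      tsum ACC (coact_tensor_coinv k A C \<rho> m) (\<lambda>x c. canonical_map k A C \<rho> x \<boxtimes>\<^bsub>ACC\<^esub> c)"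
      by (simp add: eq1 eq3 eq4 t1 can_colinear)
  qed
  have 2: "module_comodule_hom k A C AC (left_mult A AC) (coact_tensor_comult k A C)
        TB (left_mult A TB) (coact_tensor_coinv k A C \<rho>) sect"
    unfolding module_comodule_hom_def lin_def[symmetric] tp_def[symmetric]
    by (simp add: eq2 eq3 eq4 t2 left_mult_eq sect_lact sect_colinear)
  show ?thesis
    unfolding weak_coalgebra_Galois_def Let_def tensor_coinv_eq tp_def[symmetric]
    using 1 2 by (auto simp: eq1 sect_can intro!: exI[of _ sect])
qed

end

theorem theorem6p1:
  fixes k :: "'k ring" and A :: "('k, 'a) module" and C :: "('k, 'c) coalgebra"
    and \<psi>R :: "('c, 'a) tens \<Rightarrow> ('a, 'c) tens" and \<psi>L :: "('a, 'c) tens \<Rightarrow> ('c, 'a) tens"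
    and \<rho> :: "'a \<Rightarrow> ('a, 'c) tens"
  assumes entwining: "invertible_weak_entwining k A C \<psi>R \<psi>L"
    and entwined: "weak_entwined_module k A C \<psi>R A (\<otimes>\<^bsub>A\<^esub>) \<rho>"
    and flat: "flat_module TYPE(('k + 'a + 'c) list set) k C"
    and projective: "projective_left_comodule TYPE(('k + 'a + 'c) list set) k C C (comult C)"
    and coinvariants:
      "bij_betw (\<lambda>X. tsum (tensor k A A) X (\<lambda>a b. a \<boxtimes>\<^bsub>tensor k A A\<^esub> b))
         (carrier (tensor k A (coinvariants k A C \<rho>))) (coinvariants_tensor k A C \<psi>R \<rho>)"
    and surjective:
      "canonical_map k A C \<rho> ` carrier (tensor k A A) = carrier (coring k A C \<psi>R)"
  shows "weak_coalgebra_Galois k A C \<rho> \<and>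
    relatively_projective TYPE('n) k (coinvariants k A C \<rho>) (left_regular A)"
proof -
  interpret galois_setup k A C \<psi>R \<psi>L \<rho>
    by (rule galois_setup.intro[OF entwining entwined])
  \<comment> \<open>\<open>pa\<close> and \<open>pc\<close> read a letter as an element of A or of
    C; on the other summands they take a default value, and only surjectivity matters.\<close>
  define pa where "pa x = (case x of Inr (Inl a) \<Rightarrow> a | _ \<Rightarrow> undefined)" for x :: "'k + 'a + 'c"
  define pc where "pc x = (case x of Inr (Inr c) \<Rightarrow> c | _ \<Rightarrow> undefined)" for x :: "'k + 'a + 'c"
  have pa: "surj pa" by (rule surjI[of _ "\<lambda>a. Inr (Inl a)"]) (simp add: pa_def)
  have pc: "surj pc" by (rule surjI[of _ "\<lambda>c. Inr (Inr c)"]) (simp add: pc_def)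
  \<comment> \<open>Only A \<otimes> A and C \<otimes> A have to be encoded: the source and the
    target of \<theta>.\<close>
  obtain h where "lin k C (tp k A A) h" "\<And>c. c \<in> carrier C \<Longrightarrow> can (h c) = \<psi>R (c \<boxtimes>\<^bsub>tp k C A\<^esub> \<one>\<^bsub>A\<^esub>)"
    "\<And>c. c \<in> carrier C \<Longrightarrow> gA (h c) = ts C C (tp k C (tp k A A)) (comult C c) (\<lambda>c x. c \<boxtimes>\<^bsub>tp k C (tp k A A)\<^esub> h x)"
    by (rule exists_lift[OF projective surjective[folded tp_def]
          inj_on_tensor_list[OF A_module A_module pa pa] inj_on_tensor_list[OF C_module A_module pc pa]]) blast
  then interpret galois_coinvariants k A C \<psi>R \<psi>L \<rho> h
    by (intro galois_coinvariants.intro galois_coinvariants_axioms.intro galois_split.intro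
      galois_split_axioms.intro
        galois_setup_axioms coinvariants)
  show ?thesis
    using weak_Galois relatively_projective_A unfolding B_def by simp
qed

end
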